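(* Let $\mathbb K$ be a field with $\mathrm{Char}\,\mathbb K\ne2$ and $\sqrt{-1}\notin\mathbb K$, and let $A=A(\mathbf q,\mathbf a)$ be a quantum complete intersection over $\mathbb K$. Then $A$ admits a bi-Frobenius algebra structure with permutation antipode if and only if $\mathcal N^2=\mathrm{Id}$ and there is a compatible permutation $\pi\in S_n$ with $\pi^2=\mathrm{Id}$ such that the following conditions are satisfied: (1) $|I_3|+|I_4|=0$; (2) $|I_1|\ne0$ or $\frac{|J_3|}{2}$ is even, where $I_1,I_3,I_4,J_3$ are the subsets of $\{1,\dots,n\}$ determined by $\pi$ as defined in the context. If this is the case, then, for such $\pi$ and for some $c_i\in\mathbb K$ ($1\le i\le n$) with $c_ic_{\pi(i)}=h_{\mathbf e_i}$ for all $i$ and $q_\pi\prod_{1\le i\le n}c_i^{a_i-1}=1$, the quadruple $(A,\ x_{\mathbf a-\mathbf 1}^*,\ x_{\mathbf a-\mathbf 1},\ S)$ is a bi-Frobenius algebra, where the coalgebra structure $(\Delta,\varepsilon)$ and the map $S$ are those attached to $(\pi,c_1,\dots,c_n)$ as defined in the context.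
   Context: **Quantum complete intersections.** Let $\mathbb K$ be a field, $n\ge 2$ an integer, $\mathbf a=(a_1,\dots,a_n)$ an integer vector with all $a_i\ge 2$, and $\mathbf q=(q_{ij})$ an $n\times n$ matrix over $\mathbb K$ with $q_{ii}=1$ and $q_{ij}q_{ji}=1$ for all $i,j$. The quantum complete intersection $A=A(\mathbf q,\mathbf a)$ is the $\mathbb K$-algebra $\mathbb K\langle x_1,\dots,x_n\rangle/\langle x_i^{a_i},\ x_jx_i-q_{ij}x_ix_j,\ 1\le i,j\le n\rangle$. Put $V=\{\mathbf v=(v_1,\dots,v_n)\in\mathbb N_0^n: v_i\le a_i-1,\ 1\le i\le n\}$ and $x_{\mathbf v}=x_1^{v_1}\cdots x_n^{v_n}$. Then $\{x_{\mathbf v}:\mathbf v\in V\}$ is a $\mathbb K$-basis of $A$ (the standard basis); $\{x_{\mathbf v}^*\}$ denotes the dual basis of $A^*=\mathrm{Hom}_{\mathbb K}(A,\mathbb K)$. Write $\mathbf 0=(0,\dots,0)$, $\mathbf 1=(1,\dots,1)$, and $\mathbf e_i$ for the $i$-th unit vector. **Structure coefficients and $\mathcal N$.** For $\mathbf u,\mathbf v\in\mathbb Z^n$: $\mathbf q^{\langle\mathbf u|\mathbf v\rangle}=\prod_{1\le i<j\le n}q_{ij}^{u_jv_i}$ and $h_{\mathbf v}=\mathbf q^{\langle\mathbf a-\mathbf 1-\mathbf v|\mathbf v\rangle}/\mathbf q^{\langle\mathbf v|\mathbf a-\mathbf 1-\mathbf v\rangle}$; in particular $h_{\mathbf e_i}=\prod_{1\le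 j\le n}q_{ij}^{a_j-1}$. The canonical Nakayama automorphism $\mathcal N$ of $A$ is the Nakayama automorphism with respect to the Frobenius form $x_{\mathbf a-\mathbf 1}^*$ (i.e. $x^*_{\mathbf a-\mathbf 1}(xy)=x^*_{\mathbf a-\mathbf 1}(y\mathcal N(x))$); it is given by $\mathcal N(x_{\mathbf v})=h_{\mathbf v}x_{\mathbf v}$, $\mathbf v\in V$. Thus $\mathcal N^2=\mathrm{Id}$ iff $h_{\mathbf e_i}^2=1$ for all $i$. **Permutations.** $\pi\in S_n$ acts on $\mathbb Z^n$ by $\pi(\mathbf v)=(v_{\pi^{-1}(1)},\dots,v_{\pi^{-1}(n)})$, so $\pi(\mathbf e_i)=\mathbf e_{\pi(i)}$. It is compatible (with $A$) if $a_{\pi(i)}=a_i$ and $q_{\pi(i)\pi(j)}=q_{ji}$ for all $1\le i,j\le n$ (then $\pi$ maps $V$ to $V$). Put $q_\pi=\prod_{1\le j<k\le n}(\mathbf q^{\langle\pi(\mathbf e_k)|\pi(\mathbf e_j)\rangle})^{(a_k-1)(a_j-1)}$. **The index sets.** For a compatible $\pi$ with $\pi^2=\mathrm{Id}$, let $I=\{i:\pi(i)=i\}$, $J=\{i:\pi(i)\ne i\}$ (subsets of $\{1,\dots,n\}$), and $I_1=\{i\in I: h_{\mathbf e_i}=1,\ a_i\text{ even}\}$, $I_3=\{i\in I:h_{\mathbf e_i}=-1,\ a_i\text{ even}\}$, $I_4=\{i\in I:h_{\mathbf e_i}=-1,\ a_i\text{ odd}\}$, $J_3=\{i\in J:h_{\mathbf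 e_i}=-1,\ a_i\text{ even}\}$. ($|X|$ is the cardinality of $X$.) **Bi-Frobenius algebras.** Let $A$ be a finite-dimensional algebra which is also a coalgebra $(A,\Delta,\varepsilon)$ over $\mathbb K$, let $t\in A$, $\phi\in A^*$, and let $S:A\to A$ be the linear map $S(a)=\sum\phi(t_1a)t_2$ (Sweedler notation $\Delta(t)=\sum t_1\otimes t_2$). $(A,\phi,t,S)$ is a bi-Frobenius algebra (with antipode $S$) if: (i) $\varepsilon$ is an algebra homomorphism and $\Delta(1_A)=1_A\otimes 1_A$; (ii) $(A,\phi)$ is a Frobenius algebra, i.e. every element of $A^*$ has the form $x\mapsto\phi(bx)$ for some $b\in A$, and $(A,t)$ is a Frobenius coalgebra, i.e. $A=\{\sum f(t_1)t_2: f\in A^*\}$; (iii) $S$ is an algebra anti-homomorphism ($S(1)=1$, $S(ab)=S(b)S(a)$) and a coalgebra anti-homomorphism ($\varepsilon\circ S=\varepsilon$, $\Delta(S(a))=\sum S(a_2)\otimes S(a_1)$). A bi-Frobenius algebra structure on the algebra $A$ is a choice of coalgebra structure, $\phi$, $t$ making $(A,\phi,t,S)$ a bi-Frobenius algebra. **Permutation antipode.** For a bi-Frobenius algebra structure on $A(\mathbf q,\mathbf a)$, $S$ is a permutation antipode if there are a permutation $\pi$ of the set $V$ and $c_{\mathbf v}\in\mathbb K$ ($\mathbf v\in V$) with $S(x_{\mathbf v})=c_{\mathbf v}x_{\pi(\mathbf v)}$ for all $\mathbf v\in V$. **Structure attached to $(\pi,c_1,\dots,c_n)$.** Let $\pi\in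 S_n$ be compatible with $\pi^2=\mathrm{Id}$ and $c_i\in\mathbb K$ with $c_ic_{\pi(i)}=h_{\mathbf e_i}$ for all $i$ and $q_\pi\prod_ic_i^{a_i-1}=1$. For $\mathbf v\in V$ put $$g_{\mathbf a-\mathbf 1-\mathbf v,\pi(\mathbf v)}=\frac{1}{\mathbf q^{\langle\mathbf a-\mathbf 1-\mathbf v|\mathbf v\rangle}}\prod_{1\le i\le n}c_i^{v_i}\prod_{1\le j<k\le n}(\mathbf q^{\langle\pi(\mathbf e_k)|\pi(\mathbf e_j)\rangle})^{v_jv_k}.$$ Define linear maps: $\varepsilon(x_{\mathbf v})=\delta_{\mathbf v,\mathbf 0}$; $\Delta(1_A)=1_A\otimes1_A$; $\Delta(x_{\mathbf v})=1_A\otimes x_{\mathbf v}+x_{\mathbf v}\otimes1_A$ for $\mathbf v\in V\setminus\{\mathbf 0,\mathbf a-\mathbf 1\}$; $\Delta(x_{\mathbf a-\mathbf 1})=\sum_{\mathbf v\in V}g_{\mathbf a-\mathbf 1-\mathbf v,\pi(\mathbf v)}\,x_{\mathbf a-\mathbf 1-\mathbf v}\otimes x_{\pi(\mathbf v)}$; and $$S(x_{\mathbf v})=\prod_{1\le i\le n}c_i^{v_i}\prod_{1\le j<k\le n}(\mathbf q^{\langle\pi(\mathbf e_k)|\pi(\mathbf e_j)\rangle})^{v_jv_k}\,x_{\pi(\mathbf v)},\quad\mathbf v\in V.$$ *)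

theory Defs
  imports
    "HOL-Algebra.QuotRing"
    "HOL-Algebra.Module"
    "HOL-Library.Poly_Mapping"
    "HOL-Combinatorics.Permutations"
begin

section \<open>Vector spaces over a field type\<close>

text \<open>
  The ground field is a type \<open>'k\<close> of class \<^class>\<open>field\<close>. Vector spaces and algebras over it are
  \<open>('k, 'a) module\<close> records of \<^theory>\<open>HOL-Algebra.Module\<close>, regarded over the ring \<open>scalars\<close>
  (the field \<open>'k\<close> itself, which is also a vector space over itself). For records that are only
  vector spaces the fields \<open>mult\<close> and \<open>one\<close> are irrelevant.
\<close>

definition scalars :: "('k::field, 'k) module" where
  "scalars = \<lparr>carrier = UNIV, monoid.mult = (*), monoid.one = 1, ring.zero = 0, ring.add = (+), smult = (*)\<rparr>"

definition k_algebra :: "('k::field, 'a) module \<Rightarrow> bool" where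
  "k_algebra A \<longleftrightarrow> ring A \<and> Module.module scalars A \<and>
     (\<forall>c. \<forall>x\<in>carrier A. \<forall>y\<in>carrier A.
        (c \<odot>\<^bsub>A\<^esub> x) \<otimes>\<^bsub>A\<^esub> y = c \<odot>\<^bsub>A\<^esub> (x \<otimes>\<^bsub>A\<^esub> y) \<and>
        x \<otimes>\<^bsub>A\<^esub> (c \<odot>\<^bsub>A\<^esub> y) = c \<odot>\<^bsub>A\<^esub> (x \<otimes>\<^bsub>A\<^esub> y))"

definition finite_dim :: "('k::field, 'a) module \<Rightarrow> bool" where
  "finite_dim M \<longleftrightarrow> (\<exists>B. finite B \<and> B \<subseteq> carrier M \<and>
     (\<forall>x\<in>carrier M. \<exists>c. x = (\<Oplus>\<^bsub>M\<^esub>b\<in>B. c b \<odot>\<^bsub>M\<^esub> b)))"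

definition linear_map :: "('k::field, 'a) module \<Rightarrow> ('k, 'b) module \<Rightarrow> ('a \<Rightarrow> 'b) \<Rightarrow> bool" where
  "linear_map M N f \<longleftrightarrow> (\<forall>x\<in>carrier M. f x \<in> carrier N) \<and>
     (\<forall>x\<in>carrier M. \<forall>y\<in>carrier M. f (x \<oplus>\<^bsub>M\<^esub> y) = f x \<oplus>\<^bsub>N\<^esub> f y) \<and>
     (\<forall>c. \<forall>x\<in>carrier M. f (c \<odot>\<^bsub>M\<^esub> x) = c \<odot>\<^bsub>N\<^esub> f x)"

definition dual_space :: "('k::field, 'a) module \<Rightarrow> ('a \<Rightarrow> 'k) set" where
  "dual_space M = {f. linear_map M scalars f}"

text \<open>
  For an ideal \<open>H\<close> of an algebra this is \<^const>\<open>FactRing\<close> together with the induced scalar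
  multiplication; for a subspace \<open>H\<close> of a vector space it is the quotient space.
\<close>

definition quot_module :: "('k::field, 'a) module \<Rightarrow> 'a set \<Rightarrow> ('k, 'a set) module" where
  "quot_module M H =
     \<lparr>carrier = a_rcosets\<^bsub>M\<^esub> H, monoid.mult = rcoset_mult M H, monoid.one = H +>\<^bsub>M\<^esub> \<one>\<^bsub>M\<^esub>, ring.zero = H,
      ring.add = set_add M, smult = (\<lambda>c X. \<Union>x\<in>X. H +>\<^bsub>M\<^esub> (c \<odot>\<^bsub>M\<^esub> x))\<rparr>"


section \<open>Tensor products\<close>

definition free_module :: "'x set \<Rightarrow> ('k::field, 'x \<Rightarrow>\<^sub>0 'k) module" where
  "free_module X =
     \<lparr>carrier = {p. Poly_Mapping.keys p \<subseteq> X}, monoid.mult = undefined, monoid.one = undefined, ring.zero = 0, ring.add = (+),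
      smult = (\<lambda>c. Poly_Mapping.map ((*) c))\<rparr>"

definition tensor_relations ::
    "('k::field, 'a) module \<Rightarrow> ('k, 'b) module \<Rightarrow> ('a \<times> 'b \<Rightarrow>\<^sub>0 'k) set" where
  "tensor_relations M N =
     {Poly_Mapping.single (x \<oplus>\<^bsub>M\<^esub> x', y) 1 - Poly_Mapping.single (x, y) 1 - Poly_Mapping.single (x', y) 1
        | x x' y. x \<in> carrier M \<and> x' \<in> carrier M \<and> y \<in> carrier N} \<union>
     {Poly_Mapping.single (x, y \<oplus>\<^bsub>N\<^esub> y') 1 - Poly_Mapping.single (x, y) 1 - Poly_Mapping.single (x, y') 1
        | x y y'. x \<in> carrier M \<and> y \<in> carrier N \<and> y' \<in> carrier N} \<union>
     {Poly_Mapping.single (c \<odot>\<^bsub>M\<^esub> x, y) 1 - Poly_Mapping.single (x, y) c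
        | c x y. x \<in> carrier M \<and> y \<in> carrier N} \<union>
     {Poly_Mapping.single (x, c \<odot>\<^bsub>N\<^esub> y) 1 - Poly_Mapping.single (x, y) c
        | c x y. x \<in> carrier M \<and> y \<in> carrier N}"

definition tensor_kernel ::
    "('k::field, 'a) module \<Rightarrow> ('k, 'b) module \<Rightarrow> ('a \<times> 'b \<Rightarrow>\<^sub>0 'k) set" where
  "tensor_kernel M N =
     \<Inter>{H. submodule H scalars (free_module (carrier M \<times> carrier N)) \<and> tensor_relations M N \<subseteq> H}"

definition tensor ::
    "('k::field, 'a) module \<Rightarrow> ('k, 'b) module \<Rightarrow> ('k, ('a \<times> 'b \<Rightarrow>\<^sub>0 'k) set) module" where
  "tensor M N = quot_module (free_module (carrier M \<times> carrier N)) (tensor_kernel M N)"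

definition pure_tensor ::
    "('k::field, 'a) module \<Rightarrow> ('k, 'b) module \<Rightarrow> 'a \<Rightarrow> 'b \<Rightarrow> ('a \<times> 'b \<Rightarrow>\<^sub>0 'k) set" where
  "pure_tensor M N x y =
     tensor_kernel M N +>\<^bsub>free_module (carrier M \<times> carrier N)\<^esub> Poly_Mapping.single (x, y) 1"

text \<open>
  Sweedler notation: for \<open>X = \<Sum> x\<^sub>1 \<otimes> x\<^sub>2\<close> in \<open>M \<otimes> N\<close> and a bilinear map \<open>\<beta>\<close> into \<open>P\<close>,
  \<open>sweedler P X \<beta>\<close> is \<open>\<Sum> \<beta> x\<^sub>1 x\<^sub>2\<close>. By bilinearity the value does not depend on the representative
  chosen; the definition is used for bilinear \<open>\<beta>\<close> only.
\<close>

definition sweedler ::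
    "('k::field, 'c) module \<Rightarrow> ('a \<times> 'b \<Rightarrow>\<^sub>0 'k) set \<Rightarrow> ('a \<Rightarrow> 'b \<Rightarrow> 'c) \<Rightarrow> 'c" where
  "sweedler P X \<beta> =
     (let p = (SOME p. p \<in> X)
      in \<Oplus>\<^bsub>P\<^esub>xy\<in>Poly_Mapping.keys p. Poly_Mapping.lookup p xy \<odot>\<^bsub>P\<^esub> \<beta> (fst xy) (snd xy))"


section \<open>Coalgebras and bi-Frobenius algebras\<close>

text \<open>
  Coassociativity is stated in \<open>C \<otimes> (C \<otimes> C)\<close>, i.e. after the canonical identification
  of \<open>(C \<otimes> C) \<otimes> C\<close> with it: \<open>\<Sum> x\<^sub>1\<^sub>1 \<otimes> (x\<^sub>1\<^sub>2 \<otimes> x\<^sub>2) = \<Sum> x\<^sub>1 \<otimes> (x\<^sub>2\<^sub>1 \<otimes> x\<^sub>2\<^sub>2)\<close>.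
\<close>

definition coalgebra ::
    "('k::field, 'a) module \<Rightarrow> ('a \<Rightarrow> ('a \<times> 'a \<Rightarrow>\<^sub>0 'k) set) \<Rightarrow> ('a \<Rightarrow> 'k) \<Rightarrow> bool" where
  "coalgebra C \<Delta> \<epsilon> \<longleftrightarrow> Module.module scalars C \<and>
     linear_map C (tensor C C) \<Delta> \<and> linear_map C scalars \<epsilon> \<and>
     (let CC = tensor C C; CCC = tensor C CC in
      \<forall>x\<in>carrier C.
        sweedler CCC (\<Delta> x) (\<lambda>y z. sweedler CCC (\<Delta> y)
          (\<lambda>y1 y2. pure_tensor C CC y1 (pure_tensor C C y2 z))) =
        sweedler CCC (\<Delta> x) (\<lambda>y z. sweedler CCC (\<Delta> z)
          (\<lambda>z1 z2. pure_tensor C CC y (pure_tensor C C z1 z2)))) \<and>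
     (\<forall>x\<in>carrier C. sweedler C (\<Delta> x) (\<lambda>y z. \<epsilon> y \<odot>\<^bsub>C\<^esub> z) = x \<and>
                    sweedler C (\<Delta> x) (\<lambda>y z. \<epsilon> z \<odot>\<^bsub>C\<^esub> y) = x)"

definition frobenius_algebra :: "('k::field, 'a) module \<Rightarrow> ('a \<Rightarrow> 'k) \<Rightarrow> bool" where
  "frobenius_algebra A \<phi> \<longleftrightarrow>
     (\<forall>f\<in>dual_space A. \<exists>b\<in>carrier A. \<forall>x\<in>carrier A. f x = \<phi> (b \<otimes>\<^bsub>A\<^esub> x))"

definition frobenius_coalgebra ::
    "('k::field, 'a) module \<Rightarrow> ('a \<Rightarrow> ('a \<times> 'a \<Rightarrow>\<^sub>0 'k) set) \<Rightarrow> 'a \<Rightarrow> bool" where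
  "frobenius_coalgebra C \<Delta> t \<longleftrightarrow>
     carrier C = {sweedler C (\<Delta> t) (\<lambda>t1 t2. f t1 \<odot>\<^bsub>C\<^esub> t2) | f. f \<in> dual_space C}"

definition bi_frobenius_algebra ::
    "('k::field, 'a) module \<Rightarrow> ('a \<Rightarrow> ('a \<times> 'a \<Rightarrow>\<^sub>0 'k) set) \<Rightarrow> ('a \<Rightarrow> 'k) \<Rightarrow>
     ('a \<Rightarrow> 'k) \<Rightarrow> 'a \<Rightarrow> ('a \<Rightarrow> 'a) \<Rightarrow> bool" where
  "bi_frobenius_algebra A \<Delta> \<epsilon> \<phi> t S \<longleftrightarrow>
     k_algebra A \<and> finite_dim A \<and> coalgebra A \<Delta> \<epsilon> \<and> t \<in> carrier A \<and> \<phi> \<in> dual_space A \<and>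
     (\<forall>x\<in>carrier A. S x = sweedler A (\<Delta> t) (\<lambda>t1 t2. \<phi> (t1 \<otimes>\<^bsub>A\<^esub> x) \<odot>\<^bsub>A\<^esub> t2)) \<and>
     \<epsilon> \<one>\<^bsub>A\<^esub> = 1 \<and> (\<forall>x\<in>carrier A. \<forall>y\<in>carrier A. \<epsilon> (x \<otimes>\<^bsub>A\<^esub> y) = \<epsilon> x * \<epsilon> y) \<and>
     \<Delta> \<one>\<^bsub>A\<^esub> = pure_tensor A A \<one>\<^bsub>A\<^esub> \<one>\<^bsub>A\<^esub> \<and>
     frobenius_algebra A \<phi> \<and> frobenius_coalgebra A \<Delta> t \<and>
     S \<one>\<^bsub>A\<^esub> = \<one>\<^bsub>A\<^esub> \<and> (\<forall>x\<in>carrier A. \<forall>y\<in>carrier A. S (x \<otimes>\<^bsub>A\<^esub> y) = S y \<otimes>\<^bsub>A\<^esub> S x) \<and>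
     (\<forall>x\<in>carrier A. \<epsilon> (S x) = \<epsilon> x) \<and>
     (\<forall>x\<in>carrier A. \<Delta> (S x) = sweedler (tensor A A) (\<Delta> x) (\<lambda>x1 x2. pure_tensor A A (S x2) (S x1)))"

definition nakayama :: "('k::field, 'a) module \<Rightarrow> ('a \<Rightarrow> 'k) \<Rightarrow> 'a \<Rightarrow> 'a" where
  "nakayama A \<phi> x = (THE z. z \<in> carrier A \<and> (\<forall>y\<in>carrier A. \<phi> (x \<otimes>\<^bsub>A\<^esub> y) = \<phi> (y \<otimes>\<^bsub>A\<^esub> z)))"


section \<open>Quantum complete intersections\<close>

text \<open>
  The index set \<open>{1, \<dots>, n}\<close> is an arbitrary finite linearly ordered type \<open>'n\<close> (so \<open>n = card UNIV\<close>).
  The free algebra \<open>K\<langle>x\<^sub>1, \<dots>, x\<^sub>n\<rangle>\<close> has the words in the letters \<open>'n\<close> as a basis.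
\<close>

definition free_algebra :: "('k::field, 'n list \<Rightarrow>\<^sub>0 'k) module" where
  "free_algebra =
     \<lparr>carrier = UNIV,
      monoid.mult = (\<lambda>f g. \<Sum>u\<in>Poly_Mapping.keys f. \<Sum>w\<in>Poly_Mapping.keys g. Poly_Mapping.single (u @ w) (Poly_Mapping.lookup f u * Poly_Mapping.lookup g w)),
      monoid.one = Poly_Mapping.single [] 1, ring.zero = 0, ring.add = (+),
      smult = (\<lambda>c. Poly_Mapping.map ((*) c))\<rparr>"

definition free_gen :: "'n \<Rightarrow> ('n list \<Rightarrow>\<^sub>0 'k::field)" where
  "free_gen i = Poly_Mapping.single [i] 1"

definition qci_relations :: "('n \<Rightarrow> 'n \<Rightarrow> 'k::field) \<Rightarrow> ('n \<Rightarrow> nat) \<Rightarrow> ('n list \<Rightarrow>\<^sub>0 'k) set" where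
  "qci_relations q a =
     {free_gen i [^]\<^bsub>free_algebra\<^esub> a i | i. True} \<union>
     {free_gen j \<otimes>\<^bsub>free_algebra\<^esub> free_gen i \<ominus>\<^bsub>free_algebra\<^esub>
        q i j \<odot>\<^bsub>free_algebra\<^esub> (free_gen i \<otimes>\<^bsub>free_algebra\<^esub> free_gen j) | i j. True}"

definition qci_ideal :: "('n \<Rightarrow> 'n \<Rightarrow> 'k::field) \<Rightarrow> ('n \<Rightarrow> nat) \<Rightarrow> ('n list \<Rightarrow>\<^sub>0 'k) set" where
  "qci_ideal q a = genideal free_algebra (qci_relations q a)"

definition qci ::
    "('n \<Rightarrow> 'n \<Rightarrow> 'k::field) \<Rightarrow> ('n \<Rightarrow> nat) \<Rightarrow> ('k, ('n list \<Rightarrow>\<^sub>0 'k) set) module" where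
  "qci q a = quot_module free_algebra (qci_ideal q a)"

definition qci_gen ::
    "('n \<Rightarrow> 'n \<Rightarrow> 'k::field) \<Rightarrow> ('n \<Rightarrow> nat) \<Rightarrow> 'n \<Rightarrow> ('n list \<Rightarrow>\<^sub>0 'k) set" where
  "qci_gen q a i = qci_ideal q a +>\<^bsub>free_algebra\<^esub> free_gen i"

definition exponents :: "('n \<Rightarrow> nat) \<Rightarrow> ('n \<Rightarrow> nat) set" where
  "exponents a = {v. \<forall>i. v i \<le> a i - 1}"

definition qci_monom ::
    "('n::{finite,linorder} \<Rightarrow> 'n \<Rightarrow> 'k::field) \<Rightarrow> ('n \<Rightarrow> nat) \<Rightarrow> ('n \<Rightarrow> nat) \<Rightarrow> ('n list \<Rightarrow>\<^sub>0 'k) set" where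
  "qci_monom q a v =
     foldr (\<lambda>i y. qci_gen q a i [^]\<^bsub>qci q a\<^esub> v i \<otimes>\<^bsub>qci q a\<^esub> y)
       (sorted_list_of_set UNIV) \<one>\<^bsub>qci q a\<^esub>"

definition qci_coords ::
    "('n::{finite,linorder} \<Rightarrow> 'n \<Rightarrow> 'k::field) \<Rightarrow> ('n \<Rightarrow> nat) \<Rightarrow> ('n list \<Rightarrow>\<^sub>0 'k) set \<Rightarrow> ('n \<Rightarrow> nat) \<Rightarrow> 'k" where
  "qci_coords q a x =
     (THE c. (\<forall>v. v \<notin> exponents a \<longrightarrow> c v = 0) \<and>
        x = (\<Oplus>\<^bsub>qci q a\<^esub>v\<in>exponents a. c v \<odot>\<^bsub>qci q a\<^esub> qci_monom q a v))"

definition qci_dual_monom ::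
    "('n::{finite,linorder} \<Rightarrow> 'n \<Rightarrow> 'k::field) \<Rightarrow> ('n \<Rightarrow> nat) \<Rightarrow> ('n \<Rightarrow> nat) \<Rightarrow> ('n list \<Rightarrow>\<^sub>0 'k) set \<Rightarrow> 'k" where
  "qci_dual_monom q a v x = qci_coords q a x v"

text \<open>The linear map from \<open>qci q a\<close> to \<open>P\<close> with prescribed values \<open>f v\<close> on the standard basis.\<close>

definition qci_extend ::
    "('n::{finite,linorder} \<Rightarrow> 'n \<Rightarrow> 'k::field) \<Rightarrow> ('n \<Rightarrow> nat) \<Rightarrow> ('k, 'b) module \<Rightarrow>
     (('n \<Rightarrow> nat) \<Rightarrow> 'b) \<Rightarrow> ('n list \<Rightarrow>\<^sub>0 'k) set \<Rightarrow> 'b" where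
  "qci_extend q a P f x = (\<Oplus>\<^bsub>P\<^esub>v\<in>exponents a. qci_dual_monom q a v x \<odot>\<^bsub>P\<^esub> f v)"

text \<open>The exponent vector of the socle monomial \<open>x\<^bsub>a-1\<^esub>\<close>.\<close>

definition top_exp :: "('n \<Rightarrow> nat) \<Rightarrow> 'n \<Rightarrow> nat" where
  "top_exp a = (\<lambda>i. a i - 1)"

definition qci_nakayama ::
    "('n::{finite,linorder} \<Rightarrow> 'n \<Rightarrow> 'k::field) \<Rightarrow> ('n \<Rightarrow> nat) \<Rightarrow> ('n list \<Rightarrow>\<^sub>0 'k) set \<Rightarrow> ('n list \<Rightarrow>\<^sub>0 'k) set" where
  "qci_nakayama q a = nakayama (qci q a) (qci_dual_monom q a (top_exp a))"

definition permutation_antipode ::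
    "('n::{finite,linorder} \<Rightarrow> 'n \<Rightarrow> 'k::field) \<Rightarrow> ('n \<Rightarrow> nat) \<Rightarrow>
     (('n list \<Rightarrow>\<^sub>0 'k) set \<Rightarrow> ('n list \<Rightarrow>\<^sub>0 'k) set) \<Rightarrow> bool" where
  "permutation_antipode q a S \<longleftrightarrow>
     (\<exists>p c. p permutes exponents a \<and>
        (\<forall>v\<in>exponents a. S (qci_monom q a v) = c v \<odot>\<^bsub>qci q a\<^esub> qci_monom q a (p v)))"


section \<open>Structure coefficients, permutations and index sets\<close>

definition q_pairing ::
    "('n::{finite,linorder} \<Rightarrow> 'n \<Rightarrow> 'k::field) \<Rightarrow> ('n \<Rightarrow> int) \<Rightarrow> ('n \<Rightarrow> int) \<Rightarrow> 'k" where
  "q_pairing q u v = (\<Prod>(i, j)\<in>{(i, j). i < j}. q i j powi (u j * v i))"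

definition unit_vec :: "'n \<Rightarrow> 'n \<Rightarrow> int" where
  "unit_vec i = (\<lambda>j. if j = i then 1 else 0)"

definition h_coeff ::
    "('n::{finite,linorder} \<Rightarrow> 'n \<Rightarrow> 'k::field) \<Rightarrow> ('n \<Rightarrow> nat) \<Rightarrow> ('n \<Rightarrow> int) \<Rightarrow> 'k" where
  "h_coeff q a v =
     q_pairing q (\<lambda>i. int (a i) - 1 - v i) v / q_pairing q v (\<lambda>i. int (a i) - 1 - v i)"

definition perm_vec :: "('n \<Rightarrow> 'n) \<Rightarrow> ('n \<Rightarrow> 'b) \<Rightarrow> 'n \<Rightarrow> 'b" where
  "perm_vec \<pi> v = (\<lambda>i. v (inv_into UNIV \<pi> i))"

definition compatible_perm ::
    "('n \<Rightarrow> 'n \<Rightarrow> 'k) \<Rightarrow> ('n \<Rightarrow> nat) \<Rightarrow> ('n \<Rightarrow> 'n) \<Rightarrow> bool" where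
  "compatible_perm q a \<pi> \<longleftrightarrow> \<pi> permutes UNIV \<and>
     (\<forall>i. a (\<pi> i) = a i) \<and> (\<forall>i j. q (\<pi> i) (\<pi> j) = q j i)"

definition q_perm ::
    "('n::{finite,linorder} \<Rightarrow> 'n \<Rightarrow> 'k::field) \<Rightarrow> ('n \<Rightarrow> nat) \<Rightarrow> ('n \<Rightarrow> 'n) \<Rightarrow> 'k" where
  "q_perm q a \<pi> = (\<Prod>(j, k)\<in>{(j, k). j < k}.
     q_pairing q (perm_vec \<pi> (unit_vec k)) (perm_vec \<pi> (unit_vec j)) ^ ((a k - 1) * (a j - 1)))"

definition fixed_indices :: "('n \<Rightarrow> 'n) \<Rightarrow> 'n set" where
  "fixed_indices \<pi> = {i. \<pi> i = i}"

definition moved_indices :: "('n \<Rightarrow> 'n) \<Rightarrow> 'n set" where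
  "moved_indices \<pi> = {i. \<pi> i \<noteq> i}"

definition I1 :: "('n::{finite,linorder} \<Rightarrow> 'n \<Rightarrow> 'k::field) \<Rightarrow> ('n \<Rightarrow> nat) \<Rightarrow> ('n \<Rightarrow> 'n) \<Rightarrow> 'n set" where
  "I1 q a \<pi> = {i \<in> fixed_indices \<pi>. h_coeff q a (unit_vec i) = 1 \<and> even (a i)}"

definition I3 :: "('n::{finite,linorder} \<Rightarrow> 'n \<Rightarrow> 'k::field) \<Rightarrow> ('n \<Rightarrow> nat) \<Rightarrow> ('n \<Rightarrow> 'n) \<Rightarrow> 'n set" where
  "I3 q a \<pi> = {i \<in> fixed_indices \<pi>. h_coeff q a (unit_vec i) = -1 \<and> even (a i)}"

definition I4 :: "('n::{finite,linorder} \<Rightarrow> 'n \<Rightarrow> 'k::field) \<Rightarrow> ('n \<Rightarrow> nat) \<Rightarrow> ('n \<Rightarrow> 'n) \<Rightarrow> 'n set" where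
  "I4 q a \<pi> = {i \<in> fixed_indices \<pi>. h_coeff q a (unit_vec i) = -1 \<and> odd (a i)}"

definition J3 :: "('n::{finite,linorder} \<Rightarrow> 'n \<Rightarrow> 'k::field) \<Rightarrow> ('n \<Rightarrow> nat) \<Rightarrow> ('n \<Rightarrow> 'n) \<Rightarrow> 'n set" where
  "J3 q a \<pi> = {i \<in> moved_indices \<pi>. h_coeff q a (unit_vec i) = -1 \<and> even (a i)}"


section \<open>The structure attached to a permutation and scalars\<close>

definition antipode_coeff ::
    "('n::{finite,linorder} \<Rightarrow> 'n \<Rightarrow> 'k::field) \<Rightarrow> ('n \<Rightarrow> 'n) \<Rightarrow> ('n \<Rightarrow> 'k) \<Rightarrow> ('n \<Rightarrow> nat) \<Rightarrow> 'k" where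
  "antipode_coeff q \<pi> c v = (\<Prod>i\<in>UNIV. c i ^ v i) *
     (\<Prod>(j, k)\<in>{(j, k). j < k}.
        q_pairing q (perm_vec \<pi> (unit_vec k)) (perm_vec \<pi> (unit_vec j)) ^ (v j * v k))"

text \<open>\<open>g_coeff q a \<pi> c v\<close> is the coefficient written \<open>g\<close> with index pair \<open>(a - 1 - v, \<pi>(v))\<close>.\<close>

definition g_coeff ::
    "('n::{finite,linorder} \<Rightarrow> 'n \<Rightarrow> 'k::field) \<Rightarrow> ('n \<Rightarrow> nat) \<Rightarrow> ('n \<Rightarrow> 'n) \<Rightarrow> ('n \<Rightarrow> 'k) \<Rightarrow> ('n \<Rightarrow> nat) \<Rightarrow> 'k" where
  "g_coeff q a \<pi> c v =
     1 / q_pairing q (\<lambda>i. int (a i) - 1 - int (v i)) (\<lambda>i. int (v i)) * antipode_coeff q \<pi> c v"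

definition attached_counit ::
    "('n::{finite,linorder} \<Rightarrow> 'n \<Rightarrow> 'k::field) \<Rightarrow> ('n \<Rightarrow> nat) \<Rightarrow> ('n list \<Rightarrow>\<^sub>0 'k) set \<Rightarrow> 'k" where
  "attached_counit q a = qci_extend q a scalars (\<lambda>v. if v = (\<lambda>_. 0) then 1 else 0)"

definition attached_comult_basis ::
    "('n::{finite,linorder} \<Rightarrow> 'n \<Rightarrow> 'k::field) \<Rightarrow> ('n \<Rightarrow> nat) \<Rightarrow> ('n \<Rightarrow> 'n) \<Rightarrow> ('n \<Rightarrow> 'k) \<Rightarrow>
     ('n \<Rightarrow> nat) \<Rightarrow> (('n list \<Rightarrow>\<^sub>0 'k) set \<times> ('n list \<Rightarrow>\<^sub>0 'k) set \<Rightarrow>\<^sub>0 'k) set" where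
  "attached_comult_basis q a \<pi> c v =
     (let A = qci q a; x = qci_monom q a in
      if v = (\<lambda>_. 0) then pure_tensor A A \<one>\<^bsub>A\<^esub> \<one>\<^bsub>A\<^esub>
      else if v = top_exp a then
        (\<Oplus>\<^bsub>tensor A A\<^esub>w\<in>exponents a.
           g_coeff q a \<pi> c w \<odot>\<^bsub>tensor A A\<^esub> pure_tensor A A (x (\<lambda>i. a i - 1 - w i)) (x (perm_vec \<pi> w)))
      else pure_tensor A A \<one>\<^bsub>A\<^esub> (x v) \<oplus>\<^bsub>tensor A A\<^esub> pure_tensor A A (x v) \<one>\<^bsub>A\<^esub>)"

definition attached_comult ::
    "('n::{finite,linorder} \<Rightarrow> 'n \<Rightarrow> 'k::field) \<Rightarrow> ('n \<Rightarrow> nat) \<Rightarrow> ('n \<Rightarrow> 'n) \<Rightarrow> ('n \<Rightarrow> 'k) \<Rightarrow>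
     ('n list \<Rightarrow>\<^sub>0 'k) set \<Rightarrow> (('n list \<Rightarrow>\<^sub>0 'k) set \<times> ('n list \<Rightarrow>\<^sub>0 'k) set \<Rightarrow>\<^sub>0 'k) set" where
  "attached_comult q a \<pi> c =
     qci_extend q a (tensor (qci q a) (qci q a)) (attached_comult_basis q a \<pi> c)"

definition attached_antipode ::
    "('n::{finite,linorder} \<Rightarrow> 'n \<Rightarrow> 'k::field) \<Rightarrow> ('n \<Rightarrow> nat) \<Rightarrow> ('n \<Rightarrow> 'n) \<Rightarrow> ('n \<Rightarrow> 'k) \<Rightarrow>
     ('n list \<Rightarrow>\<^sub>0 'k) set \<Rightarrow> ('n list \<Rightarrow>\<^sub>0 'k) set" where
  "attached_antipode q a \<pi> c =
     qci_extend q a (qci q a)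
       (\<lambda>v. antipode_coeff q \<pi> c v \<odot>\<^bsub>qci q a\<^esub> qci_monom q a (perm_vec \<pi> v))"

text \<open>
  The number \<open>card (J3 q a \<pi>)\<close> is even, because \<open>\<pi>\<close> acts on the set without
  fixed points, so \<open>div 2\<close> is exact.
\<close>

definition admissible_perm ::
    "('n::{finite,linorder} \<Rightarrow> 'n \<Rightarrow> 'k::field) \<Rightarrow> ('n \<Rightarrow> nat) \<Rightarrow> ('n \<Rightarrow> 'n) \<Rightarrow> bool" where
  "admissible_perm q a \<pi> \<longleftrightarrow> compatible_perm q a \<pi> \<and> \<pi> \<circ> \<pi> = id \<and>
     card (I3 q a \<pi>) + card (I4 q a \<pi>) = 0 \<and>
     (card (I1 q a \<pi>) \<noteq> 0 \<or> even (card (J3 q a \<pi>) div 2))"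

end

theory Submission
  imports Defs
begin

text \<open>
  The algebra \<open>A = qci q a\<close> is local, and its socle is spanned by the top monomial \<open>x\<^bsub>a-1\<^esub>\<close>.

  Necessity. Let \<open>(\<Delta>, \<epsilon>, \<phi>, t, S)\<close> be a bi-Frobenius structure with
  \<open>S x\<^sub>v = c\<^sub>v x\<^bsub>p v\<^esub>\<close>. The counit law for \<open>t\<close> and \<open>\<epsilon> \<circ> S = \<epsilon>\<close> give
  \<open>\<phi> (t z) = \<epsilon> z\<close>, so \<open>t\<close> is a multiple of the top monomial and \<open>S t = t\<close>
  (\<open>t_eq\<close>, \<open>S_t\<close>). An anti-homomorphism that permutes the monomials permutes the generators,
  \<open>S x\<^sub>i = \<gamma>\<^sub>i x\<^bsub>\<pi> i\<^esub>\<close>, and \<open>\<pi>\<close> is compatible. Since \<open>S\<close> reverses \<open>\<Delta>\<close> and fixes \<open>t\<close>,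
  the tensor \<open>\<Delta> t\<close> is unchanged when its factors are exchanged and \<open>S\<close> is applied to both of them;
  this yields \<open>\<phi> (S (S x) b) = \<phi> (b x)\<close> (\<open>phi_S_S\<close>), so \<open>S\<^sup>2\<close> is inverse to the Nakayama
  automorphism of \<open>\<phi>\<close>. On generators this says \<open>\<pi>\<^sup>2 = 1\<close> and \<open>\<gamma>\<^sub>i \<gamma>\<^bsub>\<pi> i\<^esub> = h\<^sub>i\<close>.
  Compatibility gives \<open>h\<^bsub>\<pi> i\<^esub> h\<^sub>i = 1\<close>, hence \<open>h\<^sub>i\<^sup>2 = 1\<close>, which is \<open>\<N>\<^sup>2 = 1\<close>. Finally
  \<open>S\<close> fixes the top monomial, that is, \<open>q\<^sub>\<pi> \<Prod> \<gamma>\<^sub>i\<^bsup>a i - 1\<^esup> = 1\<close>.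

  Signs. All \<open>h\<^sub>i\<close> are \<open>1\<close> or \<open>-1\<close>. At a fixed index \<open>h\<^sub>i = \<gamma>\<^sub>i\<^sup>2\<close>, so \<open>h\<^sub>i = 1\<close> because
  \<open>-1\<close> is not a square; this is condition (1). In \<open>q\<^sub>\<pi> \<Prod> \<gamma>\<^sub>i\<^bsup>a i - 1\<^esup>\<close> the factors at indices
  exchanged by \<open>\<pi>\<close> cancel up to a sign, and if every fixed index has odd \<open>a i\<close> the product is
  \<open>(-1)\<^bsup>|J\<^sub>3|/2\<^esup>\<close> (\<open>sign_relation\<close>); this is condition (2). Conversely signs \<open>c\<^sub>i\<close> with the
  required products exist: an index in \<open>I\<^sub>1\<close>, if there is one, can absorb a wrong sign of the total
  product (\<open>exists_coefficients\<close>).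

  Sufficiency. In the attached coalgebra every monomial other than \<open>1\<close> and the top one is primitive,
  so coassociativity only has to be seen at the top monomial, where it is a rearrangement of a sum.
  The other axioms, evaluated on monomials, are identities between products of the \<open>q\<^sub>i\<^sub>j\<close>:
  \<open>antipode_coeff_mult\<close>, \<open>antipode_coeff_perm\<close> and \<open>pairing_compl\<close>.

  Two foundations carry these arguments. The standard monomials form a basis, because there are
  linear forms on the free algebra that vanish on the defining ideal and separate the monomials
  (\<open>coord_I\<close>). And tensors are only ever used through the universal property of the tensor
  product: Sweedler sums are linear in the tensor and have the expected value on pure tensors
  (\<open>sweedler_linear\<close>, \<open>sweedler_pure\<close>).
\<close>

section \<open>Vector spaces over the ground field\<close>

lemma scalars_simps [simp]:
  "carrier scalars = UNIV" "x \<otimes>\<^bsub>scalars\<^esub> y = x * y" "\<one>\<^bsub>scalars\<^esub> = 1" "\<zero>\<^bsub>scalars\<^esub> = 0"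
  "x \<oplus>\<^bsub>scalars\<^esub> y = x + y" "c \<odot>\<^bsub>scalars\<^esub> x = c * x"
  by (simp_all add: scalars_def)

lemma cring_scalars: "cring (scalars :: ('k::field, 'k) module)"
proof (intro cringI abelian_groupI comm_monoidI)
  fix x :: 'k assume "x \<in> carrier scalars"
  show "\<exists>y\<in>carrier scalars. y \<oplus>\<^bsub>scalars\<^esub> x = \<zero>\<^bsub>scalars\<^esub>"
    by (rule bexI[of _ "- x"]) auto
qed (auto simp: algebra_simps)

locale vspace = Module.module scalars M for M :: "('k::field, 'a) module" (structure)

lemma vspace_scalars: "vspace (scalars :: ('k::field, 'k) module)"
  unfolding vspace_def
  by (rule moduleI) (use cring_scalars in \<open>auto simp: cring_def ring_def algebra_simps\<close>)

lemma finsum_scalars: "finite A \<Longrightarrow> finsum scalars f A = (\<Sum>x\<in>A. f x)"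
proof (induction A rule: finite_induct)
  interpret vspace scalars by (rule vspace_scalars)
  case empty then show ?case by simp
next
  interpret vspace scalars by (rule vspace_scalars)
  case (insert x A) then show ?case by (subst finsum_insert) auto
qed

lemmas (in vspace) vs_simps [simp] =
  smult_closed[simplified] smult_l_null[simplified] smult_r_null[simplified] smult_one[simplified]
lemma (in vspace) vs_distr_l: "x \<in> carrier M \<Longrightarrow> (a + b) \<odot> x = a \<odot> x \<oplus> b \<odot> x"
  using smult_l_distr[of a b x] by simp
lemma (in vspace) vs_distr_r:
  "x \<in> carrier M \<Longrightarrow> y \<in> carrier M \<Longrightarrow> a \<odot> (x \<oplus> y) = a \<odot> x \<oplus> a \<odot> y"
  using smult_r_distr[of a x y] by simp
lemma (in vspace) vs_assoc: "x \<in> carrier M \<Longrightarrow> (a * b) \<odot> x = a \<odot> (b \<odot> x)"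
  using smult_assoc1[of a b x] by simp
lemma (in vspace) vs_finsum_smult:
  "finite A \<Longrightarrow> f \<in> A \<rightarrow> carrier M \<Longrightarrow> c \<odot> finsum M f A = (\<Oplus>i\<in>A. c \<odot> f i)"
  using finsum_smult_ldistr[of A c f] by simp
lemma (in vspace) vs_neg: "x \<in> carrier M \<Longrightarrow> (- 1) \<odot> x = \<ominus> x"
  using vs_distr_l[of x "-1" 1] by (simp add: minus_equality)

lemma (in vspace) finsum_superset:
  assumes "finite S" "A \<subseteq> S" "f \<in> S \<rightarrow> carrier M" "\<And>x. x \<in> S - A \<Longrightarrow> f x = \<zero>"
  shows "finsum M f A = finsum M f S"
  using assms by (intro add.finprod_mono_neutral_cong_left) auto

lemma (in vspace) finsum_delta:
  assumes "finite S" "s \<in> S" "\<And>x. x \<in> S \<Longrightarrow> f x = (if x = s then y else \<zero>)" "y \<in> carrier M"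
  shows "finsum M f S = y"
proof -
  have "finsum M f {s} = finsum M f S"
    using assms by (intro finsum_superset) auto
  moreover have "finsum M f {s} = y" using assms by (subst finsum_insert) auto
  ultimately show ?thesis by simp
qed

section \<open>Linear and bilinear maps\<close>

lemma linear_mapD:
  assumes "linear_map M N f"
  shows "x \<in> carrier M \<Longrightarrow> f x \<in> carrier N"
    "x \<in> carrier M \<Longrightarrow> y \<in> carrier M \<Longrightarrow> f (x \<oplus>\<^bsub>M\<^esub> y) = f x \<oplus>\<^bsub>N\<^esub> f y"
    "x \<in> carrier M \<Longrightarrow> f (c \<odot>\<^bsub>M\<^esub> x) = c \<odot>\<^bsub>N\<^esub> f x"
  using assms by (auto simp: linear_map_def)

lemma linear_map_zero:
  assumes "vspace M" "vspace N" "linear_map M N f"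
  shows "f \<zero>\<^bsub>M\<^esub> = \<zero>\<^bsub>N\<^esub>"
proof -
  interpret M: vspace M by fact
  interpret N: vspace N by fact
  have "f (0 \<odot>\<^bsub>M\<^esub> \<zero>\<^bsub>M\<^esub>) = 0 \<odot>\<^bsub>N\<^esub> f \<zero>\<^bsub>M\<^esub>"
    using assms(3) by (intro linear_mapD(3)) auto
  then show ?thesis using linear_mapD(1)[OF assms(3), of "\<zero>\<^bsub>M\<^esub>"] by simp
qed

lemma linear_map_finsum:
  assumes "vspace M" "vspace N" "linear_map M N f" "finite A" "g \<in> A \<rightarrow> carrier M"
  shows "f (finsum M g A) = (\<Oplus>\<^bsub>N\<^esub>x\<in>A. f (g x))"
  using assms(4,5)
proof (induction A rule: finite_induct)
  interpret M: vspace M by fact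
  interpret N: vspace N by fact
  case empty then show ?case using linear_map_zero[OF assms(1-3)] by simp
next
  interpret M: vspace M by fact
  interpret N: vspace N by fact
  case (insert x A)
  then have "\<And>y. y \<in> insert x A \<Longrightarrow> f (g y) \<in> carrier N"
    using linear_mapD(1)[OF assms(3)] by auto
  with insert show ?case
    using linear_mapD(1,2)[OF assms(3)] by (simp add: Pi_iff M.finsum_closed)
qed

lemma linear_map_comp:
  assumes "linear_map M N f" "linear_map N P g"
  shows "linear_map M P (\<lambda>x. g (f x))"
  using assms by (simp add: linear_map_def)

lemma (in vspace) linear_map_smult:
  assumes "linear_map N M f" shows "linear_map N M (\<lambda>x. c \<odot> f x)"
  using assms by (simp add: linear_map_def vs_distr_r vs_assoc[symmetric] mult.commute)

lemma (in vspace) linear_map_add: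
  assumes "linear_map N M f" "linear_map N M g"
  shows "linear_map N M (\<lambda>x. f x \<oplus> g x)"
  using assms by (simp add: linear_map_def vs_distr_r a_ac)

lemma (in vspace) linear_map_scalar_smult:
  assumes "linear_map N scalars f" "y \<in> carrier M" shows "linear_map N M (\<lambda>x. f x \<odot> y)"
  using assms by (simp add: linear_map_def vs_distr_l vs_assoc)

lemma (in vspace) linear_map_finsum_fun:
  assumes "finite A" "vspace N" "\<And>i. i \<in> A \<Longrightarrow> linear_map N M (f i)"
  shows "linear_map N M (\<lambda>x. \<Oplus>i\<in>A. f i x)"
  using assms(1,3)
proof (induction A rule: finite_induct)
  case empty then show ?case by (simp add: linear_map_def)
next
  case (insert i A)
  have c: "f j x \<in> carrier M" if "j \<in> insert i A" "x \<in> carrier N" for j x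
    using insert.prems that linear_mapD(1) by metis
  have e: "(\<Oplus>j\<in>insert i A. f j x) = f i x \<oplus> (\<Oplus>j\<in>A. f j x)" if "x \<in> carrier N" for x
    using insert c that by (simp add: Pi_iff)
  interpret N: vspace N by fact
  have "linear_map N M (\<lambda>x. f i x \<oplus> (\<Oplus>j\<in>A. f j x))"
    using insert by (intro linear_map_add) auto
  then show ?case by (simp add: linear_map_def e)
qed

definition bilinear_map ::
    "('k::field, 'a) module \<Rightarrow> ('k, 'b) module \<Rightarrow> ('k, 'c) module \<Rightarrow> ('a \<Rightarrow> 'b \<Rightarrow> 'c) \<Rightarrow> bool" where
  "bilinear_map M N P \<beta> \<longleftrightarrow> (\<forall>x\<in>carrier M. linear_map N P (\<beta> x)) \<and>
     (\<forall>y\<in>carrier N. linear_map M P (\<lambda>x. \<beta> x y))"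

lemma bilinear_mapI:
  assumes "\<And>x. x \<in> carrier M \<Longrightarrow> linear_map N P (\<beta> x)"
    "\<And>y. y \<in> carrier N \<Longrightarrow> linear_map M P (\<lambda>x. \<beta> x y)"
  shows "bilinear_map M N P \<beta>"
  using assms by (simp add: bilinear_map_def)

lemma bilinear_mapD:
  assumes "bilinear_map M N P \<beta>"
  shows "x \<in> carrier M \<Longrightarrow> linear_map N P (\<beta> x)"
    "y \<in> carrier N \<Longrightarrow> linear_map M P (\<lambda>x. \<beta> x y)"
    "x \<in> carrier M \<Longrightarrow> y \<in> carrier N \<Longrightarrow> \<beta> x y \<in> carrier P"
  using assms by (auto simp: bilinear_map_def linear_map_def)

lemma bilinear_map_comp:
  assumes "bilinear_map M N P \<beta>" "linear_map M' M f" "linear_map N' N g"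
  shows "bilinear_map M' N' P (\<lambda>x y. \<beta> (f x) (g y))"
  using assms by (auto simp: bilinear_map_def linear_map_def)

lemma bilinear_map_linear:
  assumes "bilinear_map M N P \<beta>" "linear_map P Q L"
  shows "bilinear_map M N Q (\<lambda>x y. L (\<beta> x y))"
  using assms by (auto simp: bilinear_map_def linear_map_def)

lemma bilinear_map_swap:
  "bilinear_map M N P \<beta> \<Longrightarrow> bilinear_map N M P (\<lambda>x y. \<beta> y x)"
  by (auto simp: bilinear_map_def)

lemma (in vspace) bilinear_map_scalars:
  assumes "linear_map N scalars f"
  shows "bilinear_map N M M (\<lambda>x y. f x \<odot> y)"
  using assms by (auto simp: bilinear_map_def linear_map_def vs_distr_l vs_distr_r vs_assoc[symmetric] mult.commute)

section \<open>Quotient spaces\<close>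

locale subspace = vspace M for M :: "('k::field, 'a) module" (structure) and H +
  assumes submodule_H: "submodule H scalars M"
begin

abbreviation "cls x \<equiv> H +>\<^bsub>M\<^esub> x"

lemma H_sub: "H \<subseteq> carrier M" and H_smult: "x \<in> H \<Longrightarrow> c \<odot> x \<in> H"
  using submoduleE[OF submodule_H] by auto

sublocale abelian_subgroup H M
  by (rule abelian_subgroupI3)
    (use submodule_H in \<open>auto simp: additive_subgroup_def submodule_def intro: M.abelian_group_axioms\<close>)

lemma quot_simps:
  "carrier (quot_module M H) = cls ` carrier M" "\<zero>\<^bsub>quot_module M H\<^esub> = cls \<zero>"
  "x \<in> carrier M \<Longrightarrow> y \<in> carrier M \<Longrightarrow> cls x \<oplus>\<^bsub>quot_module M H\<^esub> cls y = cls (x \<oplus> y)"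
  by (auto simp: quot_module_def A_RCOSETS_defs a_r_coset_defs[symmetric] a_rcos_sum)
     (auto simp: a_r_coset_def r_coset_def H_sub[THEN subsetD])

lemma mem_cls: "x \<in> carrier M \<Longrightarrow> z \<in> cls x \<longleftrightarrow> (\<exists>h\<in>H. z = h \<oplus> x)"
  by (auto simp: a_r_coset_def r_coset_def)

lemma cls_eq_iff:
  assumes "x \<in> carrier M" "y \<in> carrier M"
  shows "cls x = cls y \<longleftrightarrow> x \<ominus> y \<in> H"
proof
  assume "cls x = cls y"
  then have "x \<in> cls y" using a_rcos_self[OF assms(1)] by simp
  then obtain h where "h \<in> H" "x = h \<oplus> y" using assms mem_cls by auto
  then show "x \<ominus> y \<in> H" using assms H_sub by (auto simp: a_minus_def a_assoc r_neg)
next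
  assume "x \<ominus> y \<in> H"
  then have "x \<in> cls y" using assms
    by (auto simp: mem_cls a_minus_def a_assoc l_neg intro!: bexI[of _ "x \<ominus> y"])
  then show "cls x = cls y" using a_repr_independence'[OF _ assms(2)] by metis
qed

text \<open>
  The union in the definition of the scalar multiplication runs over equal cosets, because any two
  representatives differ by an element of the submodule.
\<close>
lemma quot_smult: "x \<in> carrier M \<Longrightarrow> c \<odot>\<^bsub>quot_module M H\<^esub> cls x = cls (c \<odot> x)"
proof -
  assume x: "x \<in> carrier M"
  have eq: "cls (c \<odot> z) = cls (c \<odot> x)" if "z \<in> cls x" for z
  proof -
    from that have "\<exists>h\<in>H. z = h \<oplus> x" by (simp only: mem_cls[OF x])
    then obtain h where h: "h \<in> H" "z = h \<oplus> x" by blast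
    then have z: "z \<in> carrier M" "h \<in> carrier M" using H_sub x by auto
    have "c \<odot> z \<ominus> c \<odot> x = c \<odot> h"
      using h x z by (simp add: vs_distr_r a_minus_def a_assoc r_neg)
    then show ?thesis using x z h H_smult by (subst cls_eq_iff) auto
  qed
  have "c \<odot>\<^bsub>quot_module M H\<^esub> cls x = (\<Union>z\<in>cls x. cls (c \<odot> z))"
    by (simp add: quot_module_def)
  also have "\<dots> = (\<Union>z\<in>cls x. cls (c \<odot> x))" by (rule SUP_cong[OF refl eq])
  also have "\<dots> = cls (c \<odot> x)"
    using a_rcos_self[OF x] by (metis UN_constant empty_iff)
  finally show ?thesis .
qed

lemma vspace_quot: "vspace (quot_module M H)"
  unfolding vspace_def
proof (rule moduleI)
  show "cring (scalars :: ('k, 'k) module)" by (rule cring_scalars)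
  show "abelian_group (quot_module M H)"
  proof (rule abelian_groupI)
    fix X assume "X \<in> carrier (quot_module M H)"
    then obtain x where "x \<in> carrier M" "X = cls x" by (auto simp: quot_simps)
    then show "\<exists>Y\<in>carrier (quot_module M H). Y \<oplus>\<^bsub>quot_module M H\<^esub> X = \<zero>\<^bsub>quot_module M H\<^esub>"
      by (intro bexI[of _ "cls (\<ominus> x)"]) (auto simp: quot_simps l_neg)
  qed (auto simp: quot_simps a_ac)
qed (auto simp: quot_simps quot_smult vs_distr_l vs_distr_r vs_assoc)

lemma linear_cls: "linear_map M (quot_module M H) cls"
  by (auto simp: linear_map_def quot_simps quot_smult)

end

section \<open>Free modules\<close>

lemma lookup_scale [simp]:
  "Poly_Mapping.lookup (Poly_Mapping.map ((*) (c::'k::field)) p) k = c * Poly_Mapping.lookup p k"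
  by (simp add: Poly_Mapping.map.rep_eq when_def)

lemma keys_scale: "Poly_Mapping.keys (Poly_Mapping.map ((*) (c::'k::field)) p) \<subseteq> Poly_Mapping.keys p"
  by (auto simp: in_keys_iff)

lemma free_module_simps [simp]:
  "carrier (free_module X) = {p. Poly_Mapping.keys p \<subseteq> X}" "\<zero>\<^bsub>free_module X\<^esub> = 0"
  "p \<oplus>\<^bsub>free_module X\<^esub> r = p + r" "c \<odot>\<^bsub>free_module X\<^esub> p = Poly_Mapping.map ((*) c) p"
  by (simp_all add: free_module_def)

lemma vspace_free_module: "vspace (free_module X :: ('k::field, 'x \<Rightarrow>\<^sub>0 'k) module)"
  unfolding vspace_def
proof (rule moduleI)
  show "abelian_group (free_module X :: ('k, 'x \<Rightarrow>\<^sub>0 'k) module)"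
  proof (rule abelian_groupI)
    fix p :: "'x \<Rightarrow>\<^sub>0 'k" assume "p \<in> carrier (free_module X)"
    then show "\<exists>r\<in>carrier (free_module X). r \<oplus>\<^bsub>free_module X\<^esub> p = \<zero>\<^bsub>free_module X\<^esub>"
      by (intro bexI[of _ "- p"]) auto
  qed (use keys_add in \<open>fastforce simp: algebra_simps\<close>)+
qed (auto simp: algebra_simps lookup_add cring_scalars dest: keys_scale[THEN subsetD] intro!: poly_mapping_eqI)

text \<open>
  This is the sum in the definition of \<^const>\<open>sweedler\<close>; it extends \<open>\<gamma>\<close> linearly from the
  basis of the free module.
\<close>
definition free_lift :: "('k::field, 'c) module \<Rightarrow> ('x \<Rightarrow> 'c) \<Rightarrow> ('x \<Rightarrow>\<^sub>0 'k) \<Rightarrow> 'c" where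
  "free_lift P \<gamma> p = (\<Oplus>\<^bsub>P\<^esub>x\<in>Poly_Mapping.keys p. Poly_Mapping.lookup p x \<odot>\<^bsub>P\<^esub> \<gamma> x)"

lemma (in vspace) free_lift_superset:
  assumes "finite S" "Poly_Mapping.keys p \<subseteq> S" "\<gamma> \<in> S \<rightarrow> carrier M"
  shows "free_lift M \<gamma> p = (\<Oplus>x\<in>S. Poly_Mapping.lookup p x \<odot> \<gamma> x)"
  unfolding free_lift_def using assms
  by (intro finsum_superset) (auto simp: in_keys_iff Pi_iff)

lemma (in vspace) free_lift_linear:
  assumes "\<gamma> \<in> X \<rightarrow> carrier M"
  shows "linear_map (free_module X) M (free_lift M \<gamma>)"
  unfolding linear_map_def
proof (intro conjI ballI allI)
  fix p r :: "'b \<Rightarrow>\<^sub>0 'k" and c assume p: "p \<in> carrier (free_module X)" and r: "r \<in> carrier (free_module X)"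
  define S where "S = Poly_Mapping.keys p \<union> Poly_Mapping.keys r"
  have S: "finite S" "S \<subseteq> X" using p r by (auto simp: S_def)
  then have g: "\<And>x. x \<in> S \<Longrightarrow> \<gamma> x \<in> carrier M" using assms by auto
  have e: "free_lift M \<gamma> t = (\<Oplus>x\<in>S. Poly_Mapping.lookup t x \<odot> \<gamma> x)" if "Poly_Mapping.keys t \<subseteq> S" for t
    using S g that by (intro free_lift_superset) auto
  show "free_lift M \<gamma> (p \<oplus>\<^bsub>free_module X\<^esub> r) = free_lift M \<gamma> p \<oplus> free_lift M \<gamma> r"
  proof -
    have k: "Poly_Mapping.keys (p + r) \<subseteq> S" using keys_add[of p r] by (simp add: S_def)
    have "free_lift M \<gamma> (p + r) = (\<Oplus>x\<in>S. Poly_Mapping.lookup p x \<odot> \<gamma> x \<oplus> Poly_Mapping.lookup r x \<odot> \<gamma> x)"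
      unfolding e[OF k] using g by (intro finsum_cong') (auto simp: lookup_add vs_distr_l)
    also have "\<dots> = free_lift M \<gamma> p \<oplus> free_lift M \<gamma> r"
      using g by (subst finsum_addf) (auto simp: e S_def)
    finally show ?thesis by simp
  qed
  show "free_lift M \<gamma> p \<in> carrier M" using g by (subst e) (auto simp: S_def intro!: finsum_closed)
  show "free_lift M \<gamma> (c \<odot>\<^bsub>free_module X\<^esub> p) = c \<odot> free_lift M \<gamma> p"
  proof -
    have k: "Poly_Mapping.keys (Poly_Mapping.map ((*) c) p) \<subseteq> S" using keys_scale[of c p] by (auto simp: S_def)
    have "free_lift M \<gamma> (Poly_Mapping.map ((*) c) p) = (\<Oplus>x\<in>S. c \<odot> (Poly_Mapping.lookup p x \<odot> \<gamma> x))"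
      unfolding e[OF k] using g by (intro finsum_cong') (auto simp: vs_assoc)
    also have "\<dots> = c \<odot> free_lift M \<gamma> p"
      using g S by (subst vs_finsum_smult[symmetric]) (auto simp: e S_def)
    finally show ?thesis by simp
  qed
qed

lemma (in vspace) free_lift_single:
  assumes "\<gamma> x \<in> carrier M"
  shows "free_lift M \<gamma> (Poly_Mapping.single x c) = c \<odot> \<gamma> x"
  using assms by (subst free_lift_superset[of "{x}"]) (auto simp: Pi_iff)

section \<open>Tensor products and Sweedler sums\<close>

lemma linear_map_kernel_submodule:
  assumes "vspace M" "vspace N" "linear_map M N f"
  shows "submodule {x \<in> carrier M. f x = \<zero>\<^bsub>N\<^esub>} scalars M"
proof -
  interpret M: vspace M by fact
  interpret N: vspace N by fact
  note L = linear_mapD[OF assms(3)]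
  show ?thesis
  proof (rule M.submoduleI)
    fix x assume x: "x \<in> {x \<in> carrier M. f x = \<zero>\<^bsub>N\<^esub>}"
    then have "f (\<ominus>\<^bsub>M\<^esub> x) = (-1) \<odot>\<^bsub>N\<^esub> f x" by (simp add: M.vs_neg[symmetric] L)
    with x show "\<ominus>\<^bsub>M\<^esub> x \<in> {x \<in> carrier M. f x = \<zero>\<^bsub>N\<^esub>}" by simp
  qed (auto simp: L linear_map_zero[OF assms])
qed

lemma (in vspace) submodule_Inter:
  assumes "F \<noteq> {}" "\<And>H. H \<in> F \<Longrightarrow> submodule H scalars M"
  shows "submodule (\<Inter>F) scalars M"
proof -
  note E = submoduleE[OF assms(2)]
  have Z: "\<zero> \<in> H" if "H \<in> F" for H
    using assms(2)[OF that] subgroup.one_closed[of H "add_monoid M"] by (auto simp: submodule_def)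
  show ?thesis
  proof (rule submoduleI)
    show "\<Inter>F \<subseteq> carrier M" using assms(1) E(1) by (meson Inter_lower all_not_in_conv order_trans)
  qed (use Z in \<open>auto simp: E(3,4,5)\<close>)
qed

lemma tensor_relations_sub:
  assumes "vspace M" "vspace N"
  shows "tensor_relations M N \<subseteq> carrier (free_module (carrier M \<times> carrier N))"
proof -
  interpret M: vspace M by fact
  interpret N: vspace N by fact
  show ?thesis
    unfolding tensor_relations_def
    by (auto simp: in_keys_iff lookup_minus lookup_single when_def split: if_splits)
qed

locale tensor_pair = M: vspace M + N: vspace N
  for M :: "('k::field, 'a) module" and N :: "('k, 'b) module"
begin

abbreviation "F \<equiv> free_module (carrier M \<times> carrier N)"
abbreviation "T \<equiv> tensor M N"
abbreviation pt (infixl "\<otimes>\<^sub>t" 75) where "x \<otimes>\<^sub>t y \<equiv> pure_tensor M N x y"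

sublocale F: vspace F by (rule vspace_free_module)

lemma kernel_submodule: "submodule (tensor_kernel M N) scalars F"
  unfolding tensor_kernel_def
  by (rule F.submodule_Inter)
    (use F.carrier_is_submodule tensor_relations_sub M.vspace_axioms N.vspace_axioms in blast)+

sublocale Q: subspace F "tensor_kernel M N"
  by (rule subspace.intro[OF F.vspace_axioms subspace_axioms.intro[OF kernel_submodule]])

sublocale T: vspace T
  unfolding tensor_def by (rule Q.vspace_quot)

lemma rel_in_kernel: "tensor_relations M N \<subseteq> tensor_kernel M N"
  by (auto simp: tensor_kernel_def)

lemma single_F [simp]: "x \<in> carrier M \<Longrightarrow> y \<in> carrier N \<Longrightarrow> Poly_Mapping.single (x, y) c \<in> carrier F"
  by simp

lemma F_minus: "p \<in> carrier F \<Longrightarrow> r \<in> carrier F \<Longrightarrow> p \<ominus>\<^bsub>F\<^esub> r = p - r"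
  using F.vs_neg[of r] by (simp add: a_minus_def)
    (metis (no_types, lifting) add_uminus_conv_diff lookup_scale lookup_uminus mult_minus1 poly_mapping_eqI)

lemma pure_bilinear: "bilinear_map M N T (pure_tensor M N)"
proof -
  have s: "c \<odot>\<^bsub>F\<^esub> Poly_Mapping.single k 1 = Poly_Mapping.single k c" for c k
    by (auto intro!: poly_mapping_eqI simp: lookup_single when_def)
  have c: "x \<otimes>\<^sub>t y \<in> carrier T" if "x \<in> carrier M" "y \<in> carrier N" for x y
    using that by (auto simp: tensor_def Q.quot_simps pure_tensor_def)
  have eq: "Q.cls p = Q.cls r" if "p - r \<in> tensor_relations M N" "p \<in> carrier F" "r \<in> carrier F" for p r
    unfolding Q.cls_eq_iff[OF that(2,3)] F_minus[OF that(2,3)] using that(1) rel_in_kernel by blast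
  show ?thesis
    unfolding bilinear_map_def linear_map_def
  proof (intro conjI ballI allI c; assumption?)
    fix x x' y assume a: "x \<in> carrier M" "x' \<in> carrier M" "y \<in> carrier N"
    have "Q.cls (Poly_Mapping.single (x \<oplus>\<^bsub>M\<^esub> x', y) 1) =
      Q.cls (Poly_Mapping.single (x, y) 1 + Poly_Mapping.single (x', y) 1)"
      by (rule eq) (use a in \<open>auto simp: tensor_relations_def diff_diff_add dest!: set_mp[OF keys_add]\<close>)
    then show "(x \<oplus>\<^bsub>M\<^esub> x') \<otimes>\<^sub>t y = x \<otimes>\<^sub>t y \<oplus>\<^bsub>T\<^esub> x' \<otimes>\<^sub>t y"
      using a by (simp add: pure_tensor_def tensor_def Q.quot_simps)
  next
    fix x y y' assume a: "x \<in> carrier M" "y \<in> carrier N" "y' \<in> carrier N"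
    have "Q.cls (Poly_Mapping.single (x, y \<oplus>\<^bsub>N\<^esub> y') 1) =
      Q.cls (Poly_Mapping.single (x, y) 1 + Poly_Mapping.single (x, y') 1)"
      by (rule eq) (use a in \<open>auto simp: tensor_relations_def diff_diff_add dest!: set_mp[OF keys_add]\<close>)
    then show "x \<otimes>\<^sub>t (y \<oplus>\<^bsub>N\<^esub> y') = x \<otimes>\<^sub>t y \<oplus>\<^bsub>T\<^esub> x \<otimes>\<^sub>t y'"
      using a by (simp add: pure_tensor_def tensor_def Q.quot_simps)
  next
    fix x y c assume a: "x \<in> carrier M" "y \<in> carrier N"
    have "Q.cls (Poly_Mapping.single (c \<odot>\<^bsub>M\<^esub> x, y) 1) = Q.cls (Poly_Mapping.single (x, y) c)"
      by (rule eq) (use a in \<open>auto simp: tensor_relations_def\<close>)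
    then show "(c \<odot>\<^bsub>M\<^esub> x) \<otimes>\<^sub>t y = c \<odot>\<^bsub>T\<^esub> (x \<otimes>\<^sub>t y)"
      using a by (simp add: pure_tensor_def tensor_def Q.quot_smult s[simplified])
    have "Q.cls (Poly_Mapping.single (x, c \<odot>\<^bsub>N\<^esub> y) 1) = Q.cls (Poly_Mapping.single (x, y) c)"
      by (rule eq) (use a in \<open>auto simp: tensor_relations_def\<close>)
    then show "x \<otimes>\<^sub>t (c \<odot>\<^bsub>N\<^esub> y) = c \<odot>\<^bsub>T\<^esub> (x \<otimes>\<^sub>t y)"
      using a by (simp add: pure_tensor_def tensor_def Q.quot_smult s[simplified])
  qed
qed

lemma pure_closed [simp]: "x \<in> carrier M \<Longrightarrow> y \<in> carrier N \<Longrightarrow> x \<otimes>\<^sub>t y \<in> carrier T"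
  using bilinear_mapD(3)[OF pure_bilinear] .

end

locale tensor_lift = tensor_pair M N + P: vspace P
  for M :: "('k::field, 'a) module" and N :: "('k, 'b) module" and P :: "('k, 'c) module" +
  fixes \<beta> :: "'a \<Rightarrow> 'b \<Rightarrow> 'c"
  assumes bil: "bilinear_map M N P \<beta>"
begin

abbreviation "lift \<equiv> free_lift P (\<lambda>xy. \<beta> (fst xy) (snd xy))"

lemma lift_linear: "linear_map F P lift"
  by (rule P.free_lift_linear) (use bilinear_mapD(3)[OF bil] in auto)

lemma lift_single: "x \<in> carrier M \<Longrightarrow> y \<in> carrier N \<Longrightarrow> lift (Poly_Mapping.single (x, y) c) = c \<odot>\<^bsub>P\<^esub> \<beta> x y"
  using bilinear_mapD(3)[OF bil] by (subst P.free_lift_single) auto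

lemma lift_diff: "p \<in> carrier F \<Longrightarrow> r \<in> carrier F \<Longrightarrow> lift (p - r) = lift p \<ominus>\<^bsub>P\<^esub> lift r"
proof -
  assume a: "p \<in> carrier F" "r \<in> carrier F"
  have "lift (p - r) = lift (p \<oplus>\<^bsub>F\<^esub> (-1) \<odot>\<^bsub>F\<^esub> r)"
    using a F_minus[of p r] F.vs_neg[of r] by (simp add: a_minus_def)
  also have "\<dots> = lift p \<oplus>\<^bsub>P\<^esub> (-1) \<odot>\<^bsub>P\<^esub> lift r"
    unfolding linear_mapD(2)[OF lift_linear a(1) F.vs_simps(1)[OF a(2)]] linear_mapD(3)[OF lift_linear a(2)] ..
  also have "\<dots> = lift p \<ominus>\<^bsub>P\<^esub> lift r" using a linear_mapD(1)[OF lift_linear, of r] P.vs_neg by (simp add: a_minus_def)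
  finally show ?thesis .
qed

text \<open>
  The elements killed by the lift form a submodule. By bilinearity it contains the defining
  relations, and the tensor kernel is the least such submodule.
\<close>
lemma lift_kernel: "p \<in> tensor_kernel M N \<Longrightarrow> lift p = \<zero>\<^bsub>P\<^esub>"
proof -
  let ?K = "{p \<in> carrier F. lift p = \<zero>\<^bsub>P\<^esub>}"
  have "submodule ?K scalars F"
    by (rule linear_map_kernel_submodule[OF F.vspace_axioms P.vspace_axioms lift_linear])
  moreover have "tensor_relations M N \<subseteq> ?K"
  proof
    fix p assume p: "p \<in> tensor_relations M N"
    have zero: "u \<oplus>\<^bsub>P\<^esub> v \<ominus>\<^bsub>P\<^esub> u \<ominus>\<^bsub>P\<^esub> v = \<zero>\<^bsub>P\<^esub>" if "u \<in> carrier P" "v \<in> carrier P" for u v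
      using that by (simp add: P.M.minus_eq P.M.a_comm[of u v] P.M.a_assoc P.M.r_neg)
    have kd: "p - r \<in> carrier F" if "p \<in> carrier F" "r \<in> carrier F" for p r
      using that keys_diff[of p r] by auto
    have "lift p = \<zero>\<^bsub>P\<^esub>"
      using p unfolding tensor_relations_def
      by (auto simp: lift_diff kd lift_single linear_mapD[OF bilinear_mapD(1)[OF bil]]
          linear_mapD[OF bilinear_mapD(2)[OF bil]] bilinear_mapD(3)[OF bil] zero P.M.minus_eq[of "c \<odot>\<^bsub>P\<^esub> x" "c \<odot>\<^bsub>P\<^esub> x" for c x] P.M.r_neg
          simp del: free_module_simps)
    then show "p \<in> ?K" using p tensor_relations_sub[OF M.vspace_axioms N.vspace_axioms] by auto
  qed
  ultimately have "tensor_kernel M N \<subseteq> ?K" unfolding tensor_kernel_def by blast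
  then show "p \<in> tensor_kernel M N \<Longrightarrow> lift p = \<zero>\<^bsub>P\<^esub>" by blast
qed

text \<open>
  The representative that \<^const>\<open>sweedler\<close> chooses is immaterial, since the lift vanishes on the
  tensor kernel.
\<close>
lemma sweedler_cls: "p \<in> carrier F \<Longrightarrow> sweedler P (Q.cls p) \<beta> = lift p"
proof -
  assume p: "p \<in> carrier F"
  define r where "r = (SOME r. r \<in> Q.cls p)"
  have "r \<in> Q.cls p" unfolding r_def by (rule someI) (rule Q.a_rcos_self[OF p])
  then obtain h where h: "h \<in> tensor_kernel M N" "r = h \<oplus>\<^bsub>F\<^esub> p"
    unfolding Q.mem_cls[OF p] by (elim bexE)
  have "lift r = lift h \<oplus>\<^bsub>P\<^esub> lift p"
    unfolding h(2) by (rule linear_mapD(2)[OF lift_linear subsetD[OF Q.H_sub h(1)] p])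
  also have "\<dots> = lift p" using lift_kernel[OF h(1)] linear_mapD(1)[OF lift_linear p] by simp
  finally show ?thesis unfolding sweedler_def r_def[symmetric] Let_def by (simp add: free_lift_def)
qed

theorem sweedler_linear: "linear_map T P (\<lambda>X. sweedler P X \<beta>)"
proof -
  note L = linear_mapD[OF lift_linear]
  have T: "\<exists>p\<in>carrier F. X = Q.cls p" if "X \<in> carrier T" for X
    using that unfolding tensor_def Q.quot_simps by blast
  show ?thesis
    unfolding linear_map_def
  proof (intro conjI ballI allI)
    fix X Y c assume "X \<in> carrier T" "Y \<in> carrier T"
    then obtain p r where p: "p \<in> carrier F" "X = Q.cls p" and r: "r \<in> carrier F" "Y = Q.cls r"
      using T by metis
    show "sweedler P X \<beta> \<in> carrier P"
      unfolding p(2) sweedler_cls[OF p(1)] by (rule L(1)[OF p(1)])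
    show "sweedler P (X \<oplus>\<^bsub>T\<^esub> Y) \<beta> = sweedler P X \<beta> \<oplus>\<^bsub>P\<^esub> sweedler P Y \<beta>"
      unfolding p(2) r(2) tensor_def Q.quot_simps(3)[OF p(1) r(1)] sweedler_cls[OF p(1)]
        sweedler_cls[OF r(1)] sweedler_cls[OF F.add.m_closed[OF p(1) r(1)]] by (rule L(2)[OF p(1) r(1)])
    show "sweedler P (c \<odot>\<^bsub>T\<^esub> X) \<beta> = c \<odot>\<^bsub>P\<^esub> sweedler P X \<beta>"
      unfolding p(2) tensor_def Q.quot_smult[OF p(1)] sweedler_cls[OF p(1)]
        sweedler_cls[OF F.vs_simps(1)[OF p(1)]] by (rule L(3)[OF p(1)])
  qed
qed

theorem sweedler_pure: "x \<in> carrier M \<Longrightarrow> y \<in> carrier N \<Longrightarrow> sweedler P (x \<otimes>\<^sub>t y) \<beta> = \<beta> x y"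
  unfolding pure_tensor_def using bilinear_mapD(3)[OF bil]
  by (simp add: sweedler_cls lift_single)

end

context tensor_pair
begin

lemma tensor_liftI: "vspace P \<Longrightarrow> bilinear_map M N P \<beta> \<Longrightarrow> tensor_lift M N P \<beta>"
  by (intro tensor_lift.intro tensor_pair_axioms tensor_lift_axioms.intro)

lemma sweedler_linear: "vspace P \<Longrightarrow> bilinear_map M N P \<beta> \<Longrightarrow> linear_map T P (\<lambda>X. sweedler P X \<beta>)"
  by (rule tensor_lift.sweedler_linear[OF tensor_liftI])

lemma sweedler_pure:
  "vspace P \<Longrightarrow> bilinear_map M N P \<beta> \<Longrightarrow> x \<in> carrier M \<Longrightarrow> y \<in> carrier N \<Longrightarrow>
    sweedler P (x \<otimes>\<^sub>t y) \<beta> = \<beta> x y"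
  by (rule tensor_lift.sweedler_pure[OF tensor_liftI])

lemma tensor_rep: "X \<in> carrier T \<Longrightarrow> \<exists>p. p \<in> carrier F \<and> X = Q.cls p"
  unfolding tensor_def Q.quot_simps by blast

lemma sweedler_rep:
  "p \<in> carrier F \<Longrightarrow> vspace P \<Longrightarrow> bilinear_map M N P \<beta> \<Longrightarrow> sweedler P (Q.cls p) \<beta> =
    (\<Oplus>\<^bsub>P\<^esub>xy\<in>Poly_Mapping.keys p. Poly_Mapping.lookup p xy \<odot>\<^bsub>P\<^esub> \<beta> (fst xy) (snd xy))"
  using tensor_lift.sweedler_cls[OF tensor_liftI] by (simp only: free_lift_def)

lemma sweedler_cong:
  fixes P :: "('k, 'c) module"
  assumes "X \<in> carrier T" "vspace P" "bilinear_map M N P \<beta>" "bilinear_map M N P \<gamma>"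
    "\<And>x y. x \<in> carrier M \<Longrightarrow> y \<in> carrier N \<Longrightarrow> \<beta> x y = \<gamma> x y"
  shows "sweedler P X \<beta> = sweedler P X \<gamma>"
proof -
  interpret P: vspace P by fact
  obtain p where p: "p \<in> carrier F" and X: "X = Q.cls p"
    using tensor_rep[OF assms(1)] by (elim exE conjE)
  note e = sweedler_rep[OF p]
  have k: "fst xy \<in> carrier M \<and> snd xy \<in> carrier N" if "xy \<in> Poly_Mapping.keys p" for xy
    using p that by auto
  show ?thesis unfolding X e[OF assms(2,3)] e[OF assms(2,4)]
    using k assms(5) bilinear_mapD(3)[OF assms(4)] by (intro P.finsum_cong') auto
qed

text \<open>
  A Sweedler sum is a finite sum over the support of one representative, and linear maps commute
  with it.
\<close>
lemma linear_map_sweedler: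
  fixes P :: "('k, 'c) module" and R :: "('k, 'd) module"
  assumes "X \<in> carrier T" "vspace P" "vspace R" "bilinear_map M N P \<beta>" "linear_map P R L"
  shows "L (sweedler P X \<beta>) = sweedler R X (\<lambda>x y. L (\<beta> x y))"
proof -
  interpret P: vspace P by fact
  interpret R: vspace R by fact
  obtain p where p: "p \<in> carrier F" and X: "X = Q.cls p"
    using tensor_rep[OF assms(1)] by (elim exE conjE)
  note e = sweedler_rep[OF p]
  have "fst xy \<in> carrier M \<and> snd xy \<in> carrier N" if "xy \<in> Poly_Mapping.keys p" for xy
    using p that by auto
  then have k: "\<beta> (fst xy) (snd xy) \<in> carrier P" if "xy \<in> Poly_Mapping.keys p" for xy
    using bilinear_mapD(3)[OF assms(4)] that by auto
  show ?thesis
    unfolding X e[OF assms(2,4)] e[OF assms(3) bilinear_map_linear[OF assms(4,5)]]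
    using k by (subst linear_map_finsum[OF assms(2,3,5)])
      (auto simp: linear_mapD[OF assms(5)] intro!: R.finsum_cong')
qed

text \<open>
  Coassociativity nests one Sweedler sum inside another. Linearity in a parameter makes the inner
  sum a bilinear map, so that the outer sum falls under the universal property as well.
\<close>
lemma sweedler_linear_param:
  fixes P :: "('k, 'c) module" and R :: "('k, 'd) module"
  assumes "X \<in> carrier T" "vspace P" "vspace R"
    "\<And>z. z \<in> carrier R \<Longrightarrow> bilinear_map M N P (\<beta> z)"
    "\<And>x y. x \<in> carrier M \<Longrightarrow> y \<in> carrier N \<Longrightarrow> linear_map R P (\<lambda>z. \<beta> z x y)"
  shows "linear_map R P (\<lambda>z. sweedler P X (\<beta> z))"
proof -
  interpret P: vspace P by fact
  interpret R: vspace R by fact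
  obtain p where p: "p \<in> carrier F" and X: "X = Q.cls p"
    using tensor_rep[OF assms(1)] by (elim exE conjE)
  note e = sweedler_rep[OF p]
  have k: "fst xy \<in> carrier M \<and> snd xy \<in> carrier N" if "xy \<in> Poly_Mapping.keys p" for xy
    using p that by auto
  have "linear_map R P (\<lambda>z. \<Oplus>\<^bsub>P\<^esub>xy\<in>Poly_Mapping.keys p. Poly_Mapping.lookup p xy \<odot>\<^bsub>P\<^esub> \<beta> z (fst xy) (snd xy))"
    by (rule P.linear_map_finsum_fun[OF _ assms(3) P.linear_map_smult]) (use k assms(5) in auto)
  then show ?thesis
    using e[OF assms(2) assms(4)] unfolding X by (simp add: linear_map_def)
qed

end

section \<open>The free algebra\<close>

lemma free_algebra_simps [simp]:
  "carrier free_algebra = UNIV" "\<zero>\<^bsub>free_algebra\<^esub> = 0" "p \<oplus>\<^bsub>free_algebra\<^esub> r = p + r"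
  "c \<odot>\<^bsub>free_algebra\<^esub> p = Poly_Mapping.map ((*) c) p" "\<one>\<^bsub>free_algebra\<^esub> = Poly_Mapping.single [] 1"
  by (simp_all add: free_algebra_def)

abbreviation fa_mult (infixl "\<star>" 70) where
  "(f :: 'n list \<Rightarrow>\<^sub>0 'k::field) \<star> g \<equiv> f \<otimes>\<^bsub>free_algebra\<^esub> g"

lemma fa_mult_superset:
  fixes f g :: "'n list \<Rightarrow>\<^sub>0 'k::field"
  assumes "finite S" "finite T" "Poly_Mapping.keys f \<subseteq> S" "Poly_Mapping.keys g \<subseteq> T"
  shows "f \<star> g =
    (\<Sum>u\<in>S. \<Sum>w\<in>T. Poly_Mapping.single (u @ w) (Poly_Mapping.lookup f u * Poly_Mapping.lookup g w))"
proof -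
  have "f \<star> g = (\<Sum>u\<in>Poly_Mapping.keys f. \<Sum>w\<in>T.
      Poly_Mapping.single (u @ w) (Poly_Mapping.lookup f u * Poly_Mapping.lookup g w))"
    using assms unfolding free_algebra_def
    by (simp, intro sum.cong refl sum.mono_neutral_left) (auto simp: in_keys_iff)
  also have "\<dots> = (\<Sum>u\<in>S. \<Sum>w\<in>T. Poly_Mapping.single (u @ w) (Poly_Mapping.lookup f u * Poly_Mapping.lookup g w))"
    using assms by (intro sum.mono_neutral_left) (auto simp: in_keys_iff)
  finally show ?thesis .
qed

lemma fa_mult_single:
  "Poly_Mapping.single u (c::'k::field) \<star> Poly_Mapping.single w d = Poly_Mapping.single (u @ w) (c * d)"
  by (subst fa_mult_superset[of "{u}" "{w}"]) auto

lemma fa_add_l: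
  fixes f g h :: "'n list \<Rightarrow>\<^sub>0 'k::field"
  shows "(f + g) \<star> h = f \<star> h + g \<star> h"
  using keys_add[of f g]
  by (simp add: fa_mult_superset[of "Poly_Mapping.keys f \<union> Poly_Mapping.keys g" "Poly_Mapping.keys h"]
      lookup_add distrib_right single_add sum.distrib)

lemma fa_add_r:
  fixes f g h :: "'n list \<Rightarrow>\<^sub>0 'k::field"
  shows "h \<star> (f + g) = h \<star> f + h \<star> g"
  using keys_add[of f g]
  by (simp add: fa_mult_superset[of "Poly_Mapping.keys h" "Poly_Mapping.keys f \<union> Poly_Mapping.keys g"]
      lookup_add distrib_left single_add sum.distrib)

text \<open>
  Reduces statements about the free algebra that are additive in an element to single words.
\<close>
lemma poly_mapping_add_induct [case_names zero single add]:
  fixes p :: "'x \<Rightarrow>\<^sub>0 'k::field"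
  assumes "P 0" "\<And>x c. P (Poly_Mapping.single x c)" "\<And>p r. P p \<Longrightarrow> P r \<Longrightarrow> P (p + r)"
  shows "P p"
proof (induction p rule: update_induct)
  case (update f x c)
  have "Poly_Mapping.update x c f = f + Poly_Mapping.single x c"
    using update(1) by (auto intro!: poly_mapping_eqI simp: lookup_update lookup_add lookup_single when_def in_keys_iff)
  with assms update show ?case by simp
qed (rule assms)

lemma fa_zero [simp]:
  "f \<star> 0 = (0 :: 'n list \<Rightarrow>\<^sub>0 'k::field)" "0 \<star> f = (0 :: 'n list \<Rightarrow>\<^sub>0 'k::field)"
  by (simp_all add: free_algebra_def)

lemma fa_assoc:
  fixes f g h :: "'n list \<Rightarrow>\<^sub>0 'k::field"
  shows "f \<star> g \<star> h = f \<star> (g \<star> h)"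
proof (induction f rule: poly_mapping_add_induct)
  case (single u c)
  show ?case
  proof (induction g rule: poly_mapping_add_induct)
    case (single w d)
    show ?case by (induction h rule: poly_mapping_add_induct) (simp_all add: fa_add_l fa_add_r fa_mult_single mult.assoc)
  qed (simp_all add: fa_add_l fa_add_r)
qed (simp_all add: fa_add_l)

lemma ring_free_algebra: "ring (free_algebra :: ('k::field, 'n list \<Rightarrow>\<^sub>0 'k) module)"
proof (intro ringI abelian_groupI monoidI)
  fix p :: "'n list \<Rightarrow>\<^sub>0 'k"
  show "\<exists>r\<in>carrier free_algebra. r \<oplus>\<^bsub>free_algebra\<^esub> p = \<zero>\<^bsub>free_algebra\<^esub>"
    by (intro bexI[of _ "- p"]) auto
  show "\<one>\<^bsub>free_algebra\<^esub> \<star> p = p" "p \<star> \<one>\<^bsub>free_algebra\<^esub> = p"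
    by (induction p rule: poly_mapping_add_induct) (simp_all add: fa_add_l fa_add_r fa_mult_single)
qed (auto simp: fa_add_l fa_add_r fa_assoc algebra_simps)

lemma vspace_free_algebra: "vspace (free_algebra :: ('k::field, 'n list \<Rightarrow>\<^sub>0 'k) module)"
  unfolding vspace_def
  by (rule moduleI) (use ring_free_algebra in \<open>auto simp: algebra_simps lookup_add cring_scalars ring_def
      intro!: poly_mapping_eqI\<close>)

lemma fa_smult:
  fixes f g :: "'n list \<Rightarrow>\<^sub>0 'k::field"
  shows "(c \<odot>\<^bsub>free_algebra\<^esub> f) \<star> g = c \<odot>\<^bsub>free_algebra\<^esub> (f \<star> g)"
    "f \<star> (c \<odot>\<^bsub>free_algebra\<^esub> g) = c \<odot>\<^bsub>free_algebra\<^esub> (f \<star> g)"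
proof -
  have s: "Poly_Mapping.map ((*) c) p = Poly_Mapping.single [] c \<star> p"
    and s': "Poly_Mapping.map ((*) c) p = p \<star> Poly_Mapping.single [] c" for p :: "'n list \<Rightarrow>\<^sub>0 'k"
    by (induction p rule: poly_mapping_add_induct)
      (simp_all add: fa_add_l fa_add_r fa_mult_single distrib_left[symmetric] poly_mapping_eq_iff fun_eq_iff lookup_add lookup_single when_def mult.commute distrib_left)
  show "(c \<odot>\<^bsub>free_algebra\<^esub> f) \<star> g = c \<odot>\<^bsub>free_algebra\<^esub> (f \<star> g)"
    by (simp add: s fa_assoc)
  show "f \<star> (c \<odot>\<^bsub>free_algebra\<^esub> g) = c \<odot>\<^bsub>free_algebra\<^esub> (f \<star> g)"
    by (simp add: s' fa_assoc)
qed

section \<open>Quotient algebras\<close>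

lemma ring_quot_module:
  assumes "ring M" "ideal H M" "vspace M" "submodule H scalars M"
  shows "ring (quot_module M H)"
proof -
  interpret ideal H M by fact
  interpret S: subspace M H using assms by (simp add: subspace_def subspace_axioms_def)
  interpret V: vspace "quot_module M H" by (rule S.vspace_quot)
  have m: "(H +>\<^bsub>M\<^esub> x) \<otimes>\<^bsub>quot_module M H\<^esub> (H +>\<^bsub>M\<^esub> y) = H +>\<^bsub>M\<^esub> (x \<otimes>\<^bsub>M\<^esub> y)"
    if "x \<in> carrier M" "y \<in> carrier M" for x y
    using rcoset_mult_add[OF that] by (simp add: quot_module_def)
  have o: "\<one>\<^bsub>quot_module M H\<^esub> = H +>\<^bsub>M\<^esub> \<one>\<^bsub>M\<^esub>" by (simp add: quot_module_def)
  show ?thesis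
  proof (rule ringI)
    show "abelian_group (quot_module M H)" by (rule V.M.abelian_group_axioms)
    show "Group.monoid (quot_module M H)"
      by (rule monoidI) (auto simp: S.quot_simps m o m_assoc)
  qed (auto simp: S.quot_simps m l_distr r_distr)
qed

section \<open>The bicharacter and the straightening coefficient of a word\<close>

text \<open>
  The structure constants of the algebra: \<open>x\<^sub>u x\<^sub>v = pairing q u v x\<^bsub>u+v\<^esub>\<close>, because moving
  a letter \<open>i\<close> to the left past a larger letter \<open>j\<close> costs a factor \<open>q i j\<close>. The pairs with
  \<open>\<not> i < j\<close> contribute the factor 1; including them lets products be reindexed by arbitrary
  permutations of the indices.
\<close>
definition pairing :: "('n::{finite,linorder} \<Rightarrow> 'n \<Rightarrow> 'k::field) \<Rightarrow> ('n \<Rightarrow> nat) \<Rightarrow> ('n \<Rightarrow> nat) \<Rightarrow> 'k" where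
  "pairing q u v = (\<Prod>i\<in>UNIV. \<Prod>j\<in>UNIV. (if i < j then q i j else 1) ^ (u j * v i))"

lemma pairing_add:
  "pairing q (\<lambda>i. u i + u' i) v = pairing q u v * pairing q u' v"
  "pairing q u (\<lambda>i. v i + v' i) = pairing q u v * pairing q u v'"
  by (simp_all add: pairing_def distrib_left distrib_right power_add prod.distrib)

lemma pairing_zero [simp]: "pairing q (\<lambda>_. 0) v = 1" "pairing q u (\<lambda>_. 0) = 1"
  by (simp_all add: pairing_def)

definition unit_exp :: "'n \<Rightarrow> 'n \<Rightarrow> nat" where "unit_exp i = (\<lambda>j. if j = i then 1 else 0)"

lemma pairing_unit: "pairing q (unit_exp l) (unit_exp k) = (if k < l then q k l else 1)"
proof -
  have "pairing q (unit_exp l) (unit_exp k) =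
    (\<Prod>i\<in>UNIV. \<Prod>j\<in>UNIV. if j = l then (if i = k then (if i < j then q i j else 1) else 1) else 1)"
    unfolding pairing_def by (intro prod.cong refl) (auto simp: unit_exp_def)
  also have "\<dots> = (\<Prod>i\<in>UNIV. if i = k then (if k < l then q k l else 1) else 1)"
    by (intro prod.cong refl) (simp add: prod.delta)
  finally show ?thesis by (simp add: prod.delta)
qed

text \<open>
  The scalar by which a word differs from its sorted rearrangement: the first letter of \<open>i # w\<close>
  has to move to the right past the smaller letters of \<open>w\<close>.
\<close>
primrec straighten_coeff :: "('n::{finite,linorder} \<Rightarrow> 'n \<Rightarrow> 'k::field) \<Rightarrow> 'n list \<Rightarrow> 'k" where
  "straighten_coeff q [] = 1"
| "straighten_coeff q (i # w) = pairing q (unit_exp i) (count (mset w)) * straighten_coeff q w"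

lemma count_mset_Cons: "count (mset (i # w)) = (\<lambda>j. unit_exp i j + count (mset w) j)"
  by (auto simp: unit_exp_def)

lemma count_mset_append: "count (mset (u @ w)) = (\<lambda>j. count (mset u) j + count (mset w) j)"
  by auto

lemma count_mset_Nil: "count (mset []) = (\<lambda>_. 0)" by auto

text \<open>
  The coefficient is multiplicative up to a factor that only depends on the letter counts. The
  coordinate functionals below are compatible with multiplication for this reason.
\<close>
lemma straighten_append:
  "straighten_coeff q (u @ w) =
    straighten_coeff q u * straighten_coeff q w * pairing q (count (mset u)) (count (mset w))"
proof (induction u)
  case (Cons i u)
  show ?case
    unfolding append_Cons straighten_coeff.simps Cons count_mset_Cons pairing_add count_mset_append by (simp add: mult_ac)
qed (simp add: count_mset_Nil del: mset.simps)

lemma pairing_unit_le: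
  "(\<And>x. x \<in> set w \<Longrightarrow> i \<le> x) \<Longrightarrow> pairing q (unit_exp i) (count (mset w)) = 1"
proof (induction w)
  case (Cons x w)
  then have "pairing q (unit_exp i) (count (mset w)) = 1" "i \<le> x" by auto
  then show ?case unfolding count_mset_Cons pairing_add pairing_unit by auto
qed (simp add: count_mset_Nil del: mset.simps)

lemma straighten_sorted: "sorted w \<Longrightarrow> straighten_coeff q w = 1"
  by (induction w) (auto simp: pairing_unit_le)

definition std_word :: "('n::{finite,linorder} \<Rightarrow> nat) \<Rightarrow> 'n list" where
  "std_word v = concat (map (\<lambda>i. replicate (v i) i) (sorted_list_of_set UNIV))"

lemma sorted_std_word: "sorted (std_word v)"
proof -
  have "sorted (concat (map (\<lambda>i. replicate (v i) i) xs))" if "sorted xs" for xs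
    using that by (induction xs) (auto simp: sorted_append)
  then show ?thesis by (simp add: std_word_def)
qed

lemma count_std_word: "count (mset (std_word v)) = v"
proof -
  have c: "count (mset (concat (map (\<lambda>i. replicate (v i) i) xs))) j = (if j \<in> set xs then v j else 0)"
    if "distinct xs" for xs j
    using that by (induction xs) auto
  show ?thesis by (rule ext) (simp add: std_word_def c)
qed

lemma sort_eq_std_word: "sort w = std_word (count (mset w))"
  by (rule properties_for_sort) (auto intro!: multiset_eqI simp: count_std_word sorted_std_word)

lemma add_exp_eq_iff:
  fixes f g v :: "'n \<Rightarrow> nat"
  shows "(\<lambda>j. f j + g j) = v \<longleftrightarrow> (\<forall>i. f i \<le> v i) \<and> g = (\<lambda>i. v i - f i)"
proof
  assume "(\<lambda>j. f j + g j) = v"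
  then have "v i = f i + g i" for i by auto
  then show "(\<forall>i. f i \<le> v i) \<and> g = (\<lambda>i. v i - f i)" by auto
qed auto

locale qci_data =
  fixes q :: "'n::{finite,linorder} \<Rightarrow> 'n \<Rightarrow> 'k::field" and a :: "'n \<Rightarrow> nat"
  assumes a_ge: "\<And>i. a i \<ge> 2" and q_diag: "\<And>i. q i i = 1" and q_inv: "\<And>i j. q i j * q j i = 1"
begin

abbreviation "FA \<equiv> free_algebra :: ('k, 'n list \<Rightarrow>\<^sub>0 'k) module"
abbreviation "I \<equiv> qci_ideal q a"
abbreviation "A \<equiv> qci q a"
abbreviation "V \<equiv> exponents a"
abbreviation "xm \<equiv> qci_monom q a"
abbreviation "coef \<equiv> qci_dual_monom q a"
abbreviation A_mult (infixl "\<bullet>" 70) where "X \<bullet> Y \<equiv> X \<otimes>\<^bsub>A\<^esub> Y"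
abbreviation A_scale (infixl "\<cdot>" 70) where "r \<cdot> X \<equiv> r \<odot>\<^bsub>A\<^esub> X"
abbreviation A_add (infixl "\<oplus>\<^sub>A" 65) where "X \<oplus>\<^sub>A Y \<equiv> X \<oplus>\<^bsub>A\<^esub> Y"
abbreviation A_one ("\<one>\<^sub>A") where "\<one>\<^sub>A \<equiv> \<one>\<^bsub>A\<^esub>"
abbreviation A_zero ("\<zero>\<^sub>A") where "\<zero>\<^sub>A \<equiv> \<zero>\<^bsub>A\<^esub>"

sublocale FA: ring FA by (rule ring_free_algebra)

lemma qci_ideal_ideal: "ideal I FA"
  unfolding qci_ideal_def by (rule FA.genideal_ideal) simp

lemma qci_ideal_submodule: "submodule I scalars FA"
proof -
  interpret V: vspace FA by (rule vspace_free_algebra)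
  interpret I: ideal I FA by (rule qci_ideal_ideal)
  show ?thesis
  proof (rule V.submoduleI)
    fix c p assume "p \<in> I"
    then have "(c \<odot>\<^bsub>FA\<^esub> \<one>\<^bsub>FA\<^esub>) \<star> p \<in> I" by (intro I.I_l_closed) auto
    then show "c \<odot>\<^bsub>FA\<^esub> p \<in> I" by (simp only: fa_smult FA.l_one free_algebra_simps(1) UNIV_I)
  next
    show "\<zero>\<^bsub>FA\<^esub> \<in> I" by (rule I.zero_closed)
    show "f \<oplus>\<^bsub>FA\<^esub> g \<in> I" if "f \<in> I" "g \<in> I" for f g using that by (rule I.a_closed)
    show "\<ominus>\<^bsub>FA\<^esub> f \<in> I" if "f \<in> I" for f using that by (rule I.a_inv_closed)
  qed simp
qed

sublocale S: subspace FA I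
  by (rule subspace.intro[OF vspace_free_algebra subspace_axioms.intro[OF qci_ideal_submodule]])

sublocale A: vspace A unfolding qci_def by (rule S.vspace_quot)

lemma ring_A: "ring A"
  unfolding qci_def by (rule ring_quot_module[OF ring_free_algebra qci_ideal_ideal vspace_free_algebra qci_ideal_submodule])

sublocale A: ring A by (rule ring_A)

lemma cls_mult: "S.cls f \<bullet> S.cls g = S.cls (f \<star> g)"
  using ideal.rcoset_mult_add[OF qci_ideal_ideal, of f g] by (simp add: qci_def quot_module_def)

lemma cls_add: "S.cls f \<oplus>\<^bsub>A\<^esub> S.cls g = S.cls (f + g)"
  using S.quot_simps(3)[of f g] by (simp add: qci_def)

lemma cls_smult: "c \<cdot> S.cls g = S.cls (c \<odot>\<^bsub>FA\<^esub> g)"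
  using S.quot_smult[of g c] by (simp add: qci_def)

lemma cls_one: "\<one>\<^bsub>A\<^esub> = S.cls (Poly_Mapping.single [] 1)"
  by (simp add: qci_def quot_module_def)

lemma cls_zero: "\<zero>\<^bsub>A\<^esub> = S.cls 0"
  using S.quot_simps(2) by (simp add: qci_def)

lemma cls_zero_iff: "S.cls f = \<zero>\<^bsub>A\<^esub> \<longleftrightarrow> f \<in> I"
  using S.cls_eq_iff[of f 0] FA.minus_eq[of f "\<zero>\<^bsub>FA\<^esub>"] FA.minus_zero by (simp add: cls_zero)

lemma carrier_A: "carrier A = range S.cls"
  using S.quot_simps(1) by (simp add: qci_def)

lemma smult_A:
  assumes "X \<in> carrier A" "Y \<in> carrier A"
  shows "(c \<cdot> X) \<bullet> Y = c \<cdot> (X \<bullet> Y)" "X \<bullet> (c \<cdot> Y) = c \<cdot> (X \<bullet> Y)"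
proof -
  obtain f g where X: "X = S.cls f" "Y = S.cls g" using assms carrier_A by auto
  show "(c \<cdot> X) \<bullet> Y = c \<cdot> (X \<bullet> Y)" "X \<bullet> (c \<cdot> Y) = c \<cdot> (X \<bullet> Y)"
    unfolding X cls_smult cls_mult fa_smult by (rule refl)+
qed

lemma k_algebra_A: "k_algebra A"
  using ring_A A.vspace_axioms smult_A by (auto simp: k_algebra_def vspace_def)

section \<open>Straightening words in a quantum complete intersection\<close>

definition word :: "'n list \<Rightarrow> ('n list \<Rightarrow>\<^sub>0 'k) set" where
  "word w = S.cls (Poly_Mapping.single w 1)"

lemma word_closed [simp]: "word w \<in> carrier A" by (auto simp: word_def carrier_A)

lemma word_append: "word (u @ w) = word u \<bullet> word w"
  by (simp add: word_def cls_mult fa_mult_single)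

lemma word_Nil: "word [] = \<one>\<^sub>A" by (simp add: word_def cls_one)

lemma gen_eq_word: "qci_gen q a i = word [i]" by (simp add: qci_gen_def word_def free_gen_def)

lemma gen_pow: "word [i] [^]\<^bsub>A\<^esub> (n::nat) = word (replicate n i)"
  by (induction n) (simp_all add: word_Nil word_append[symmetric] replicate_append_same)

lemma free_gen_pow: "free_gen i [^]\<^bsub>FA\<^esub> (n::nat) = Poly_Mapping.single (replicate n i) 1"
  by (induction n) (simp_all add: free_gen_def fa_mult_single replicate_append_same)

lemma relations_in_I: "qci_relations q a \<subseteq> I"
  unfolding qci_ideal_def by (rule FA.genideal_self) simp

lemma word_power_zero: "word (replicate (a i) i) = \<zero>\<^sub>A"
  unfolding word_def cls_zero_iff
  using relations_in_I by (auto simp: qci_relations_def free_gen_pow)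

lemma word_swap: "word [j, i] = q i j \<cdot> word [i, j]"
proof -
  have m: "free_gen k \<star> free_gen l = Poly_Mapping.single [k, l] 1" for k l
    by (simp add: free_gen_def fa_mult_single)
  have "Poly_Mapping.single [j, i] 1 \<ominus>\<^bsub>FA\<^esub> (q i j \<odot>\<^bsub>FA\<^esub> Poly_Mapping.single [i, j] 1) \<in> I"
    using relations_in_I unfolding qci_relations_def m by blast
  then show ?thesis unfolding word_def cls_smult by (subst S.cls_eq_iff) auto
qed

lemma monom_eq_word: "xm v = word (std_word v)"
proof -
  have "foldr (\<lambda>i y. qci_gen q a i [^]\<^bsub>A\<^esub> v i \<bullet> y) xs \<one>\<^sub>A = word (concat (map (\<lambda>i. replicate (v i) i) xs))" for xs
    by (induction xs) (simp_all add: word_Nil gen_eq_word gen_pow word_append)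
  then show ?thesis by (simp add: qci_monom_def std_word_def)
qed

text \<open>
  The letter \<open>i\<close> is swapped with the letters smaller than \<open>i\<close>; these are the ones that contribute
  to the pairing.
\<close>
lemma word_insort:
  "sorted w \<Longrightarrow> word (i # w) = pairing q (unit_exp i) (count (mset w)) \<cdot> word (insort i w)"
proof (induction w)
  case (Cons y w)
  show ?case
  proof (cases "i \<le> y")
    case True
    then have "pairing q (unit_exp i) (count (mset (y # w))) = 1"
      using Cons.prems by (intro pairing_unit_le) auto
    then show ?thesis using True by (simp del: mset.simps)
  next
    case False
    have w: "word (z # u) = word [z] \<bullet> word u" for z u using word_append[of "[z]" u] by simp
    have "word (i # y # w) = word [i, y] \<bullet> word w" using word_append[of "[i, y]" w] by simp
    also have "\<dots> = q y i \<cdot> (word [y, i] \<bullet> word w)" by (simp add: word_swap[of i y] smult_A)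
    also have "word [y, i] \<bullet> word w = word [y] \<bullet> word (i # w)"
      using word_append[of "[y, i]" w] w[of y "i # w"] by simp
    also have "\<dots> = pairing q (unit_exp i) (count (mset w)) \<cdot> word (insort i (y # w))"
      using Cons False w[of y "insort i w"] by (simp add: smult_A)
    finally have e: "word (i # y # w) = q y i \<cdot> (pairing q (unit_exp i) (count (mset w)) \<cdot> word (insort i (y # w)))" .
    have "y < i" using False by simp
    then show ?thesis
      using False unfolding e count_mset_Cons pairing_add pairing_unit by (simp add: A.vs_assoc)
  qed
qed (simp add: count_mset_Nil del: mset.simps)

lemma word_sort: "word w = straighten_coeff q w \<cdot> word (sort w)"
proof (induction w)
  case (Cons i w)
  have "word (i # w) = word [i] \<bullet> word w" using word_append[of "[i]" w] by simp
  also have "\<dots> = straighten_coeff q w \<cdot> word (i # sort w)"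
    using word_append[of "[i]" "sort w"] by (subst Cons) (simp add: smult_A)
  also have "\<dots> = straighten_coeff q (i # w) \<cdot> word (sort (i # w))"
    by (simp add: word_insort A.vs_assoc[symmetric] mult.commute)
  finally show ?case .
qed simp

lemma word_monom: "word w = straighten_coeff q w \<cdot> xm (count (mset w))"
  using word_sort[of w] by (simp add: monom_eq_word sort_eq_std_word)

lemma monom_closed [simp]: "xm v \<in> carrier A" by (simp add: monom_eq_word)

lemma monom_mult: "xm v \<bullet> xm w = pairing q v w \<cdot> xm (\<lambda>i. v i + w i)"
proof -
  have "xm v \<bullet> xm w = word (std_word v @ std_word w)" by (simp add: monom_eq_word word_append)
  also have "\<dots> = pairing q v w \<cdot> xm (\<lambda>i. v i + w i)"
    unfolding word_monom[of "std_word v @ std_word w"] straighten_append count_mset_append count_std_word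
    by (simp add: straighten_sorted sorted_std_word)
  finally show ?thesis .
qed

lemma monom_0: "xm (\<lambda>_. 0) = \<one>\<^sub>A"
  using word_monom[of "[]"] by (simp add: count_mset_Nil word_Nil del: mset.simps)

lemma monom_unit: "xm (unit_exp i) = word [i]"
proof -
  have "count (mset [i]) = unit_exp i" by (auto simp: unit_exp_def)
  then show ?thesis
    using word_monom[of "[i]"] straighten_sorted[of "[i]" q] by (simp del: mset.simps straighten_coeff.simps)
qed

text \<open>
  A letter \<open>i\<close> of exponent at least \<open>a i\<close> occurs in one block in the sorted word, and the block
  contains the relation \<open>x\<^sub>i\<^bsup>a i\<^esup> = 0\<close>.
\<close>
lemma monom_zero: "v \<notin> V \<Longrightarrow> xm v = \<zero>\<^sub>A"
proof -
  assume "v \<notin> V"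
  then obtain i where "\<not> v i \<le> a i - 1" by (auto simp: exponents_def)
  then have "v i \<ge> a i" by simp
  then obtain k where k: "v i = a i + k" using le_Suc_ex by blast
  obtain ys zs where l: "sorted_list_of_set (UNIV :: 'n set) = ys @ i # zs"
    using split_list[of i "sorted_list_of_set UNIV"] by auto
  have "std_word v = concat (map (\<lambda>i. replicate (v i) i) ys) @ replicate (a i) i @
      (replicate k i @ concat (map (\<lambda>i. replicate (v i) i) zs))"
    unfolding std_word_def l by (simp add: k replicate_add)
  then show ?thesis by (simp add: monom_eq_word word_append word_power_zero)
qed

section \<open>Linear independence of the standard monomials\<close>

text \<open>
  The functional on the free algebra that sends a word to its straightening coefficient if it sorts
  to the monomial \<open>x\<^sub>v\<close>, and to 0 otherwise.
\<close>
definition coord :: "('n \<Rightarrow> nat) \<Rightarrow> ('n list \<Rightarrow>\<^sub>0 'k) \<Rightarrow> 'k" where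
  "coord v = free_lift scalars (\<lambda>w. if count (mset w) = v then straighten_coeff q w else 0)"

lemma coord_linear: "linear_map FA scalars (coord v)"
  using vspace.free_lift_linear[OF vspace_scalars, of _ UNIV] unfolding coord_def linear_map_def by simp

lemma coord_simps:
  "coord v (f + g) = coord v f + coord v g" "coord v (Poly_Mapping.map ((*) c) f) = c * coord v f"
  "coord v 0 = 0"
  using linear_mapD[OF coord_linear] linear_map_zero[OF vspace_free_algebra vspace_scalars coord_linear]
  by simp_all

lemma coord_single: "coord v (Poly_Mapping.single w c) = c * (if count (mset w) = v then straighten_coeff q w else 0)"
  unfolding coord_def by (subst vspace.free_lift_single[OF vspace_scalars]) auto

text \<open>
  A coordinate of a product with a word is a multiple of the coordinate at a smaller exponent. As
  \<^term>\<open>exponents a\<close> is closed under passing to smaller exponents, the elements at which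
  all coordinates in it vanish form a left ideal; together with \<open>coord_mult_r\<close>, a two-sided one.
\<close>
lemma coord_mult_l:
  "coord v (Poly_Mapping.single u c \<star> f) = c * straighten_coeff q u *
    (if \<forall>i. count (mset u) i \<le> v i then pairing q (count (mset u)) (\<lambda>i. v i - count (mset u) i) *
      coord (\<lambda>i. v i - count (mset u) i) f else 0)"
proof (induction f rule: poly_mapping_add_induct)
  case (single w d)
  have "count (mset (u @ w)) = v \<longleftrightarrow> (\<forall>i. count (mset u) i \<le> v i) \<and> count (mset w) = (\<lambda>i. v i - count (mset u) i)"
    unfolding count_mset_append by (rule add_exp_eq_iff)
  then show ?case by (simp add: fa_mult_single coord_single straighten_append mult_ac)
qed (simp_all add: coord_simps fa_add_r algebra_simps)

lemma coord_mult_r: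
  "coord v (f \<star> Poly_Mapping.single u c) = c * straighten_coeff q u *
    (if \<forall>i. count (mset u) i \<le> v i then pairing q (\<lambda>i. v i - count (mset u) i) (count (mset u)) *
      coord (\<lambda>i. v i - count (mset u) i) f else 0)"
proof (induction f rule: poly_mapping_add_induct)
  case (single w d)
  have "count (mset (w @ u)) = v \<longleftrightarrow> (\<forall>i. count (mset u) i \<le> v i) \<and> count (mset w) = (\<lambda>i. v i - count (mset u) i)"
    unfolding count_mset_append add.commute[of "count (mset w) _"] by (rule add_exp_eq_iff)
  then show ?case by (simp add: fa_mult_single coord_single straighten_append mult_ac)
qed (simp_all add: coord_simps fa_add_l algebra_simps)

lemma exponents_diff: "v \<in> V \<Longrightarrow> (\<lambda>i. v i - u i) \<in> V"
  unfolding exponents_def by (simp add: le_trans[OF diff_le_self])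

text \<open>
  The common zeros of the coordinates form an ideal that contains the defining relations.
\<close>
lemma coord_I: "f \<in> I \<Longrightarrow> v \<in> V \<Longrightarrow> coord v f = 0"
proof -
  let ?K = "{f. \<forall>v\<in>V. coord v f = 0}"
  have neg: "coord v (\<ominus>\<^bsub>FA\<^esub> f) = - coord v f" for v f
    using S.vs_neg[of f] linear_mapD(3)[OF coord_linear, of f v "-1"] by simp
  have "submodule ?K scalars FA"
    by (rule S.submoduleI) (auto simp: coord_simps neg)
  then have sub: "subgroup ?K (add_monoid FA)" by (simp add: submodule_def)
  have "ideal ?K FA"
  proof (rule idealI[OF ring_free_algebra sub])
    fix f g assume f: "f \<in> ?K"
    have l: "\<forall>v\<in>V. coord v (g \<star> f) = 0"
      by (induction g rule: poly_mapping_add_induct) (use f exponents_diff in \<open>auto simp: coord_mult_l coord_simps fa_add_l\<close>)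
    have r: "\<forall>v\<in>V. coord v (f \<star> g) = 0"
      by (induction g rule: poly_mapping_add_induct) (use f exponents_diff in \<open>auto simp: coord_mult_r coord_simps fa_add_r\<close>)
    show "g \<star> f \<in> ?K" "f \<star> g \<in> ?K" using l r by auto
  qed
  moreover have "qci_relations q a \<subseteq> ?K"
  proof -
    have "coord v (Poly_Mapping.single (replicate (a i) i) 1) = 0" if "v \<in> V" for i v
    proof -
      have "count (mset (replicate (a i) i)) i = a i" by simp
      moreover have "v i < a i" using that a_ge[of i] unfolding exponents_def by (auto dest: spec[of _ i])
      ultimately have "count (mset (replicate (a i) i)) \<noteq> v" by (auto simp del: count_mset)
      then show ?thesis by (simp add: coord_single)
    qed
    moreover have "coord v (Poly_Mapping.single [j, i] 1 \<ominus>\<^bsub>FA\<^esub> (q i j \<odot>\<^bsub>FA\<^esub> Poly_Mapping.single [i, j] 1)) = 0" for i j v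
    proof -
      have s: "straighten_coeff q [k, l] = (if l < k then q l k else 1)" for k l
        by (simp add: count_mset_Cons count_mset_Nil pairing_add pairing_unit del: mset.simps)
      have "count (mset [j, i]) = count (mset [i, j])" by (auto simp: fun_eq_iff)
      then show ?thesis
        using q_inv[of i j] q_inv[of j i] q_diag[of i] unfolding a_minus_def
        by (auto simp: coord_simps coord_single neg s simp del: mset.simps straighten_coeff.simps)
    qed
    ultimately show ?thesis
      by (auto simp: qci_relations_def free_gen_pow) (simp_all add: free_gen_def fa_mult_single)
  qed
  ultimately have "I \<subseteq> ?K" unfolding qci_ideal_def by (intro FA.genideal_minimal)
  then show "f \<in> I \<Longrightarrow> v \<in> V \<Longrightarrow> coord v f = 0" by blast
qed

lemma finite_V: "finite V"
proof -
  have "V = Pi\<^sub>E UNIV (\<lambda>i. {..a i - 1})"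
    by (simp add: exponents_def PiE_def extensional_def Pi_def)
  then show ?thesis by (simp add: finite_PiE)
qed

definition lin_comb :: "(('n \<Rightarrow> nat) \<Rightarrow> 'k) \<Rightarrow> ('n list \<Rightarrow>\<^sub>0 'k) set" where
  "lin_comb c = (\<Oplus>\<^bsub>A\<^esub>v\<in>V. c v \<cdot> xm v)"

lemma lin_comb_span: "X \<in> carrier A \<Longrightarrow> \<exists>c. X = lin_comb c"
proof -
  have "\<exists>c. S.cls f = lin_comb c" for f
  proof (induction f rule: poly_mapping_add_induct)
    case zero
    have "lin_comb (\<lambda>_. 0) = \<zero>\<^sub>A" unfolding lin_comb_def by (rule A.add.finprod_one_eqI) simp
    then show ?case using cls_zero by metis
  next
    case (single w c)
    let ?v = "count (mset w)"
    have "c \<odot>\<^bsub>FA\<^esub> Poly_Mapping.single w 1 = Poly_Mapping.single w c"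
      by (auto intro!: poly_mapping_eqI simp: lookup_single when_def)
    then have e: "S.cls (Poly_Mapping.single w c) = (c * straighten_coeff q w) \<cdot> xm ?v"
      using word_monom[of w] cls_smult[of c "Poly_Mapping.single w 1"]
      by (simp add: word_def A.vs_assoc del: free_algebra_simps)
    show ?case
    proof (cases "?v \<in> V")
      case True
      have "lin_comb (\<lambda>v. if v = ?v then c * straighten_coeff q w else 0) = (c * straighten_coeff q w) \<cdot> xm ?v"
        unfolding lin_comb_def using finite_V True by (intro A.finsum_delta[of _ ?v]) auto
      with e show ?thesis by metis
    next
      case False
      have "lin_comb (\<lambda>_. 0) = \<zero>\<^sub>A" unfolding lin_comb_def by (rule A.add.finprod_one_eqI) simp
      then show ?thesis using e monom_zero[OF False] by (metis A.smult_r_null UNIV_I scalars_simps(1))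
    qed
  next
    case (add f g)
    then obtain c d where "S.cls f = lin_comb c" "S.cls g = lin_comb d" by blast
    then have "S.cls (f + g) = lin_comb (\<lambda>v. c v + d v)"
      unfolding cls_add[symmetric] lin_comb_def by (simp add: A.vs_distr_l A.finsum_addf Pi_iff)
    then show ?case by blast
  qed
  then show "X \<in> carrier A \<Longrightarrow> \<exists>c. X = lin_comb c" using carrier_A by auto
qed

text \<open>
  A linear combination of monomials lifts to the free algebra, where the coordinates read off its
  coefficients; on the ideal the coordinates vanish.
\<close>
lemma lin_comb_inj: "lin_comb c = lin_comb d \<Longrightarrow> v \<in> V \<Longrightarrow> c v = d v"
proof -
  have e: "\<exists>f. lin_comb c = S.cls f \<and> (\<forall>v\<in>V. coord v f = c v)" for c
  proof (intro exI conjI)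
    let ?f = "\<lambda>V. (\<Oplus>\<^bsub>FA\<^esub>v\<in>V. c v \<odot>\<^bsub>FA\<^esub> Poly_Mapping.single (std_word v) 1)"
    have l: "linear_map FA A S.cls" using S.linear_cls by (simp add: qci_def)
    show "lin_comb c = S.cls (?f V)"
      unfolding lin_comb_def
      by (subst linear_map_finsum[OF vspace_free_algebra A.vspace_axioms l finite_V])
        (auto simp: cls_smult[symmetric] word_def[symmetric] monom_eq_word simp del: free_algebra_simps(2-))
    show "\<forall>v\<in>V. coord v (?f V) = c v"
    proof
      fix u assume u: "u \<in> V"
      have "coord u (?f V) = (\<Oplus>\<^bsub>scalars\<^esub>v\<in>V. coord u (c v \<odot>\<^bsub>FA\<^esub> Poly_Mapping.single (std_word v) 1))"
        by (rule linear_map_finsum[OF vspace_free_algebra vspace_scalars coord_linear finite_V]) simp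
      also have "\<dots> = (\<Sum>v\<in>V. if v = u then c v else 0)"
        unfolding finsum_scalars[OF finite_V]
        by (intro sum.cong) (auto simp: coord_simps coord_single count_std_word straighten_sorted sorted_std_word)
      also have "\<dots> = c u" using u finite_V by simp
      finally show "coord u (?f V) = c u" .
    qed
  qed
  assume eq: "lin_comb c = lin_comb d" and v: "v \<in> V"
  obtain f g where f: "lin_comb c = S.cls f" "\<forall>v\<in>V. coord v f = c v"
    and g: "lin_comb d = S.cls g" "\<forall>v\<in>V. coord v g = d v" using e by metis
  have "f \<ominus>\<^bsub>FA\<^esub> g \<in> I" using eq f g S.cls_eq_iff[of f g] by simp
  then have z: "coord v (f \<ominus>\<^bsub>FA\<^esub> g) = 0" using v coord_I by blast
  have "coord v (\<ominus>\<^bsub>FA\<^esub> g) = - coord v g"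
    using S.vs_neg[of g] linear_mapD(3)[OF coord_linear, of g v "-1"] by simp
  with z f g v show "c v = d v" by (simp add: a_minus_def coord_simps)
qed

end

section \<open>Coordinates and linear maps on the standard basis\<close>

context qci_data
begin

lemma lin_comb_cong: "(\<And>v. v \<in> V \<Longrightarrow> c v = d v) \<Longrightarrow> lin_comb c = lin_comb d"
  unfolding lin_comb_def by (rule A.finsum_cong') auto

lemma lin_comb_closed [simp]: "lin_comb c \<in> carrier A"
  unfolding lin_comb_def by (rule A.finsum_closed) auto

lemma coords_lin_comb: "qci_coords q a (lin_comb c) v = (if v \<in> V then c v else 0)"
proof -
  have "qci_coords q a (lin_comb c) = (\<lambda>v. if v \<in> V then c v else 0)"
    unfolding qci_coords_def lin_comb_def[symmetric]
  proof (rule the_equality)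
    show "(\<forall>v. v \<notin> V \<longrightarrow> (if v \<in> V then c v else 0) = 0) \<and> lin_comb c = lin_comb (\<lambda>v. if v \<in> V then c v else 0)"
      by (intro conjI lin_comb_cong) auto
    fix d assume d: "(\<forall>v. v \<notin> V \<longrightarrow> d v = 0) \<and> lin_comb c = lin_comb d"
    then show "d = (\<lambda>v. if v \<in> V then c v else 0)" using lin_comb_inj[of c d] by (auto simp: fun_eq_iff)
  qed
  then show ?thesis by simp
qed

lemma lin_comb_coords: "X \<in> carrier A \<Longrightarrow> lin_comb (\<lambda>v. coef v X) = X"
proof -
  assume "X \<in> carrier A"
  then obtain c where "X = lin_comb c" using lin_comb_span by metis
  moreover have "lin_comb (\<lambda>v. coef v (lin_comb c)) = lin_comb c"
    by (rule lin_comb_cong) (simp add: qci_dual_monom_def coords_lin_comb)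
  ultimately show ?thesis by simp
qed

lemma lin_comb_add: "lin_comb c \<oplus>\<^sub>A lin_comb d = lin_comb (\<lambda>v. c v + d v)"
  unfolding lin_comb_def by (simp add: A.vs_distr_l A.finsum_addf Pi_iff)

lemma lin_comb_smult: "r \<cdot> lin_comb d = lin_comb (\<lambda>v. r * d v)"
  unfolding lin_comb_def by (simp add: A.vs_finsum_smult finite_V Pi_iff A.vs_assoc)

lemma lin_comb_delta: "v \<in> V \<Longrightarrow> lin_comb (\<lambda>w. if w = v then 1 else 0) = xm v"
  unfolding lin_comb_def using finite_V by (intro A.finsum_delta[of _ v]) auto

lemma dual_linear: "linear_map A scalars (coef v)"
  unfolding linear_map_def
proof (intro conjI ballI allI)
  fix X Y r assume "X \<in> carrier A" "Y \<in> carrier A"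
  then obtain c d where "X = lin_comb c" "Y = lin_comb d" using lin_comb_span by metis
  then show "coef v (X \<oplus>\<^sub>A Y) = coef v X \<oplus>\<^bsub>scalars\<^esub> coef v Y"
    "coef v (r \<cdot> X) = r \<odot>\<^bsub>scalars\<^esub> coef v X"
    by (simp_all add: lin_comb_add lin_comb_smult qci_dual_monom_def coords_lin_comb)
qed simp

lemmas coef_zero = linear_map_zero[OF A.vspace_axioms vspace_scalars dual_linear]
lemmas coef_scale = linear_mapD(3)[OF dual_linear, simplified]

lemma dual_monom: "u \<in> V \<Longrightarrow> coef v (xm u) = (if u = v then 1 else 0)"
  using coords_lin_comb[of "\<lambda>w. if w = u then 1 else 0" v] by (auto simp: lin_comb_delta qci_dual_monom_def)

lemma linear_map_lin_comb:
  assumes "vspace P" "linear_map A P f"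
  shows "f (lin_comb c) = (\<Oplus>\<^bsub>P\<^esub>v\<in>V. c v \<odot>\<^bsub>P\<^esub> f (xm v))"
proof -
  interpret P: vspace P by fact
  show ?thesis unfolding lin_comb_def using linear_mapD[OF assms(2)]
    by (subst linear_map_finsum[OF A.vspace_axioms assms finite_V]) auto
qed

lemma linear_ext:
  assumes "vspace P" "linear_map A P f" "linear_map A P g" "\<And>v. v \<in> V \<Longrightarrow> f (xm v) = g (xm v)" "X \<in> carrier A"
  shows "f X = g X"
proof -
  interpret P: vspace P by fact
  obtain c where X: "X = lin_comb c" using lin_comb_span assms(5) by metis
  show ?thesis unfolding X linear_map_lin_comb[OF assms(1,2)] linear_map_lin_comb[OF assms(1,3)]
    using assms(4) linear_mapD(1)[OF assms(3)] by (intro P.finsum_cong') auto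
qed

lemma bilinear_ext:
  assumes "vspace P" "bilinear_map A A P f" "bilinear_map A A P g"
    "\<And>v w. v \<in> V \<Longrightarrow> w \<in> V \<Longrightarrow> f (xm v) (xm w) = g (xm v) (xm w)" "X \<in> carrier A" "Y \<in> carrier A"
  shows "f X Y = g X Y"
proof -
  have "f (xm v) Y = g (xm v) Y" if "v \<in> V" for v
    by (rule linear_ext[OF assms(1) bilinear_mapD(1)[OF assms(2)] bilinear_mapD(1)[OF assms(3)] _ assms(6)])
      (use that assms(4) in auto)
  then show ?thesis
    by (rule linear_ext[OF assms(1) bilinear_mapD(2)[OF assms(2,6)] bilinear_mapD(2)[OF assms(3,6)] _ assms(5)])
qed

lemma extend_linear:
  assumes "vspace P" "\<And>v. v \<in> V \<Longrightarrow> f v \<in> carrier P"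
  shows "linear_map A P (qci_extend q a P f)"
proof -
  interpret P: vspace P by fact
  have "linear_map A P (\<lambda>X. \<Oplus>\<^bsub>P\<^esub>v\<in>V. coef v X \<odot>\<^bsub>P\<^esub> f v)"
    by (rule P.linear_map_finsum_fun[OF finite_V A.vspace_axioms P.linear_map_scalar_smult[OF dual_linear assms(2)]])
  then show ?thesis by (simp add: qci_extend_def[abs_def])
qed

lemma extend_monom:
  assumes "vspace P" "\<And>v. v \<in> V \<Longrightarrow> f v \<in> carrier P" "v \<in> V"
  shows "qci_extend q a P f (xm v) = f v"
proof -
  interpret P: vspace P by fact
  show ?thesis unfolding qci_extend_def
    using finite_V assms(2,3) by (intro P.finsum_delta[of _ v]) (auto simp: dual_monom)
qed

lemma mult_bilinear: "bilinear_map A A A (\<lambda>X Y. X \<bullet> Y)"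
  by (intro bilinear_mapI) (simp_all add: linear_map_def A.l_distr A.r_distr smult_A)

lemma xm_inj: "inj_on xm V"
proof (rule inj_onI)
  fix v w assume a: "v \<in> V" "w \<in> V" "xm v = xm w"
  then have "coef v (xm w) = 1" using dual_monom[OF a(1), of v] by simp
  then show "v = w" unfolding dual_monom[OF a(2)] by (metis zero_neq_one)
qed

lemma finite_dim_A: "finite_dim A"
  unfolding finite_dim_def
proof (intro exI[of _ "xm ` V"] conjI ballI)
  fix X assume "X \<in> carrier A"
  then obtain c where "X = lin_comb c" using lin_comb_span by metis
  also have "\<dots> = (\<Oplus>\<^bsub>A\<^esub>b\<in>xm ` V. c (the_inv_into V xm b) \<cdot> b)"
    unfolding lin_comb_def using xm_inj
    by (subst A.add.finprod_reindex, force, assumption)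
      (rule A.finsum_cong'; simp add: the_inv_into_f_f)
  finally show "\<exists>c. X = (\<Oplus>\<^bsub>A\<^esub>b\<in>xm ` V. c b \<cdot> b)" by (intro exI[of _ "\<lambda>b. c (the_inv_into V xm b)"])
qed (use finite_V in auto)

section \<open>The top monomial\<close>

abbreviation "tp \<equiv> top_exp a"
abbreviation compl where "compl v \<equiv> (\<lambda>i. a i - 1 - v i)"
abbreviation "tr \<equiv> coef (top_exp a)"

lemma top_in_V [simp]: "tp \<in> V" by (simp add: top_exp_def exponents_def)
lemma zero_in_V [simp]: "(\<lambda>_. 0) \<in> V" by (simp add: exponents_def)
lemma compl_in_V [simp]: "compl v \<in> V"
  unfolding exponents_def mem_Collect_eq by (intro allI diff_le_self)
lemma V_le: "v \<in> V \<Longrightarrow> v i \<le> a i - 1" by (simp add: exponents_def)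
lemma unit_in_V [simp]: "unit_exp i \<in> V"
proof -
  have "1 \<le> a j - 1" for j using a_ge[of j] by simp
  then show ?thesis by (auto simp: exponents_def unit_exp_def)
qed
lemma compl_compl: "v \<in> V \<Longrightarrow> compl (compl v) = v"
  by (rule ext) (rule diff_diff_cancel[OF V_le])
lemma compl_add: "v \<in> V \<Longrightarrow> (\<lambda>i. compl v i + v i) = tp" "v \<in> V \<Longrightarrow> (\<lambda>i. v i + compl v i) = tp"
  unfolding top_exp_def by (rule ext, rule le_add_diff_inverse2[OF V_le] le_add_diff_inverse[OF V_le], assumption)+
lemma add_eq_top: "v \<in> V \<Longrightarrow> (\<lambda>i. w i + v i) = tp \<longleftrightarrow> w = compl v" "v \<in> V \<Longrightarrow> (\<lambda>i. v i + w i) = tp \<longleftrightarrow> w = compl v"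
proof -
  assume "v \<in> V"
  then have "v i \<le> a i - 1" for i by (simp add: exponents_def)
  then show "(\<lambda>i. w i + v i) = tp \<longleftrightarrow> w = compl v" "(\<lambda>i. v i + w i) = tp \<longleftrightarrow> w = compl v"
    unfolding fun_eq_iff top_exp_def by (metis add.commute add_diff_cancel_left' le_add_diff_inverse)+
qed

lemma xm_nonzero: "v \<in> V \<Longrightarrow> xm v \<noteq> \<zero>\<^sub>A"
  using dual_monom[of v v] coef_zero[of v] by auto

lemma q_nz: "q i j \<noteq> 0" using q_inv[of i j] by auto
lemma pairing_nz: "pairing q u v \<noteq> 0" by (simp add: pairing_def q_nz)

lemma tr_mult: "tr (xm v \<bullet> xm w) = (if (\<lambda>i. v i + w i) = tp then pairing q v w else 0)"
proof (cases "(\<lambda>i. v i + w i) \<in> V")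
  case True then show ?thesis by (simp add: monom_mult coef_scale dual_monom)
next
  case False
  then show ?thesis using coef_zero top_in_V
    by (auto simp: monom_mult monom_zero)
qed

end

section \<open>Identities between structure coefficients\<close>

lemma q_pairing_nat: "q_pairing q (\<lambda>i. int (u i)) (\<lambda>i. int (v i)) = pairing q u v"
proof -
  have "pairing q u v = (\<Prod>(i, j)\<in>UNIV \<times> UNIV. (if i < j then q i j else 1) ^ (u j * v i))"
    by (simp add: pairing_def prod.cartesian_product)
  also have "\<dots> = (\<Prod>(i, j)\<in>{(i, j). i < j}. q i j ^ (u j * v i))"
    by (rule prod.mono_neutral_cong_right) (auto split: if_splits)
  finally show ?thesis
    by (auto simp: q_pairing_def power_int_def nat_mult_distrib intro!: prod.cong)
qed

lemma perm_vec_unit: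
  assumes "\<pi> permutes UNIV" shows "perm_vec \<pi> (unit_vec k) = (\<lambda>i. int (unit_exp (\<pi> k) i))"
  using assms by (auto simp: perm_vec_def unit_vec_def unit_exp_def fun_eq_iff permutes_inverses permutes_inv_eq)

text \<open>
  The factor \<open>q\<^bsup>\<langle>\<pi>(e\<^sub>k)|\<pi>(e\<^sub>j)\<rangle>\<^esup>\<close> for \<open>j < k\<close>, which is trivial when \<open>\<pi>\<close>
  inverts the pair; extended by 1 to all pairs so that products can be reindexed.
\<close>
definition antipode_base :: "('n::{finite,linorder} \<Rightarrow> 'n \<Rightarrow> 'k::field) \<Rightarrow> ('n \<Rightarrow> 'n) \<Rightarrow> 'n \<Rightarrow> 'n \<Rightarrow> 'k" where
  "antipode_base q \<pi> j k = (if j < k \<and> \<pi> j < \<pi> k then q (\<pi> j) (\<pi> k) else 1)"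

lemma antipode_base_eq:
  "\<pi> permutes UNIV \<Longrightarrow> j < k \<Longrightarrow>
    q_pairing q (perm_vec \<pi> (unit_vec k)) (perm_vec \<pi> (unit_vec j)) = antipode_base q \<pi> j k"
  unfolding perm_vec_unit q_pairing_nat pairing_unit antipode_base_def by simp

lemma prod_less_pairs:
  fixes f g :: "'n::{finite,linorder} \<Rightarrow> 'n \<Rightarrow> 'k::field"
  assumes "\<And>j k. j < k \<Longrightarrow> f j k = g j k" "\<And>j k. \<not> j < k \<Longrightarrow> g j k = 1"
  shows "(\<Prod>(j, k)\<in>{(j, k). j < k}. f j k) = (\<Prod>j\<in>UNIV. \<Prod>k\<in>UNIV. g j k)"
proof -
  have "(\<Prod>(j, k)\<in>{(j, k). j < k}. f j k) = (\<Prod>(j, k)\<in>UNIV \<times> UNIV. g j k)"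
    by (rule prod.mono_neutral_cong_left) (use assms in auto)
  then show ?thesis by (simp add: prod.cartesian_product)
qed

lemma antipode_coeff_eq:
  assumes "\<pi> permutes UNIV"
  shows "antipode_coeff q \<pi> c v =
    (\<Prod>i\<in>UNIV. c i ^ v i) * (\<Prod>j\<in>UNIV. \<Prod>k\<in>UNIV. antipode_base q \<pi> j k ^ (v j * v k))"
  unfolding antipode_coeff_def
  by (subst prod_less_pairs[where g = "\<lambda>j k. antipode_base q \<pi> j k ^ (v j * v k)"])
    (auto simp: antipode_base_eq[OF assms] antipode_base_def)

lemma q_perm_eq:
  assumes "\<pi> permutes UNIV"
  shows "q_perm q a \<pi> = (\<Prod>j\<in>UNIV. \<Prod>k\<in>UNIV. antipode_base q \<pi> j k ^ ((a j - 1) * (a k - 1)))"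
  unfolding q_perm_def
  by (subst prod_less_pairs[where g = "\<lambda>j k. antipode_base q \<pi> j k ^ ((a j - 1) * (a k - 1))"])
    (auto simp: antipode_base_eq[OF assms] antipode_base_def mult.commute)

lemma perm_vec_apply: "\<pi> permutes UNIV \<Longrightarrow> perm_vec \<pi> v (\<pi> i) = v i"
  by (simp add: perm_vec_def permutes_inverses)

lemma prod_reindex_perm: "\<pi> permutes UNIV \<Longrightarrow> (\<Prod>i\<in>UNIV. f (\<pi> i)) = (\<Prod>i\<in>UNIV. f i)"
  using prod.permute[of \<pi> UNIV f] by (simp add: o_def)

lemma prod2_reindex_perm:
  "\<pi> permutes UNIV \<Longrightarrow> (\<Prod>i\<in>UNIV. \<Prod>j\<in>UNIV. f (\<pi> i) (\<pi> j)) = (\<Prod>i\<in>UNIV. \<Prod>j\<in>UNIV. f i j)"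
  by (subst prod_reindex_perm[of \<pi> "\<lambda>i. \<Prod>j\<in>UNIV. f i (\<pi> j)"]) (simp_all add: prod_reindex_perm)

context qci_data
begin

text \<open>
  The scalar \<open>h\<close> at the unit vector \<open>e\<^sub>i\<close> in closed form; see \<open>h_coeff_unit\<close>.
\<close>
definition h_unit :: "'n \<Rightarrow> 'k" where "h_unit i = (\<Prod>j\<in>UNIV. q i j ^ (a j - 1))"

abbreviation "h_exp v \<equiv> \<Prod>i\<in>UNIV. h_unit i ^ v i"

lemma compatD:
  assumes "compatible_perm q a \<pi>"
  shows "\<pi> permutes UNIV" "a (\<pi> i) = a i" "q (\<pi> i) (\<pi> j) = q j i"
  using assms by (auto simp: compatible_perm_def)

lemma perm_exp_in_V: "compatible_perm q a \<pi> \<Longrightarrow> perm_vec \<pi> v \<in> V \<longleftrightarrow> v \<in> V"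
proof -
  assume c: "compatible_perm q a \<pi>"
  note D = compatD[OF c]
  have "(\<forall>i. perm_vec \<pi> v i \<le> a i - 1) \<longleftrightarrow> (\<forall>i. perm_vec \<pi> v (\<pi> i) \<le> a (\<pi> i) - 1)"
  proof (intro iffI allI)
    fix j assume "\<forall>i. perm_vec \<pi> v (\<pi> i) \<le> a (\<pi> i) - 1"
    from this[rule_format, of "inv_into UNIV \<pi> j"] show "perm_vec \<pi> v j \<le> a j - 1"
      unfolding permutes_inverses(1)[OF D(1)] .
  qed simp
  then show ?thesis by (simp add: exponents_def perm_vec_apply[OF D(1)] D(2))
qed

text \<open>
  This makes the attached antipode an anti-homomorphism. After reindexing, all terms are products
  over ordered pairs \<open>(j, k)\<close> of powers with exponent \<open>v j * w k\<close>, and the bases agree for each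
  pair.
\<close>
lemma antipode_coeff_mult:
  assumes "compatible_perm q a \<pi>"
  shows "pairing q v w * antipode_coeff q \<pi> c (\<lambda>i. v i + w i) =
    antipode_coeff q \<pi> c v * antipode_coeff q \<pi> c w * pairing q (perm_vec \<pi> w) (perm_vec \<pi> v)"
proof -
  note D = compatD[OF assms]
  let ?R = "antipode_base q \<pi>"
  define Q where "Q i j = (if i < j then q i j else 1)" for i j
  \<comment> \<open>For \<open>j < k\<close> only the second factor can be nontrivial; for \<open>k < j\<close> the first one is
    cancelled by the third one exactly if \<open>\<pi>\<close> preserves the order of the pair.\<close>
  have key: "Q k j * (?R j k * ?R k j) = Q (\<pi> j) (\<pi> k)" for j k
  proof -
    have inj: "\<pi> j = \<pi> k \<longleftrightarrow> j = k" using permutes_inj[OF D(1)] by (metis injD)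
    show ?thesis
      unfolding Q_def antipode_base_def D(3) using q_inv[of j k] q_inv[of k j] q_diag[of j] inj
      by (cases "j < k"; cases "k < j"; cases "\<pi> j < \<pi> k"; cases "\<pi> k < \<pi> j") simp_all
  qed
  have "pairing q (perm_vec \<pi> w) (perm_vec \<pi> v) = (\<Prod>i\<in>UNIV. \<Prod>j\<in>UNIV. Q (\<pi> i) (\<pi> j) ^ (perm_vec \<pi> w (\<pi> j) * perm_vec \<pi> v (\<pi> i)))"
    unfolding pairing_def Q_def by (rule prod2_reindex_perm[OF D(1), symmetric])
  also have "\<dots> = (\<Prod>j\<in>UNIV. \<Prod>k\<in>UNIV. Q (\<pi> j) (\<pi> k) ^ (v j * w k))"
    by (simp add: perm_vec_apply[OF D(1)] mult.commute)
  also have "\<dots> = (\<Prod>j\<in>UNIV. \<Prod>k\<in>UNIV. Q k j ^ (v j * w k)) *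
     ((\<Prod>j\<in>UNIV. \<Prod>k\<in>UNIV. ?R j k ^ (v j * w k)) * (\<Prod>j\<in>UNIV. \<Prod>k\<in>UNIV. ?R k j ^ (v j * w k)))"
    by (simp only: key[symmetric] power_mult_distrib prod.distrib)
  also have "(\<Prod>j\<in>UNIV. \<Prod>k\<in>UNIV. Q k j ^ (v j * w k)) = pairing q v w"
    unfolding pairing_def Q_def by (rule prod.swap)
  also have "(\<Prod>j\<in>UNIV. \<Prod>k\<in>UNIV. ?R k j ^ (v j * w k)) = (\<Prod>j\<in>UNIV. \<Prod>k\<in>UNIV. ?R j k ^ (w j * v k))"
    by (subst prod.swap) (simp add: mult.commute)
  finally have e: "pairing q (perm_vec \<pi> w) (perm_vec \<pi> v) = pairing q v w *
    ((\<Prod>j\<in>UNIV. \<Prod>k\<in>UNIV. ?R j k ^ (v j * w k)) * (\<Prod>j\<in>UNIV. \<Prod>k\<in>UNIV. ?R j k ^ (w j * v k)))" .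
  show ?thesis
    unfolding e antipode_coeff_eq[OF D(1)] distrib_left distrib_right power_add prod.distrib by (simp only: mult_ac)
qed

lemma antipode_base_involution:
  assumes "compatible_perm q a \<pi>" "\<pi> \<circ> \<pi> = id"
  shows "antipode_base q \<pi> j k * antipode_base q \<pi> (\<pi> j) (\<pi> k) = 1"
proof -
  have "\<pi> (\<pi> i) = i" for i using assms(2) by (metis comp_apply id_apply)
  then show ?thesis using compatD(3)[OF assms(1), of j k] q_inv[of j k] q_inv[of k j]
    by (auto simp: antipode_base_def)
qed

text \<open>
  The coefficient of the square of the attached antipode at \<open>x\<^sub>w\<close>: the factors that depend on
  \<open>q\<close> cancel, because \<open>\<pi>\<close> replaces each of them by its inverse.
\<close>
lemma antipode_coeff_perm:
  assumes "compatible_perm q a \<pi>" "\<pi> \<circ> \<pi> = id"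
  shows "antipode_coeff q \<pi> c w * antipode_coeff q \<pi> c (perm_vec \<pi> w) = (\<Prod>i\<in>UNIV. (c i * c (\<pi> i)) ^ w i)"
proof -
  note D = compatD[OF assms(1)]
  let ?R = "antipode_base q \<pi>"
  have r: "(\<Prod>j\<in>UNIV. \<Prod>k\<in>UNIV. ?R j k ^ (perm_vec \<pi> w j * perm_vec \<pi> w k)) =
     (\<Prod>j\<in>UNIV. \<Prod>k\<in>UNIV. ?R (\<pi> j) (\<pi> k) ^ (w j * w k))"
    using prod2_reindex_perm[OF D(1), of "\<lambda>j k. ?R j k ^ (perm_vec \<pi> w j * perm_vec \<pi> w k)"]
    by (simp add: perm_vec_apply[OF D(1)])
  have c: "(\<Prod>i\<in>UNIV. c i ^ perm_vec \<pi> w i) = (\<Prod>i\<in>UNIV. c (\<pi> i) ^ w i)"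
    using prod_reindex_perm[OF D(1), of "\<lambda>i. c i ^ perm_vec \<pi> w i"] by (simp add: perm_vec_apply[OF D(1)])
  have one: "(\<Prod>j\<in>UNIV. \<Prod>k\<in>UNIV. ?R j k ^ (w j * w k)) * (\<Prod>j\<in>UNIV. \<Prod>k\<in>UNIV. ?R (\<pi> j) (\<pi> k) ^ (w j * w k)) = 1"
    by (simp add: prod.distrib[symmetric] power_mult_distrib[symmetric] antipode_base_involution[OF assms])
  have assoc: "(x * r) * (y * r') = x * y" if "r * r' = 1" for x y r r' :: 'k
  proof -
    have "(x * r) * (y * r') = (x * y) * (r * r')" by (simp only: ac_simps)
    then show ?thesis using that by simp
  qed
  show ?thesis
    unfolding antipode_coeff_eq[OF D(1)] r c power_mult_distrib prod.distrib by (rule assoc[OF one])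
qed

text \<open>
  Exchanging the arguments multiplies by the full commutation factor of the two monomials.
\<close>
lemma pairing_flip: "pairing q u w = pairing q w u * (\<Prod>i\<in>UNIV. \<Prod>j\<in>UNIV. q i j ^ (u j * w i))"
proof -
  define Q where "Q i j = (if i < j then q i j else 1)" for i j
  have key: "Q i j = Q j i * q i j" for i j
    using q_inv[of j i] q_diag[of i] by (cases rule: linorder_cases[of i j]) (auto simp: Q_def)
  have "pairing q w u = (\<Prod>i\<in>UNIV. \<Prod>j\<in>UNIV. Q j i ^ (u j * w i))"
    unfolding pairing_def Q_def by (subst prod.swap) (simp add: mult.commute)
  then show ?thesis
    unfolding pairing_def[of q u w] Q_def[symmetric]
    by (subst key) (simp add: power_mult_distrib prod.distrib)
qed

text \<open>
  Commuting \<open>x\<^sub>w\<close> past the complementary monomial costs \<open>h\<^sub>w = \<Prod> h\<^sub>i\<^bsup>w i\<^esup>\<close>: in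
  \<open>pairing_flip\<close> the monomial \<open>x\<^bsub>a-1-w\<^esub>\<close> may be replaced by \<open>x\<^bsub>a-1\<^esub>\<close>, since \<open>x\<^sub>w\<close>
  commutes with itself.
\<close>
lemma pairing_compl:
  assumes "w \<in> V"
  shows "pairing q (compl w) w = pairing q w (compl w) * (h_exp w)"
proof -
  have "(\<Prod>i\<in>UNIV. \<Prod>j\<in>UNIV. q i j ^ (w j * w i)) = 1"
    using pairing_flip[of w w] pairing_nz[of w w] by simp
  then have "(\<Prod>i\<in>UNIV. \<Prod>j\<in>UNIV. q i j ^ (compl w j * w i)) =
     (\<Prod>i\<in>UNIV. \<Prod>j\<in>UNIV. q i j ^ (compl w j * w i)) * (\<Prod>i\<in>UNIV. \<Prod>j\<in>UNIV. q i j ^ (w j * w i))" by simp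
  also have "\<dots> = (\<Prod>i\<in>UNIV. \<Prod>j\<in>UNIV. q i j ^ ((a j - 1) * w i))"
  proof -
    have "compl w j * w i + w j * w i = (a j - 1) * w i" for i j
      unfolding distrib_right[symmetric] le_add_diff_inverse2[OF V_le[OF assms]] ..
    then show ?thesis by (simp add: prod.distrib[symmetric] power_add[symmetric])
  qed
  also have "\<dots> = (h_exp w)"
    by (simp add: h_unit_def prod_power_distrib power_mult)
  finally show ?thesis using pairing_flip[of "compl w" w] by simp
qed

lemma q_pairing_compl: "w \<in> V \<Longrightarrow> q_pairing q (\<lambda>i. int (a i) - 1 - int (w i)) (\<lambda>i. int (w i)) = pairing q (compl w) w"
  "w \<in> V \<Longrightarrow> q_pairing q (\<lambda>i. int (w i)) (\<lambda>i. int (a i) - 1 - int (w i)) = pairing q w (compl w)"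
proof -
  assume w: "w \<in> V"
  have "int (a i) - 1 - int (w i) = int (compl w i)" for i
    using V_le[OF w, of i] a_ge[of i] by arith
  then show "q_pairing q (\<lambda>i. int (a i) - 1 - int (w i)) (\<lambda>i. int (w i)) = pairing q (compl w) w"
   "q_pairing q (\<lambda>i. int (w i)) (\<lambda>i. int (a i) - 1 - int (w i)) = pairing q w (compl w)"
    by (simp_all only: q_pairing_nat)
qed

lemma h_coeff_unit: "h_coeff q a (unit_vec i) = h_unit i"
proof -
  have u: "unit_vec i = (\<lambda>j. int (unit_exp i j))" by (auto simp: unit_vec_def unit_exp_def)
  have "h_coeff q a (unit_vec i) = pairing q (compl (unit_exp i)) (unit_exp i) / pairing q (unit_exp i) (compl (unit_exp i))"
    unfolding h_coeff_def u by (simp add: q_pairing_compl)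
  also have "\<dots> = (\<Prod>j\<in>UNIV. h_unit j ^ unit_exp i j)"
    by (subst pairing_compl) (simp_all add: pairing_nz)
  also have "\<dots> = (\<Prod>j\<in>UNIV. if j = i then h_unit j else 1)" by (rule prod.cong) (auto simp: unit_exp_def)
  finally show ?thesis by simp
qed

lemma prod_power_unit_exp: "(\<Prod>j\<in>UNIV. f j ^ unit_exp (i :: 'n) j) = (f i :: 'k)"
proof -
  have "(\<Prod>j\<in>UNIV. f j ^ unit_exp i j) = (\<Prod>j\<in>UNIV. if j = i then f j else 1)" by (rule prod.cong) (auto simp: unit_exp_def)
  then show ?thesis by simp
qed

text \<open>
  A compatible permutation transposes \<open>q\<close>, and transposing inverts \<open>q\<close> entrywise.
\<close>
lemma h_unit_perm:
  assumes "compatible_perm q a \<pi>" shows "h_unit (\<pi> i) * h_unit i = 1"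
proof -
  note D = compatD[OF assms]
  have "h_unit (\<pi> i) = (\<Prod>j\<in>UNIV. q (\<pi> i) (\<pi> j) ^ (a (\<pi> j) - 1))"
    unfolding h_unit_def by (rule prod_reindex_perm[OF D(1), symmetric])
  then show ?thesis unfolding h_unit_def
    by (simp add: D prod.distrib[symmetric] power_mult_distrib[symmetric] q_inv)
qed

lemma h_unit_nz: "h_unit i \<noteq> 0" by (simp add: h_unit_def q_nz)

lemma antipode_coeff_top: "compatible_perm q a \<pi> \<Longrightarrow> antipode_coeff q \<pi> c tp = q_perm q a \<pi> * (\<Prod>i\<in>UNIV. c i ^ (a i - 1))"
  using compatD(1) by (simp add: antipode_coeff_eq q_perm_eq top_exp_def)

lemma antipode_coeff_zero: "antipode_coeff q \<pi> c (\<lambda>_. 0) = 1"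
  by (simp add: antipode_coeff_def case_prod_beta)

lemma antipode_coeff_unit: "antipode_coeff q \<pi> c (unit_exp i) = c i"
proof -
  have "(\<Prod>(j, k)\<in>{(j, k). j < k}. q_pairing q (perm_vec \<pi> (unit_vec k)) (perm_vec \<pi> (unit_vec j)) ^ (unit_exp i j * unit_exp i k)) = 1"
    by (rule prod.neutral) (auto simp: unit_exp_def)
  then show ?thesis by (simp add: antipode_coeff_def prod_power_unit_exp)
qed

lemma perm_vec_top: "compatible_perm q a \<pi> \<Longrightarrow> perm_vec \<pi> tp = tp"
proof
  fix i assume "compatible_perm q a \<pi>"
  note D = compatD[OF this]
  have "perm_vec \<pi> tp i = a (inv_into UNIV \<pi> i) - 1" by (simp add: perm_vec_def top_exp_def)
  then show "perm_vec \<pi> tp i = tp i"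
    using D(2)[of "inv_into UNIV \<pi> i"] by (simp add: permutes_inverses[OF D(1)] top_exp_def)
qed

end

section \<open>Signs\<close>

text \<open>
  The factors at \<open>x\<close> and \<open>\<sigma> x\<close> cancel, and the factors at fixed points are trivial.
\<close>
lemma prod_involution:
  fixes f :: "'x \<Rightarrow> 'k::comm_monoid_mult"
  assumes "finite X" "\<And>x. x \<in> X \<Longrightarrow> \<sigma> x \<in> X \<and> \<sigma> (\<sigma> x) = x \<and> f x * f (\<sigma> x) = 1"
    "\<And>x. x \<in> X \<Longrightarrow> \<sigma> x = x \<Longrightarrow> f x = 1"
  shows "prod f X = 1"
  using assms
proof (induction X rule: finite_psubset_induct)
  case (psubset X)
  show ?case
  proof (cases "X = {}")
    case False
    then obtain x where x: "x \<in> X" by auto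
    let ?Y = "X - {x, \<sigma> x}"
    have mem: "\<sigma> y \<in> ?Y" if "y \<in> ?Y" for y
    proof -
      have "\<sigma> y \<noteq> x" using that psubset.prems(1)[of y] by auto
      moreover have "\<sigma> y \<noteq> \<sigma> x" using that psubset.prems(1)[of y] psubset.prems(1)[of x] x by (metis Diff_iff insertCI)
      ultimately show ?thesis using that psubset.prems(1)[of y] by auto
    qed
    have IH: "prod f ?Y = 1"
    proof (rule psubset.IH)
      show "?Y \<subset> X" using x by auto
      show "\<sigma> y \<in> ?Y \<and> \<sigma> (\<sigma> y) = y \<and> f y * f (\<sigma> y) = 1" if "y \<in> ?Y" for y
        using mem[OF that] psubset.prems(1)[of y] that by simp
      show "f y = 1" if "y \<in> ?Y" "\<sigma> y = y" for y using psubset.prems(2)[of y] that by simp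
    qed
    have "prod f {x, \<sigma> x} = 1"
      using psubset.prems(1)[OF x] psubset.prems(2)[OF x] by (cases "\<sigma> x = x") auto
    moreover have "prod f X = prod f ?Y * prod f {x, \<sigma> x}"
      using psubset.hyps x psubset.prems(1)[OF x] by (intro prod.subset_diff) auto
    ultimately show ?thesis using IH by simp
  qed simp
qed

lemma involution_power:
  fixes x :: "'k::comm_monoid_mult"
  assumes "x * x = 1" shows "x ^ n = (if even n then 1 else x)"
proof -
  have "x ^ (2 * m) = 1" for m using assms by (simp add: power_mult power2_eq_square)
  then show ?thesis by (auto elim!: evenE oddE)
qed

context qci_data
begin

lemma h_unit_square_cases: "h_unit i * h_unit i = 1 \<Longrightarrow> h_unit i = 1 \<or> h_unit i = -1"
  using square_eq_1_iff by blast

lemma h_unit_pi: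
  assumes "compatible_perm q a \<pi>" "h_unit i * h_unit i = 1" shows "h_unit (\<pi> i) = h_unit i"
  using h_unit_perm[OF assms(1), of i] assms(2) h_unit_nz[of i] by (metis mult_right_cancel)

text \<open>
  On pairs of indices \<open>\<pi>\<close> acts as an involution that inverts the factors. At a pair of fixed
  indices the base is a sign, and it occurs with an even exponent.
\<close>
lemma q_perm_eq_one:
  assumes compat: "compatible_perm q a \<pi>" and inv: "\<pi> \<circ> \<pi> = id"
    and odd: "\<And>i. \<pi> i = i \<Longrightarrow> odd (a i)"
  shows "q_perm q a \<pi> = 1"
proof -
  note D = compatD[OF compat]
  let ?f = "\<lambda>(j, k). antipode_base q \<pi> j k ^ ((a j - 1) * (a k - 1))"
  have pp: "\<pi> (\<pi> i) = i" for i using inv by (metis comp_apply id_apply)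
  have "prod ?f UNIV = 1"
  proof (rule prod_involution[where \<sigma> = "\<lambda>(j, k). (\<pi> j, \<pi> k)"])
    fix x :: "'n \<times> 'n"
    obtain j k where x: "x = (j, k)" by (cases x)
    show "(case x of (j, k) \<Rightarrow> (\<pi> j, \<pi> k)) \<in> UNIV \<and> (case (case x of (j, k) \<Rightarrow> (\<pi> j, \<pi> k)) of (j, k) \<Rightarrow> (\<pi> j, \<pi> k)) = x \<and>
       ?f x * ?f (case x of (j, k) \<Rightarrow> (\<pi> j, \<pi> k)) = 1"
      by (simp add: x pp D power_mult_distrib[symmetric] antipode_base_involution[OF compat inv])
    assume "(case x of (j, k) \<Rightarrow> (\<pi> j, \<pi> k)) = x"
    then have "\<pi> j = j" "\<pi> k = k" by (simp_all add: x)
    then have "antipode_base q \<pi> j k * antipode_base q \<pi> j k = 1" "even (a j - 1)"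
      using antipode_base_involution[OF compat inv, of j k] odd[of j] by simp_all
    then show "?f x = 1" by (simp add: x involution_power)
  qed simp
  then show ?thesis unfolding q_perm_eq[OF D(1)] by (simp add: prod.cartesian_product)
qed

text \<open>
  Each orbit of \<open>\<pi>\<close> in \<open>J\<^sub>3\<close> has two elements, one of which is smaller than its image.
\<close>
lemma card_J3:
  assumes "compatible_perm q a \<pi>" "\<pi> \<circ> \<pi> = id" "\<And>i. h_unit i * h_unit i = 1"
  shows "card (J3 q a \<pi>) div 2 = card {i. i < \<pi> i \<and> h_unit i = -1 \<and> even (a i)}"
proof -
  note D = compatD[OF assms(1)]
  let ?K = "{i. i < \<pi> i \<and> h_unit i = -1 \<and> even (a i)}"
  have pp: "\<pi> (\<pi> i) = i" for i using assms(2) by (metis comp_apply id_apply)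
  have "J3 q a \<pi> = ?K \<union> \<pi> ` ?K"
  proof
    show "J3 q a \<pi> \<subseteq> ?K \<union> \<pi> ` ?K"
    proof
      fix i assume "i \<in> J3 q a \<pi>"
      then have i: "\<pi> i \<noteq> i" "h_unit i = -1" "even (a i)" by (auto simp: J3_def moved_indices_def h_coeff_unit)
      show "i \<in> ?K \<union> \<pi> ` ?K"
      proof (cases "i < \<pi> i")
        case False
        then have "\<pi> i \<in> ?K" using i pp by (auto simp: D h_unit_pi[OF assms(1,3)])
        then show ?thesis by (intro UnI2 image_eqI[of _ \<pi> "\<pi> i"]) (simp_all only: pp)
      qed (use i in auto)
    qed
    show "?K \<union> \<pi> ` ?K \<subseteq> J3 q a \<pi>"
      using pp by (auto simp: J3_def moved_indices_def h_coeff_unit D h_unit_pi[OF assms(1,3)])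
  qed
  moreover have "card (\<pi> ` ?K) = card ?K" by (intro card_image permutes_inj_on[OF D(1)])
  moreover have "?K \<inter> \<pi> ` ?K = {}" using pp by auto
  ultimately show ?thesis by (simp add: card_Un_disjoint)
qed

text \<open>
  Dividing \<open>c\<^sub>i\<^bsup>a i - 1\<^esup>\<close> at the smaller element of each orbit of \<open>J\<^sub>3\<close> by the sign
  \<open>-1\<close> makes the factors of each orbit multiply to 1. What remains is one sign per orbit.
\<close>
lemma sign_relation:
  assumes compat: "compatible_perm q a \<pi>" and inv: "\<pi> \<circ> \<pi> = id" and h2: "\<And>i. h_unit i * h_unit i = 1"
    and fixed: "\<And>i. \<pi> i = i \<Longrightarrow> h_unit i = 1" and odd: "\<And>i. \<pi> i = i \<Longrightarrow> odd (a i)"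
    and c: "\<And>i. c i * c (\<pi> i) = h_unit i"
  shows "q_perm q a \<pi> * (\<Prod>i\<in>UNIV. c i ^ (a i - 1)) = (-1) ^ (card (J3 q a \<pi>) div 2)"
proof -
  note D = compatD[OF compat]
  have pp: "\<pi> (\<pi> i) = i" for i using inv by (metis comp_apply id_apply)
  define s where "s i = (if i < \<pi> i \<and> h_unit i = -1 \<and> even (a i) then -1 else 1 :: 'k)" for i
  have ss: "s i * s i = 1" for i by (simp add: s_def)
  have "(\<Prod>i\<in>UNIV. c i ^ (a i - 1) * s i) = 1"
  proof (rule prod_involution[where \<sigma> = \<pi>])
    fix i
    have b: "even (a i - 1) \<longleftrightarrow> odd (a i)" using a_ge[of i] by auto
    show "\<pi> i \<in> UNIV \<and> \<pi> (\<pi> i) = i \<and> c i ^ (a i - 1) * s i * (c (\<pi> i) ^ (a (\<pi> i) - 1) * s (\<pi> i)) = 1"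
    proof (intro conjI)
      have "s i * s (\<pi> i) = h_unit i ^ (a i - 1)"
      proof (cases "\<pi> i = i")
        case True
        then show ?thesis using fixed by (simp add: ss)
      next
        case False
        then have "i < \<pi> i \<and> \<not> \<pi> i < i \<or> \<pi> i < i \<and> \<not> i < \<pi> i" by auto
        then show ?thesis
          using b h_unit_square_cases[OF h2, of i]
          by (auto simp: s_def pp D h_unit_pi[OF compat h2] involution_power[OF h2])
      qed
      moreover have "c i ^ (a i - 1) * c (\<pi> i) ^ (a i - 1) = h_unit i ^ (a i - 1)"
        by (simp only: power_mult_distrib[symmetric] c)
      moreover have "c i ^ (a i - 1) * s i * (c (\<pi> i) ^ (a (\<pi> i) - 1) * s (\<pi> i)) =
          (c i ^ (a i - 1) * c (\<pi> i) ^ (a i - 1)) * (s i * s (\<pi> i))"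
        unfolding D by (simp only: mult_ac)
      ultimately have "c i ^ (a i - 1) * s i * (c (\<pi> i) ^ (a (\<pi> i) - 1) * s (\<pi> i)) = h_unit i ^ (a i - 1) * h_unit i ^ (a i - 1)"
        by (simp only:)
      also have "\<dots> = 1" by (simp add: power_mult_distrib[symmetric] h2)
      finally show "c i ^ (a i - 1) * s i * (c (\<pi> i) ^ (a (\<pi> i) - 1) * s (\<pi> i)) = 1" .
    qed (simp_all add: pp)
    assume f: "\<pi> i = i"
    then have "c i * c i = 1" using c[of i] fixed by simp
    moreover have "even (a i - 1)" using odd[OF f] by simp
    ultimately show "c i ^ (a i - 1) * s i = 1" using f by (simp add: involution_power s_def)
  qed simp
  then have e: "(\<Prod>i\<in>UNIV. c i ^ (a i - 1)) * (\<Prod>i\<in>UNIV. s i) = 1" by (simp add: prod.distrib)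
  have "(\<Prod>i\<in>UNIV. s i) = (\<Prod>i\<in>{i. i < \<pi> i \<and> h_unit i = -1 \<and> even (a i)}. -1)"
    by (rule prod.mono_neutral_cong_right) (auto simp: s_def)
  then have S: "(\<Prod>i\<in>UNIV. s i) = (-1) ^ (card (J3 q a \<pi>) div 2)"
    by (simp add: card_J3[OF compat inv h2])
  have ss2: "(\<Prod>i\<in>UNIV. s i) * (\<Prod>i\<in>UNIV. s i) = 1" by (simp add: prod.distrib[symmetric] ss)
  \<comment> \<open>A sign that is inverse to the product is equal to it.\<close>
  have cancel: "x = y" if "x * y = 1" "y * y = 1" for x y :: 'k
  proof -
    have "x = x * (y * y)" using that by simp
    also have "\<dots> = (x * y) * y" by (simp only: mult_ac)
    finally show ?thesis using that by simp
  qed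
  from ss2 have "(\<Prod>i\<in>UNIV. c i ^ (a i - 1)) = (\<Prod>i\<in>UNIV. s i)" by (rule cancel[OF e])
  moreover have "q_perm q a \<pi> = 1" by (rule q_perm_eq_one[OF compat inv]) (rule odd)
  ultimately show ?thesis by (simp add: S)
qed

lemma admissible_iff:
  "admissible_perm q a \<pi> \<longleftrightarrow> compatible_perm q a \<pi> \<and> \<pi> \<circ> \<pi> = id \<and> (\<forall>i. \<pi> i = i \<longrightarrow> h_unit i \<noteq> -1) \<and>
     ((\<exists>i. \<pi> i = i \<and> h_unit i = 1 \<and> even (a i)) \<or> even (card (J3 q a \<pi>) div 2))"
  unfolding admissible_perm_def I1_def I3_def I4_def fixed_indices_def h_coeff_unit by (auto simp: card_eq_0_iff)

text \<open>
  On an orbit with two elements take \<open>1\<close> and \<open>h\<^sub>i\<close>, on fixed points \<open>1\<close>. If some fixed \<open>k\<close>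
  has even \<open>a k\<close>, the total product is a sign that can be moved into \<open>c\<^sub>k\<close>, since the exponent
  \<open>a k - 1\<close> is odd; otherwise the product is given by \<open>sign_relation\<close>.
\<close>
lemma exists_coefficients:
  assumes adm: "admissible_perm q a \<pi>" and h2: "\<And>i. h_unit i * h_unit i = 1"
  shows "\<exists>c. (\<forall>i. c i * c (\<pi> i) = h_unit i) \<and> q_perm q a \<pi> * (\<Prod>i\<in>UNIV. c i ^ (a i - 1)) = 1"
proof -
  have compat: "compatible_perm q a \<pi>" and inv: "\<pi> \<circ> \<pi> = id"
    and fixed: "\<And>i. \<pi> i = i \<Longrightarrow> h_unit i = 1"
    using adm h_unit_square_cases[OF h2] by (auto simp: admissible_iff)
  note D = compatD[OF compat]
  have pp: "\<pi> (\<pi> i) = i" for i using inv by (metis comp_apply id_apply)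
  \<comment> \<open>The value 1 at a fixed index is correct because there \<open>h\<^sub>i = 1\<close>.\<close>
  define c where "c i = (if i < \<pi> i then h_unit i else 1)" for i
  have c: "c i * c (\<pi> i) = h_unit i" for i
    using fixed[of i] by (cases rule: linorder_cases[of i "\<pi> i"]) (auto simp: c_def pp h_unit_pi[OF compat h2])
  show ?thesis
  proof (cases "\<exists>i. \<pi> i = i \<and> h_unit i = 1 \<and> even (a i)")
    case False
    then have o: "\<And>i. \<pi> i = i \<Longrightarrow> odd (a i)" using fixed by blast
    have "q_perm q a \<pi> * (\<Prod>i\<in>UNIV. c i ^ (a i - 1)) = (-1) ^ (card (J3 q a \<pi>) div 2)"
      by (rule sign_relation[OF compat inv h2 fixed o c])
    moreover have "even (card (J3 q a \<pi>) div 2)" using adm False by (auto simp: admissible_iff)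
    ultimately show ?thesis using c by (intro exI[of _ c]) simp
  next
    case True
    then obtain k where k: "\<pi> k = k" "h_unit k = 1" "even (a k)" by auto
    define P where "P = q_perm q a \<pi> * (\<Prod>i\<in>UNIV. c i ^ (a i - 1))"
    have sq1: "q_perm q a \<pi> * q_perm q a \<pi> = 1"
      using antipode_coeff_perm[OF compat inv, of "\<lambda>_. 1" tp]
      unfolding perm_vec_top[OF compat] antipode_coeff_top[OF compat] by simp
    have sq2: "(\<Prod>i\<in>UNIV. c i ^ (a i - 1)) * (\<Prod>i\<in>UNIV. c i ^ (a i - 1)) = 1"
    proof -
      have "c i * c i = 1" for i by (simp add: c_def h2)
      then show ?thesis by (simp add: prod.distrib[symmetric] power_mult_distrib[symmetric])
    qed
    have square: "(x * y) * (x * y) = 1" if "x * x = 1" "y * y = 1" for x y :: 'k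
    proof -
      have "(x * y) * (x * y) = (x * x) * (y * y)" by (simp only: mult_ac)
      then show ?thesis using that by simp
    qed
    have P2: "P * P = 1" unfolding P_def by (rule square[OF sq1 sq2])
    define c' where "c' = c(k := P)"
    have "c' i * c' (\<pi> i) = h_unit i" for i
    proof (cases "i = k")
      case True then show ?thesis by (simp add: c'_def k P2)
    next
      case False
      then have "\<pi> i \<noteq> k" using k pp by metis
      then show ?thesis using False c by (simp add: c'_def)
    qed
    moreover have "q_perm q a \<pi> * (\<Prod>i\<in>UNIV. c' i ^ (a i - 1)) = 1"
    proof -
      have "odd (a k - 1)" using k a_ge[of k] by auto
      then have "P ^ (a k - 1) = P" by (simp add: involution_power[OF P2])
      moreover have "(\<Prod>i\<in>UNIV. c' i ^ (a i - 1)) = P ^ (a k - 1) * (\<Prod>i\<in>UNIV - {k}. c i ^ (a i - 1))"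
        by (subst prod.remove[of _ k]) (auto simp: c'_def intro!: prod.cong)
      moreover have "(\<Prod>i\<in>UNIV. c i ^ (a i - 1)) = (\<Prod>i\<in>UNIV - {k}. c i ^ (a i - 1))"
        by (subst prod.remove[of _ k]) (simp_all add: c_def k)
      ultimately have "q_perm q a \<pi> * (\<Prod>i\<in>UNIV. c' i ^ (a i - 1)) = P * P"
        unfolding P_def by (simp add: mult_ac)
      then show ?thesis by (simp add: P2)
    qed
    ultimately show ?thesis by blast
  qed
qed

text \<open>
  The products \<open>c\<^sub>i c\<^bsub>\<pi> i\<^esub>\<close> are symmetric under \<open>\<pi>\<close> while \<open>\<pi>\<close> inverts \<open>h\<close>, so
  \<open>h\<^sub>i\<^sup>2 = 1\<close>. At fixed indices \<open>h\<^sub>i\<close> is a square.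
\<close>
lemma necessary_admissible:
  assumes compat: "compatible_perm q a \<pi>" and inv: "\<pi> \<circ> \<pi> = id" and c: "\<And>i. c i * c (\<pi> i) = h_unit i"
    and rel: "q_perm q a \<pi> * (\<Prod>i\<in>UNIV. c i ^ (a i - 1)) = 1"
    and ns: "\<And>z::'k. z ^ 2 \<noteq> -1" and char: "(1::'k) \<noteq> -1"
  shows "admissible_perm q a \<pi> \<and> (\<forall>i. h_unit i * h_unit i = 1)"
proof -
  have pp: "\<pi> (\<pi> i) = i" for i using inv by (metis comp_apply id_apply)
  have h2: "h_unit i * h_unit i = 1" for i
    using c[of i] c[of "\<pi> i"] h_unit_perm[OF compat, of i] by (simp add: pp mult.commute)
  have ne: "h_unit i \<noteq> -1" if "\<pi> i = i" for i using c[of i] ns[of "c i"] that by (simp add: power2_eq_square)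
  have fixed: "h_unit i = 1" if "\<pi> i = i" for i using h_unit_square_cases[OF h2, of i] ne[OF that] by simp
  have "even (card (J3 q a \<pi>) div 2)" if "\<nexists>i. \<pi> i = i \<and> h_unit i = 1 \<and> even (a i)"
  proof -
    have o: "\<And>i. \<pi> i = i \<Longrightarrow> odd (a i)" using that fixed by blast
    have "(-1) ^ (card (J3 q a \<pi>) div 2) = (1::'k)"
      using sign_relation[OF compat inv h2 fixed o c] rel by simp
    then show ?thesis using char by (metis neg_one_odd_power)
  qed
  then show ?thesis using compat inv ne h2 unfolding admissible_iff by blast
qed

section \<open>The Nakayama automorphism\<close>

text \<open>
  With the convention \<open>\<phi> (x y) = \<phi> (y \<N> x)\<close>, \<open>pairing_compl\<close> shows that the
  Nakayama automorphism divides \<open>x\<^sub>v\<close> by \<open>h\<^sub>v\<close>.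
\<close>
definition "nak = qci_extend q a A (\<lambda>v. inverse (h_exp v) \<cdot> xm v)"

lemma nak_linear: "linear_map A A nak"
  unfolding nak_def by (rule extend_linear[OF A.vspace_axioms]) simp

lemma nak_monom: "v \<in> V \<Longrightarrow> nak (xm v) = inverse (h_exp v) \<cdot> xm v"
  unfolding nak_def by (rule extend_monom[OF A.vspace_axioms]) simp_all

lemma tr_mult_bilinear: "bilinear_map A A scalars (\<lambda>X Y. tr (X \<bullet> Y))"
  by (rule bilinear_map_linear[OF mult_bilinear dual_linear])

lemma id_linear: "linear_map A A (\<lambda>X. X)" by (simp add: linear_map_def)

lemma nak_property: "X \<in> carrier A \<Longrightarrow> Y \<in> carrier A \<Longrightarrow> tr (X \<bullet> Y) = tr (Y \<bullet> nak X)"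
proof (rule bilinear_ext[OF vspace_scalars tr_mult_bilinear
    bilinear_map_swap[OF bilinear_map_comp[OF tr_mult_bilinear id_linear nak_linear]]])
  fix v w assume v: "v \<in> V" and w: "w \<in> V"
  have "tr (xm w \<bullet> nak (xm v)) = inverse (h_exp v) * tr (xm w \<bullet> xm v)"
    by (simp add: nak_monom[OF v] smult_A(2)[OF monom_closed monom_closed] coef_scale)
  also have "\<dots> = tr (xm v \<bullet> xm w)"
  proof (cases "w = compl v")
    case True
    have "(h_exp v) \<noteq> 0" by (simp add: h_unit_nz)
    moreover have "tr (xm w \<bullet> xm v) = tr (xm v \<bullet> xm w) * (h_exp v)"
      unfolding True tr_mult compl_add(1)[OF v] compl_add(2)[OF v] using pairing_compl[OF v] by simp
    ultimately show ?thesis by simp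
  next
    case False
    then show ?thesis unfolding tr_mult add_eq_top(1)[OF v] add_eq_top(2)[OF v] by simp
  qed
  finally show "tr (xm v \<bullet> xm w) = tr (xm w \<bullet> nak (xm v))" ..
qed

text \<open>
  Up to a unit, multiplication with the complementary monomial turns the form \<open>tr\<close> into a
  coordinate. Hence \<open>tr\<close> is nondegenerate on both sides.
\<close>
lemma tr_compl:
  assumes "v \<in> V" "Z \<in> carrier A"
  shows "tr (xm (compl v) \<bullet> Z) = pairing q (compl v) v * coef v Z"
    "tr (Z \<bullet> xm (compl v)) = pairing q v (compl v) * coef v Z"
proof -
  have eq: "(\<lambda>i. compl v i + w i) = tp \<longleftrightarrow> w = v" "(\<lambda>i. w i + compl v i) = tp \<longleftrightarrow> w = v" if "w \<in> V" for w
    using add_eq_top(1)[OF compl_in_V[of v], of w] add_eq_top(2)[OF compl_in_V[of v], of w] compl_compl[OF assms(1)] by auto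
  have L: "linear_map A scalars (\<lambda>Z. r * coef v Z)" for r
    using vspace.linear_map_smult[OF vspace_scalars dual_linear, of r v] by simp
  show "tr (xm (compl v) \<bullet> Z) = pairing q (compl v) v * coef v Z"
    by (rule linear_ext[OF vspace_scalars bilinear_mapD(1)[OF tr_mult_bilinear monom_closed] L _ assms(2)])
      (simp only: tr_mult eq(1) dual_monom split: if_split, simp)
  show "tr (Z \<bullet> xm (compl v)) = pairing q v (compl v) * coef v Z"
    by (rule linear_ext[OF vspace_scalars bilinear_mapD(2)[OF tr_mult_bilinear monom_closed] L _ assms(2)])
      (simp only: tr_mult eq(2) dual_monom split: if_split, simp)
qed

lemma dual_eqI:
  assumes "X \<in> carrier A" "Y \<in> carrier A" "\<And>v. v \<in> V \<Longrightarrow> coef v X = coef v Y"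
  shows "X = Y"
proof -
  have "X = lin_comb (\<lambda>v. coef v X)" by (rule lin_comb_coords[OF assms(1), symmetric])
  also have "\<dots> = lin_comb (\<lambda>v. coef v Y)" by (rule lin_comb_cong[OF assms(3)])
  also have "\<dots> = Y" by (rule lin_comb_coords[OF assms(2)])
  finally show ?thesis .
qed

lemma qci_nakayama_eq: "X \<in> carrier A \<Longrightarrow> qci_nakayama q a X = nak X"
  unfolding qci_nakayama_def nakayama_def
proof (rule the_equality)
  assume X: "X \<in> carrier A"
  show "nak X \<in> carrier A \<and> (\<forall>y\<in>carrier A. tr (X \<bullet> y) = tr (y \<bullet> nak X))"
    using linear_mapD(1)[OF nak_linear X] nak_property[OF X] by blast
  fix Z assume Z: "Z \<in> carrier A \<and> (\<forall>y\<in>carrier A. tr (X \<bullet> y) = tr (y \<bullet> Z))"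
  show "Z = nak X"
  proof (rule dual_eqI)
    fix v assume v: "v \<in> V"
    have "tr (xm (compl v) \<bullet> Z) = tr (X \<bullet> xm (compl v))"
      by (rule bspec[OF conjunct2[OF Z] monom_closed, symmetric])
    also have "\<dots> = tr (xm (compl v) \<bullet> nak X)" by (rule nak_property[OF X monom_closed])
    finally show "coef v Z = coef v (nak X)"
      unfolding tr_compl(1)[OF v conjunct1[OF Z]] tr_compl(1)[OF v linear_mapD(1)[OF nak_linear X]]
        mult_left_cancel[OF pairing_nz] .
  qed (rule conjunct1[OF Z], rule linear_mapD(1)[OF nak_linear X])
qed

lemma nakayama_involutive_iff:
  "(\<forall>X\<in>carrier A. qci_nakayama q a (qci_nakayama q a X) = X) \<longleftrightarrow> (\<forall>i. h_unit i * h_unit i = 1)"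
proof -
  have sq: "nak (nak (xm v)) = inverse ((\<Prod>i\<in>UNIV. (h_unit i * h_unit i) ^ v i)) \<cdot> xm v" if "v \<in> V" for v
    using that by (simp add: nak_monom linear_mapD(3)[OF nak_linear] A.vs_assoc[symmetric]
        power_mult_distrib prod.distrib)
  have "(\<forall>X\<in>carrier A. qci_nakayama q a (qci_nakayama q a X) = X) \<longleftrightarrow> (\<forall>X\<in>carrier A. nak (nak X) = X)"
    using linear_mapD(1)[OF nak_linear] by (simp add: qci_nakayama_eq)
  also have "\<dots> \<longleftrightarrow> (\<forall>i. h_unit i * h_unit i = 1)"
  proof
    assume N: "\<forall>X\<in>carrier A. nak (nak X) = X"
    show "\<forall>i. h_unit i * h_unit i = 1"
    proof
      fix i
      have "inverse (h_unit i * h_unit i) \<cdot> xm (unit_exp i) = xm (unit_exp i)"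
        using N sq[OF unit_in_V[of i]] unfolding prod_power_unit_exp[of "\<lambda>i. h_unit i * h_unit i"] by simp
      from arg_cong[OF this, of "coef (unit_exp i)"]
      have "inverse (h_unit i * h_unit i) = 1"
        unfolding coef_scale[OF monom_closed] by (simp add: dual_monom del: inverse_mult_distrib)
      then show "h_unit i * h_unit i = 1" by (simp only: inverse_eq_1_iff)
    qed
  next
    assume h: "\<forall>i. h_unit i * h_unit i = 1"
    have "nak (nak X) = X" if "X \<in> carrier A" for X
      by (rule linear_ext[OF A.vspace_axioms linear_map_comp[OF nak_linear nak_linear] id_linear _ that])
        (simp add: sq h)
    then show "\<forall>X\<in>carrier A. nak (nak X) = X" by blast
  qed
  finally show ?thesis .
qed

end

section \<open>Monomials under multiplication and anti-homomorphisms\<close>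

context qci_data
begin

sublocale TA: tensor_pair A A by unfold_locales

lemmas TT_vspace = TA.T.vspace_axioms

lemma xm_add_zero: "(\<lambda>i. u i + w i) \<notin> V \<Longrightarrow> xm u \<bullet> xm w = \<zero>\<^sub>A"
  by (simp add: monom_mult monom_zero)

lemma dual_one: "coef (\<lambda>_. 0) \<one>\<^sub>A = 1"
  using dual_monom[OF zero_in_V, of "\<lambda>_. 0"] by (simp add: monom_0)

lemma mult_left_linear: "Y \<in> carrier A \<Longrightarrow> linear_map A A (\<lambda>X. X \<bullet> Y)"
  by (rule bilinear_mapD(2)[OF mult_bilinear])

lemma mult_right_linear: "Y \<in> carrier A \<Longrightarrow> linear_map A A (\<lambda>X. Y \<bullet> X)"
  by (rule bilinear_mapD(1)[OF mult_bilinear])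

lemma add_top_notin: "v \<noteq> (\<lambda>_. 0) \<Longrightarrow> (\<lambda>i. v i + tp i) \<notin> V"
proof
  assume "v \<noteq> (\<lambda>_. 0)" "(\<lambda>i. v i + tp i) \<in> V"
  from V_le[OF this(2)] have "v i = 0" for i by (simp add: top_exp_def)
  with \<open>v \<noteq> (\<lambda>_. 0)\<close> show False by auto
qed

lemma mult_top:
  assumes "X \<in> carrier A"
  shows "X \<bullet> xm tp = coef (\<lambda>_. 0) X \<cdot> xm tp"
    "xm tp \<bullet> X = coef (\<lambda>_. 0) X \<cdot> xm tp"
proof -
  note R = A.linear_map_scalar_smult[OF dual_linear, of "xm tp" "\<lambda>_. 0"]
  show "X \<bullet> xm tp = coef (\<lambda>_. 0) X \<cdot> xm tp"
  proof (rule linear_ext[OF A.vspace_axioms mult_left_linear R _ assms])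
    fix v assume "v \<in> V"
    then show "xm v \<bullet> xm tp = coef (\<lambda>_. 0) (xm v) \<cdot> xm tp"
      using xm_add_zero[OF add_top_notin, of v] by (cases "v = (\<lambda>_. 0)") (simp_all add: dual_monom monom_0 dual_one)
  qed simp_all
  show "xm tp \<bullet> X = coef (\<lambda>_. 0) X \<cdot> xm tp"
  proof (rule linear_ext[OF A.vspace_axioms mult_right_linear R _ assms])
    fix v assume "v \<in> V"
    then show "xm tp \<bullet> xm v = coef (\<lambda>_. 0) (xm v) \<cdot> xm tp"
      using xm_add_zero[of tp v] add_top_notin[of v]
      by (cases "v = (\<lambda>_. 0)") (simp_all add: dual_monom monom_0 dual_one add.commute)
  qed simp_all
qed

lemma smult_cancel:
  assumes "r \<cdot> X = s \<cdot> X" "X \<in> carrier A" "X \<noteq> \<zero>\<^sub>A"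
  shows "r = s"
proof (rule ccontr)
  assume ne: "r \<noteq> s"
  have "(r - s) \<cdot> X \<oplus>\<^sub>A s \<cdot> X = \<zero>\<^sub>A \<oplus>\<^sub>A s \<cdot> X"
    using assms by (simp add: A.vs_distr_l[symmetric])
  then have "(r - s) \<cdot> X = \<zero>\<^sub>A" using assms by (subst (asm) A.add.right_cancel) auto
  then have "inverse (r - s) \<cdot> ((r - s) \<cdot> X) = \<zero>\<^sub>A" by simp
  then show False using assms ne by (simp add: A.vs_assoc[symmetric])
qed

lemma smult_cancel_l:
  assumes "r \<cdot> X = r \<cdot> Y" "X \<in> carrier A" "Y \<in> carrier A" "r \<noteq> 0"
  shows "X = Y"
proof -
  have "Z = inverse r \<cdot> (r \<cdot> Z)" if "Z \<in> carrier A" for Z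
    using that assms(4) by (simp add: A.vs_assoc[symmetric])
  from this[OF assms(2)] this[OF assms(3)] assms(1) show ?thesis by simp
qed

text \<open>
  The socle is one-dimensional: if \<open>v\<close> has least total degree among the exponents that occur in
  \<open>Y\<close>, then multiplication with \<open>x\<^bsub>a-1-v\<^esub>\<close> kills all other terms of \<open>Y\<close>.
\<close>
lemma exists_monom_into_socle:
  assumes "Y \<in> carrier A" "Y \<noteq> \<zero>\<^sub>A"
  shows "\<exists>v\<in>V. \<exists>r. r \<noteq> 0 \<and> Y \<bullet> xm (compl v) = r \<cdot> xm tp"
proof -
  define d where "d v = coef v Y" for v
  have Y: "Y = lin_comb d" using lin_comb_coords[OF assms(1)] unfolding d_def ..
  have "\<exists>v. v \<in> V \<and> d v \<noteq> 0"
  proof (rule ccontr)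
    assume "\<nexists>v. v \<in> V \<and> d v \<noteq> 0"
    then have "Y = \<zero>\<^sub>A" unfolding Y lin_comb_def by (intro A.add.finprod_one_eqI) auto
    with assms show False by simp
  qed
  then obtain v where v: "v \<in> V" "d v \<noteq> 0"
    and min: "\<And>u. u \<in> V \<Longrightarrow> d u \<noteq> 0 \<Longrightarrow> sum v UNIV \<le> sum u UNIV"
    using ex_has_least_nat[of "\<lambda>v. v \<in> V \<and> d v \<noteq> 0" _ "\<lambda>v. sum v UNIV"] by metis
  have "Y \<bullet> xm (compl v) = (\<Oplus>\<^bsub>A\<^esub>u\<in>V. d u \<cdot> (xm u \<bullet> xm (compl v)))"
    unfolding Y by (rule linear_map_lin_comb[OF A.vspace_axioms mult_left_linear]) simp
  also have "\<dots> = (d v * pairing q v (compl v)) \<cdot> xm tp"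
  proof (rule A.finsum_delta[OF finite_V v(1)])
    fix u assume u: "u \<in> V"
    show "d u \<cdot> (xm u \<bullet> xm (compl v)) =
      (if u = v then (d v * pairing q v (compl v)) \<cdot> xm tp else \<zero>\<^sub>A)"
    proof (cases "u = v")
      case True
      then show ?thesis using compl_add(2)[OF v(1)] by (simp add: monom_mult A.vs_assoc)
    next
      case False
      have "d u = 0 \<or> (\<lambda>i. u i + compl v i) \<notin> V"
      proof (rule ccontr)
        assume "\<not> (d u = 0 \<or> (\<lambda>i. u i + compl v i) \<notin> V)"
        then have du: "d u \<noteq> 0" and s: "(\<lambda>i. u i + compl v i) \<in> V" by auto
        have le: "u i \<le> v i" for i using V_le[OF s, of i] V_le[OF v(1), of i] by simp
        have "\<exists>i. u i \<noteq> v i" using False by auto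
        then obtain i where "u i < v i" using le le_neq_implies_less by blast
        then have "sum u UNIV < sum v UNIV" using le by (intro sum_strict_mono_ex1) auto
        then show False using min[OF u du] by simp
      qed
      then show ?thesis
      proof
        assume "(\<lambda>i. u i + compl v i) \<notin> V"
        then show ?thesis unfolding xm_add_zero[OF \<open>(\<lambda>i. u i + compl v i) \<notin> V\<close>] using False by simp
      qed (use False in simp)
    qed
  qed simp
  finally show ?thesis using v pairing_nz by (intro bexI[OF _ v(1)] exI[of _ "d v * pairing q v (compl v)"]) simp
qed

lemma perm_vec_add: "perm_vec \<pi> (\<lambda>i. u i + w i) = (\<lambda>i. perm_vec \<pi> u i + perm_vec \<pi> w i)"
  by (simp add: perm_vec_def)

lemma perm_vec_unit_exp: "\<pi> permutes UNIV \<Longrightarrow> perm_vec \<pi> (unit_exp i) = unit_exp (\<pi> i)"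
  by (auto simp: perm_vec_def unit_exp_def fun_eq_iff permutes_inverses permutes_inv_eq)

lemma perm_vec_zero: "perm_vec \<pi> (\<lambda>_. 0) = (\<lambda>_. 0)"
  by (simp add: perm_vec_def)

lemma split_unit:
  fixes v :: "'n \<Rightarrow> nat"
  assumes "v \<noteq> (\<lambda>_. 0)"
  obtains i u where "v = (\<lambda>j. u j + unit_exp i j)" "\<forall>j. u j \<le> v j" "sum u UNIV < sum v UNIV"
proof -
  obtain i where i: "v i > 0" using assms by (auto simp: fun_eq_iff)
  define u where "u = (\<lambda>j. v j - unit_exp i j)"
  have "v = (\<lambda>j. u j + unit_exp i j)" using i by (auto simp: u_def unit_exp_def)
  moreover have le: "\<forall>j. u j \<le> v j" by (simp add: u_def)
  moreover have "sum u UNIV < sum v UNIV"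
    using le i by (intro sum_strict_mono_ex1) (auto simp: u_def unit_exp_def intro!: exI[of _ i])
  ultimately show ?thesis using that by blast
qed

text \<open>
  An anti-homomorphism that permutes the generators up to scalars is determined on all monomials;
  the cocycle identity \<open>antipode_coeff_mult\<close> drives the induction on the degree.
\<close>
lemma antihom_monom:
  assumes lin: "linear_map A A S" and one: "S \<one>\<^sub>A = \<one>\<^sub>A"
    and anti: "\<And>X Y. X \<in> carrier A \<Longrightarrow> Y \<in> carrier A \<Longrightarrow> S (X \<bullet> Y) = S Y \<bullet> S X"
    and gen: "\<And>i. S (xm (unit_exp i)) = \<gamma> i \<cdot> xm (unit_exp (\<pi> i))"
    and compat: "compatible_perm q a \<pi>"
  shows "S (xm v) = antipode_coeff q \<pi> \<gamma> v \<cdot> xm (perm_vec \<pi> v)"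
proof (induction "sum v UNIV" arbitrary: v rule: less_induct)
  case less
  note D = compatD[OF compat]
  note L = linear_mapD[OF lin]
  show ?case
  proof (cases "v = (\<lambda>_. 0)")
    case True
    then show ?thesis by (simp add: antipode_coeff_zero perm_vec_zero monom_0 one)
  next
    case False
    then obtain i u where v: "v = (\<lambda>j. u j + unit_exp i j)" and "sum u UNIV < sum v UNIV" by (rule split_unit)
    then have IH: "S (xm u) = antipode_coeff q \<pi> \<gamma> u \<cdot> xm (perm_vec \<pi> u)" using less by simp
    have m: "xm u \<bullet> xm (unit_exp i) = pairing q u (unit_exp i) \<cdot> xm v"
      unfolding v by (rule monom_mult)
    have pv: "(\<lambda>j. unit_exp (\<pi> i) j + perm_vec \<pi> u j) = perm_vec \<pi> v"
      unfolding v perm_vec_add perm_vec_unit_exp[OF D(1)] by (simp add: add.commute)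
    have "pairing q u (unit_exp i) \<cdot> S (xm v) = S (xm u \<bullet> xm (unit_exp i))"
      unfolding m by (simp add: L)
    also have "\<dots> = (antipode_coeff q \<pi> \<gamma> u * (\<gamma> i * pairing q (unit_exp (\<pi> i)) (perm_vec \<pi> u))) \<cdot> xm (perm_vec \<pi> v)"
      unfolding anti[OF monom_closed monom_closed] gen IH by (simp add: smult_A monom_mult pv A.vs_assoc)
    also have "antipode_coeff q \<pi> \<gamma> u * (\<gamma> i * pairing q (unit_exp (\<pi> i)) (perm_vec \<pi> u)) =
        pairing q u (unit_exp i) * antipode_coeff q \<pi> \<gamma> v"
      using antipode_coeff_mult[OF compat, of u "unit_exp i" \<gamma>]
      by (simp add: v antipode_coeff_unit perm_vec_unit_exp[OF D(1)] mult_ac)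
    finally show ?thesis
      by - (rule smult_cancel_l[of "pairing q u (unit_exp i)"], simp_all add: A.vs_assoc L pairing_nz)
  qed
qed

lemma word_replicate: "word (replicate n i) = xm (\<lambda>j. if j = i then n else 0)"
proof -
  have "count (mset (replicate n i)) = (\<lambda>j. if j = i then n else 0)" by auto
  then show ?thesis
    using word_monom[of "replicate n i"] straighten_sorted[of "replicate n i" q] by (simp add: sorted_replicate)
qed

lemma exp_unit_in_V: "(\<lambda>j. if j = i then n else 0) \<in> V \<longleftrightarrow> n < a i"
  using a_ge[of i] by (auto simp: exponents_def)

end

section \<open>Bi-Frobenius structures with permutation antipode\<close>

locale bifrob_perm = qci_data q a
  for q :: "'n::{finite,linorder} \<Rightarrow> 'n \<Rightarrow> 'k::field" and a +
  fixes \<Delta> \<epsilon> \<phi> t S p c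
  assumes bf: "bi_frobenius_algebra (qci q a) \<Delta> \<epsilon> \<phi> t S"
    and p_perm: "p permutes exponents a"
    and S_xm: "\<And>v. v \<in> exponents a \<Longrightarrow> S (qci_monom q a v) = c v \<odot>\<^bsub>qci q a\<^esub> qci_monom q a (p v)"
begin

lemma t_closed: "t \<in> carrier A" and phi: "linear_map A scalars \<phi>"
  and S_def: "X \<in> carrier A \<Longrightarrow> S X = sweedler A (\<Delta> t) (\<lambda>t1 t2. \<phi> (t1 \<bullet> X) \<cdot> t2)"
  and eps_one: "\<epsilon> \<one>\<^sub>A = 1"
  and eps_mult: "X \<in> carrier A \<Longrightarrow> Y \<in> carrier A \<Longrightarrow> \<epsilon> (X \<bullet> Y) = \<epsilon> X * \<epsilon> Y"
  and frob: "f \<in> dual_space A \<Longrightarrow> \<exists>b\<in>carrier A. \<forall>X\<in>carrier A. f X = \<phi> (b \<bullet> X)"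
  and S_one: "S \<one>\<^sub>A = \<one>\<^sub>A"
  and S_anti: "X \<in> carrier A \<Longrightarrow> Y \<in> carrier A \<Longrightarrow> S (X \<bullet> Y) = S Y \<bullet> S X"
  and eps_S: "X \<in> carrier A \<Longrightarrow> \<epsilon> (S X) = \<epsilon> X"
  and Delta_S: "X \<in> carrier A \<Longrightarrow> \<Delta> (S X) = sweedler (tensor A A) (\<Delta> X) (\<lambda>x1 x2. pure_tensor A A (S x2) (S x1))"
  and Delta: "linear_map A (tensor A A) \<Delta>" and eps: "linear_map A scalars \<epsilon>"
  and counit_l: "X \<in> carrier A \<Longrightarrow> sweedler A (\<Delta> X) (\<lambda>y z. \<epsilon> y \<cdot> z) = X"
  and counit_r: "X \<in> carrier A \<Longrightarrow> sweedler A (\<Delta> X) (\<lambda>y z. \<epsilon> z \<cdot> y) = X"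
  using bf unfolding bi_frobenius_algebra_def coalgebra_def frobenius_algebra_def dual_space_def by auto

lemma Delta_t_closed: "\<Delta> t \<in> carrier (tensor A A)" by (rule linear_mapD(1)[OF Delta t_closed])

lemma phi_mult_linear:
  "X \<in> carrier A \<Longrightarrow> linear_map A scalars (\<lambda>u. \<phi> (u \<bullet> X))"
  by (rule linear_map_comp[OF mult_left_linear phi])

lemma S_bilinear: "X \<in> carrier A \<Longrightarrow> bilinear_map A A A (\<lambda>t1 t2. \<phi> (t1 \<bullet> X) \<cdot> t2)"
  by (rule A.bilinear_map_scalars[OF phi_mult_linear])

lemma S_linear: "linear_map A A S"
proof -
  have "linear_map A A (\<lambda>X. sweedler A (\<Delta> t) (\<lambda>t1 t2. \<phi> (t1 \<bullet> X) \<cdot> t2))"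
    by (rule TA.sweedler_linear_param[OF Delta_t_closed A.vspace_axioms A.vspace_axioms S_bilinear])
      (auto intro!: A.linear_map_scalar_smult linear_map_comp[OF mult_right_linear phi])
  then show ?thesis by (simp add: linear_map_def S_def)
qed

lemma linear_S:
  fixes P :: "('k, 'c) module"
  assumes "linear_map A P L" "vspace P" "X \<in> carrier A"
  shows "L (S X) = sweedler P (\<Delta> t) (\<lambda>t1 t2. \<phi> (t1 \<bullet> X) \<odot>\<^bsub>P\<^esub> L t2)"
proof -
  interpret P: vspace P by fact
  have "L (S X) = sweedler P (\<Delta> t) (\<lambda>t1 t2. L (\<phi> (t1 \<bullet> X) \<cdot> t2))"
    unfolding S_def[OF assms(3)]
    by (rule TA.linear_map_sweedler[OF Delta_t_closed A.vspace_axioms assms(2) S_bilinear[OF assms(3)] assms(1)])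
  also have "\<dots> = sweedler P (\<Delta> t) (\<lambda>t1 t2. \<phi> (t1 \<bullet> X) \<odot>\<^bsub>P\<^esub> L t2)"
    by (rule TA.sweedler_cong[OF Delta_t_closed assms(2) bilinear_map_linear[OF S_bilinear[OF assms(3)] assms(1)]
        bilinear_map_comp[OF P.bilinear_map_scalars[OF phi_mult_linear[OF assms(3)]] _ assms(1), of A "\<lambda>x. x"]])
      (auto simp: linear_mapD(3)[OF assms(1)] linear_map_def)
  finally show ?thesis .
qed

text \<open>
  Both sides equal \<open>\<Sum> \<phi> (t\<^sub>1 z) \<epsilon> (t\<^sub>2)\<close>: the left one by the counit law for \<open>t\<close>, the
  right one as \<open>\<epsilon> (S z)\<close>.
\<close>
lemma phi_t: "z \<in> carrier A \<Longrightarrow> \<phi> (t \<bullet> z) = \<epsilon> z"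
proof -
  assume z: "z \<in> carrier A"
  note L = phi_mult_linear[OF z]
  have b: "bilinear_map A A A (\<lambda>y w. \<epsilon> w \<cdot> y)"
    by (rule bilinear_map_swap[OF A.bilinear_map_scalars[OF eps]])
  have b': "bilinear_map A A scalars (\<lambda>t1 t2. \<phi> (t1 \<bullet> z) \<odot>\<^bsub>scalars\<^esub> \<epsilon> t2)"
    by (rule bilinear_map_comp[OF vspace.bilinear_map_scalars[OF vspace_scalars L] _ eps, of A "\<lambda>x. x"])
      (simp add: linear_map_def)
  have "\<phi> (t \<bullet> z) = sweedler scalars (\<Delta> t) (\<lambda>y w. \<phi> ((\<epsilon> w \<cdot> y) \<bullet> z))"
    using TA.linear_map_sweedler[OF Delta_t_closed A.vspace_axioms vspace_scalars b L] unfolding counit_r[OF t_closed] .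
  also have "\<dots> = sweedler scalars (\<Delta> t) (\<lambda>t1 t2. \<phi> (t1 \<bullet> z) \<odot>\<^bsub>scalars\<^esub> \<epsilon> t2)"
    by (rule TA.sweedler_cong[OF Delta_t_closed vspace_scalars bilinear_map_linear[OF b L] b'])
      (use linear_mapD(3)[OF L] in auto)
  also have "\<dots> = \<epsilon> (S z)" by (rule linear_S[OF eps vspace_scalars z, symmetric])
  finally show ?thesis by (simp add: eps_S z)
qed

text \<open>
  The generators are nilpotent and \<open>\<epsilon>\<close> is multiplicative.
\<close>
lemma eps_word: "w \<noteq> [] \<Longrightarrow> \<epsilon> (word w) = 0"
proof -
  have e: "\<epsilon> (word (replicate n i)) = \<epsilon> (word [i]) ^ n" for n i
  proof (induction n)
    case (Suc n)
    have "word (replicate (Suc n) i) = word [i] \<bullet> word (replicate n i)"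
      using word_append[of "[i]" "replicate n i"] by simp
    then show ?case by (simp add: eps_mult Suc)
  qed (simp add: word_Nil eps_one)
  have g: "\<epsilon> (word [i]) = 0" for i
    using e[of "a i" i] linear_map_zero[OF A.vspace_axioms vspace_scalars eps] a_ge[of i]
    by (simp add: word_power_zero)
  assume "w \<noteq> []"
  then obtain i u where "w = i # u" by (cases w) auto
  then have "word w = word [i] \<bullet> word u" using word_append[of "[i]" u] by simp
  then show ?thesis by (simp add: eps_mult g)
qed

lemma eps_eq: "X \<in> carrier A \<Longrightarrow> \<epsilon> X = coef (\<lambda>_. 0) X"
proof (rule linear_ext[OF vspace_scalars eps dual_linear])
  fix v assume v: "v \<in> V"
  show "\<epsilon> (xm v) = coef (\<lambda>_. 0) (xm v)"
  proof (cases "v = (\<lambda>_. 0)")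
    case True then show ?thesis by (simp add: monom_0 eps_one dual_one)
  next
    case False
    then have "std_word v \<noteq> []" using count_std_word[of v] count_mset_Nil by metis
    then have "\<epsilon> (xm v) = 0" unfolding monom_eq_word by (rule eps_word)
    then show ?thesis using v False by (simp add: dual_monom)
  qed
qed

text \<open>
  By the Frobenius property the coordinate of the top monomial has the form \<open>\<lambda>x. \<phi> (b x)\<close>, and
  \<open>b x\<^bsub>a-1\<^esub>\<close> is a multiple of \<open>x\<^bsub>a-1\<^esub>\<close>.
\<close>
lemma phi_top: "\<phi> (xm tp) \<noteq> 0"
proof
  assume z: "\<phi> (xm tp) = 0"
  obtain b where "b \<in> carrier A" "\<forall>X\<in>carrier A. tr X = \<phi> (b \<bullet> X)"
    using frob[of tr] dual_linear by (auto simp: dual_space_def)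
  then have "tr (xm tp) = \<phi> (coef (\<lambda>_. 0) b \<cdot> xm tp)" by (simp add: mult_top)
  then show False using z by (simp add: dual_monom linear_mapD[OF phi])
qed

definition "t_coeff = inverse (\<phi> (xm tp))"

text \<open>
  The multiple of the top monomial on the right satisfies \<open>phi_t\<close> as well. A nonzero difference
  could be multiplied into the socle, where \<open>\<phi>\<close> does not vanish.
\<close>
lemma t_eq: "t = t_coeff \<cdot> xm tp"
proof -
  define Y where "Y = t \<oplus>\<^sub>A (- t_coeff) \<cdot> xm tp"
  have Yc: "Y \<in> carrier A" using t_closed by (simp add: Y_def)
  have z: "\<phi> (Y \<bullet> z) = 0" if "z \<in> carrier A" for z
    using that t_closed phi_top
    by (simp add: Y_def A.l_distr smult_A mult_top linear_mapD[OF phi] phi_t eps_eq t_coeff_def)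
  have "Y = \<zero>\<^sub>A"
  proof (rule ccontr)
    assume "Y \<noteq> \<zero>\<^sub>A"
    then obtain v r where r: "r \<noteq> 0" "Y \<bullet> xm (compl v) = r \<cdot> xm tp"
      using exists_monom_into_socle[OF Yc] by blast
    then have "r * \<phi> (xm tp) = 0" using z[of "xm (compl v)"] by (simp add: linear_mapD[OF phi])
    then show False using r phi_top by simp
  qed
  then have "t \<oplus>\<^sub>A ((- t_coeff) \<cdot> xm tp \<oplus>\<^sub>A t_coeff \<cdot> xm tp) = t_coeff \<cdot> xm tp"
    using t_closed by (simp add: Y_def A.a_assoc[symmetric])
  then show ?thesis using t_closed by (simp add: A.vs_distr_l[symmetric])
qed

lemma S_t: "S t = t"
proof -
  have "S t = sweedler A (\<Delta> t) (\<lambda>y z. \<epsilon> y \<cdot> z)"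
    unfolding S_def[OF t_closed]
  proof (rule TA.sweedler_cong[OF Delta_t_closed A.vspace_axioms S_bilinear[OF t_closed] A.bilinear_map_scalars[OF eps]])
    fix x y assume x: "x \<in> carrier A" "y \<in> carrier A"
    have "\<phi> (x \<bullet> t) = \<epsilon> x"
      using x phi_top by (simp add: t_eq smult_A mult_top linear_mapD[OF phi] eps_eq t_coeff_def)
    then show "\<phi> (x \<bullet> t) \<cdot> y = \<epsilon> x \<cdot> y" by simp
  qed
  then show ?thesis by (simp add: counit_l t_closed)
qed

lemma S_top: "S (xm tp) = xm tp"
  using S_t phi_top unfolding t_eq
  by - (rule smult_cancel_l[of t_coeff], simp_all add: linear_mapD[OF S_linear] t_coeff_def)

lemma p_V: "v \<in> V \<Longrightarrow> p v \<in> V" using permutes_in_image[OF p_perm] by simp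

text \<open>
  The factorization \<open>x\<^sub>v x\<^bsub>a-1-v\<^esub>\<close> of the top monomial is mapped to a nonzero element.
\<close>
lemma c_nz: "v \<in> V \<Longrightarrow> c v \<noteq> 0"
proof
  assume v: "v \<in> V" and z: "c v = 0"
  have "pairing q v (compl v) \<cdot> xm tp = S (xm v \<bullet> xm (compl v))"
    using compl_add(2)[OF v] by (simp add: monom_mult linear_mapD[OF S_linear] S_top)
  also have "\<dots> = \<zero>\<^sub>A" using v z linear_mapD(1)[OF S_linear, of "xm (compl v)"] by (simp add: S_anti S_xm)
  finally have "pairing q v (compl v) \<cdot> xm tp = 0 \<cdot> xm tp" by simp
  then show False using smult_cancel[of "pairing q v (compl v)" "xm tp" 0] by (simp add: xm_nonzero pairing_nz)
qed

lemma p_zero: "p (\<lambda>_. 0) = (\<lambda>_. 0)"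
proof (rule ccontr)
  assume n: "p (\<lambda>_. 0) \<noteq> (\<lambda>_. 0)"
  have "c (\<lambda>_. 0) \<cdot> xm (p (\<lambda>_. 0)) = xm (\<lambda>_. 0)"
    using S_xm[OF zero_in_V] S_one by (simp add: monom_0)
  then have "coef (\<lambda>_. 0) (c (\<lambda>_. 0) \<cdot> xm (p (\<lambda>_. 0))) = 1"
    by (metis dual_monom zero_in_V)
  then show False using n p_V[OF zero_in_V] by (simp add: coef_scale dual_monom)
qed

lemma p_inj: "p u = p v \<Longrightarrow> u = v" using permutes_inj[OF p_perm] by (simp add: inj_eq)

lemma unit_nonzero: "unit_exp i \<noteq> (\<lambda>_. 0)" by (auto simp: unit_exp_def fun_eq_iff)

text \<open>
  The monomial mapped to a generator \<open>x\<^sub>j\<close> is itself a generator: otherwise it is a product of two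
  nontrivial monomials, and so is its image, which then has degree at least 2.
\<close>
lemma p_unit_surj: "\<exists>i. p (unit_exp i) = unit_exp j"
proof -
  obtain v where v: "p v = unit_exp j" using permutes_surj[OF p_perm] by (metis surjD)
  have vV: "v \<in> V" using v permutes_in_image[OF p_perm, of v] by simp
  have "v \<noteq> (\<lambda>_. 0)" using v p_zero unit_nonzero by metis
  then obtain i u where u: "v = (\<lambda>k. u k + unit_exp i k)" "\<forall>j. u j \<le> v j" "sum u UNIV < sum v UNIV"
    by (rule split_unit)
  have uV: "u \<in> V"
    unfolding exponents_def mem_Collect_eq by (intro allI order.trans[OF spec[OF u(2)] V_le[OF vV]])
  show ?thesis
  proof (cases "u = (\<lambda>_. 0)")
    case True
    then have "v = unit_exp i" using u(1) by simp
    then show ?thesis using v by auto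
  next
    case False
    let ?s = "\<lambda>k. p (unit_exp i) k + p u k"
    have "(pairing q u (unit_exp i) * c v) \<cdot> xm (unit_exp j) = S (xm u \<bullet> xm (unit_exp i))"
      unfolding monom_mult u(1)[symmetric] by (simp add: linear_mapD[OF S_linear] S_xm[OF vV] v A.vs_assoc)
    also have "\<dots> = (c u * (c (unit_exp i) * pairing q (p (unit_exp i)) (p u))) \<cdot> xm ?s"
      unfolding S_anti[OF monom_closed monom_closed] S_xm[OF uV] S_xm[OF unit_in_V]
      by (simp add: smult_A monom_mult A.vs_assoc)
    finally have e: "(pairing q u (unit_exp i) * c v) \<cdot> xm (unit_exp j) =
      (c u * (c (unit_exp i) * pairing q (p (unit_exp i)) (p u))) \<cdot> xm ?s" .
    have "?s = unit_exp j"
    proof (rule ccontr)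
      assume ne: "?s \<noteq> unit_exp j"
      have "coef (unit_exp j) (xm ?s) = 0"
        using ne coef_zero
        by (cases "?s \<in> V") (simp_all add: dual_monom monom_zero)
      then have "coef (unit_exp j) ((pairing q u (unit_exp i) * c v) \<cdot> xm (unit_exp j)) = 0"
        unfolding e by (simp add: coef_scale)
      then show False using c_nz[OF vV] pairing_nz by (simp add: coef_scale dual_monom)
    qed
    then have s: "p (unit_exp i) k + p u k = unit_exp j k" for k by (metis)
    have "p (unit_exp i) \<noteq> (\<lambda>_. 0)" "p u \<noteq> (\<lambda>_. 0)"
      using p_inj p_zero unit_nonzero False by metis+
    then obtain k l where "p (unit_exp i) k > 0" "p u l > 0" by (auto simp: fun_eq_iff)
    then have "k = j" "l = j" using s[of k] s[of l] by (auto simp: unit_exp_def split: if_splits)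
    then show ?thesis using s[of j] \<open>p (unit_exp i) k > 0\<close> \<open>p u l > 0\<close> by (simp add: unit_exp_def)
  qed
qed

lemma unit_exp_inj: "unit_exp i = unit_exp j \<Longrightarrow> i = j"
  by (metis unit_exp_def zero_neq_one)

lemma ex_pi: "\<exists>\<pi>. \<pi> permutes UNIV \<and> (\<forall>i. p (unit_exp i) = unit_exp (\<pi> i))"
proof -
  obtain \<sigma> where s: "\<And>j. p (unit_exp (\<sigma> j)) = unit_exp j" using p_unit_surj by metis
  have "inj \<sigma>" by (rule injI) (metis s unit_exp_inj)
  then have b: "bij \<sigma>" by (simp add: bij_def finite_UNIV_inj_surj)
  define \<pi> where "\<pi> = inv_into UNIV \<sigma>"
  have "p (unit_exp i) = unit_exp (\<pi> i)" for i
    using s[of "\<pi> i"] b by (simp add: \<pi>_def bij_is_surj surj_f_inv_f)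
  moreover have "\<pi> permutes UNIV" unfolding \<pi>_def
    by (rule bij_imp_permutes[OF bij_betw_inv_into[OF b]]) simp
  ultimately show ?thesis by blast
qed

definition "\<pi> = (SOME \<pi>. \<pi> permutes UNIV \<and> (\<forall>i. p (unit_exp i) = unit_exp (\<pi> i)))"
definition "\<gamma> i = c (unit_exp i)"

lemma pi_props: "\<pi> permutes UNIV" "p (unit_exp i) = unit_exp (\<pi> i)"
proof -
  have "\<pi> permutes UNIV \<and> (\<forall>i. p (unit_exp i) = unit_exp (\<pi> i))"
    unfolding \<pi>_def by (rule someI_ex[OF ex_pi])
  then show "\<pi> permutes UNIV" "p (unit_exp i) = unit_exp (\<pi> i)" by simp_all
qed

lemma S_unit: "S (xm (unit_exp i)) = \<gamma> i \<cdot> xm (unit_exp (\<pi> i))"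
  by (simp add: S_xm pi_props \<gamma>_def)

lemma gamma_nz: "\<gamma> i \<noteq> 0" by (simp add: \<gamma>_def c_nz)

lemma S_replicate: "S (word (replicate n i)) = \<gamma> i ^ n \<cdot> word (replicate n (\<pi> i))"
proof (induction n)
  case (Suc n)
  have w: "word (replicate (Suc n) i) = word [i] \<bullet> word (replicate n i)" for i
    using word_append[of "[i]" "replicate n i"] by simp
  have w': "word (replicate (Suc n) i) = word (replicate n i) \<bullet> word [i]" for i
    using word_append[of "replicate n i" "[i]"] by (simp add: replicate_append_same)
  show ?case
    unfolding w[of i] w'[of "\<pi> i"] using S_unit[of i] by (simp add: S_anti Suc smult_A monom_unit A.vs_assoc mult.commute)
qed (simp add: word_Nil S_one)

text \<open>
  The exponent \<open>a i\<close> is the nilpotency index of \<open>x\<^sub>i\<close>, which \<open>S\<close> preserves.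
\<close>
lemma a_pi: "a (\<pi> i) = a i"
proof (rule antisym)
  have z: "S \<zero>\<^sub>A = \<zero>\<^sub>A" by (rule linear_map_zero[OF A.vspace_axioms A.vspace_axioms S_linear])
  have nz: "word (replicate n i) \<noteq> \<zero>\<^sub>A" if "n < a i" for n i
    using that xm_nonzero exp_unit_in_V by (simp add: word_replicate)
  have zz: "r \<cdot> X \<noteq> \<zero>\<^sub>A" if "r \<noteq> 0" "X \<noteq> \<zero>\<^sub>A" "X \<in> carrier A" for r X
    using smult_cancel_l[of r X "\<zero>\<^sub>A"] that by auto
  show "a (\<pi> i) \<le> a i"
  proof (rule ccontr)
    assume "\<not> a (\<pi> i) \<le> a i"
    then have "word (replicate (a i) (\<pi> i)) \<noteq> \<zero>\<^sub>A" using nz by simp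
    then have "S (word (replicate (a i) i)) \<noteq> \<zero>\<^sub>A" unfolding S_replicate by (intro zz) (simp_all add: gamma_nz)
    then show False by (simp add: word_power_zero z)
  qed
  show "a i \<le> a (\<pi> i)"
  proof (rule ccontr)
    assume "\<not> a i \<le> a (\<pi> i)"
    then have v: "(\<lambda>j. if j = i then a (\<pi> i) else 0) \<in> V" (is "?v \<in> V") using exp_unit_in_V by simp
    have "S (xm ?v) \<noteq> \<zero>\<^sub>A" unfolding S_xm[OF v] using v by (intro zz) (simp_all add: c_nz xm_nonzero p_V)
    moreover have "S (xm ?v) = \<zero>\<^sub>A"
      using S_replicate[of "a (\<pi> i)" i] by (simp add: word_replicate[symmetric] word_power_zero)
    ultimately show False by simp
  qed
qed

text \<open>
  Applying \<open>S\<close> to the commutation relation of \<open>x\<^sub>i\<close> and \<open>x\<^sub>j\<close> reverses the products.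
\<close>
lemma q_pi: "q (\<pi> i) (\<pi> j) = q j i"
proof (cases "i = j")
  case False
  then have ne: "\<pi> i \<noteq> \<pi> j" using permutes_inj[OF pi_props(1)] by (metis injD)
  have w: "word [k, l] = xm (unit_exp k) \<bullet> xm (unit_exp l)" for k l
    using word_append[of "[k]" "[l]"] by (simp add: monom_unit)
  have S: "S (word [k, l]) = (\<gamma> k * \<gamma> l) \<cdot> word [\<pi> l, \<pi> k]" for k l
    by (simp add: w S_anti S_unit smult_A A.vs_assoc)
  have "(\<gamma> i * \<gamma> j) \<cdot> (q (\<pi> i) (\<pi> j) \<cdot> word [\<pi> i, \<pi> j]) = S (word [i, j])"
    unfolding S by (simp add: word_swap[of "\<pi> j" "\<pi> i"])
  also have "\<dots> = (\<gamma> i * \<gamma> j) \<cdot> (q j i \<cdot> word [\<pi> i, \<pi> j])"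
    unfolding word_swap[of i j] linear_mapD(3)[OF S_linear word_closed] S
    by (simp add: A.vs_assoc[symmetric] mult_ac)
  finally have "q (\<pi> i) (\<pi> j) \<cdot> word [\<pi> i, \<pi> j] = q j i \<cdot> word [\<pi> i, \<pi> j]"
    by (rule smult_cancel_l) (simp_all add: gamma_nz)
  moreover have "word [\<pi> i, \<pi> j] \<noteq> \<zero>\<^sub>A"
  proof -
    have "1 \<le> a k - 1" for k using a_ge[of k] by simp
    then have "(\<lambda>k. unit_exp (\<pi> i) k + unit_exp (\<pi> j) k) \<in> V" using ne by (auto simp: exponents_def unit_exp_def)
    then show ?thesis unfolding w monom_mult
      using smult_cancel_l[of _ _ "\<zero>\<^sub>A"] xm_nonzero pairing_nz by fastforce
  qed
  ultimately show ?thesis using smult_cancel word_closed by blast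
qed (simp add: q_diag)

lemma compat: "compatible_perm q a \<pi>"
  by (simp add: compatible_perm_def pi_props a_pi q_pi)

text \<open>
  The inverse of \<open>S\<close>.
\<close>
definition "R = qci_extend q a A (\<lambda>w. inverse (c (inv_into UNIV p w)) \<cdot> xm (inv_into UNIV p w))"

lemma R_linear: "linear_map A A R"
  unfolding R_def by (rule extend_linear[OF A.vspace_axioms]) simp

lemma R_S: "X \<in> carrier A \<Longrightarrow> R (S X) = X"
proof (rule linear_ext[OF A.vspace_axioms linear_map_comp[OF S_linear R_linear]])
  show "linear_map A A (\<lambda>X. X)" by (simp add: linear_map_def)
  fix v assume v: "v \<in> V"
  have "R (xm (p v)) = inverse (c v) \<cdot> xm v"
    unfolding R_def using extend_monom[OF A.vspace_axioms _ p_V[OF v]] by (simp add: permutes_inverses[OF p_perm])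
  then show "R (S (xm v)) = xm v"
    using v by (simp add: S_xm linear_mapD[OF R_linear] A.vs_assoc[symmetric] c_nz)
qed

text \<open>
  The left side is \<open>\<Sum> \<phi> (t\<^sub>1 X) \<phi> (S t\<^sub>2 b)\<close>. Replacing \<open>t\<^sub>1 \<otimes> t\<^sub>2\<close> by
  \<open>S t\<^sub>2 \<otimes> S t\<^sub>1\<close>, which is the same tensor because \<open>S t = t\<close>, turns the sum
  \<open>\<Sum> \<phi> (t\<^sub>1 b) \<phi> (S\<^sup>-\<^sup>1 t\<^sub>2 X) = \<phi> (S\<^sup>-\<^sup>1 (S b) X)\<close> into it.
\<close>
lemma phi_S_S:
  assumes X: "X \<in> carrier A" and b: "b \<in> carrier A"
  shows "\<phi> (S (S X) \<bullet> b) = \<phi> (b \<bullet> X)"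
proof -
  note Lb = phi_mult_linear[OF b] and LX = phi_mult_linear[OF X]
  let ?B = "\<lambda>u w. \<phi> (u \<bullet> b) \<odot>\<^bsub>scalars\<^esub> \<phi> (R w \<bullet> X)"
  have LR: "linear_map A scalars (\<lambda>w. \<phi> (R w \<bullet> X))" by (rule linear_map_comp[OF R_linear LX])
  have id: "linear_map A A (\<lambda>x. x)" by (simp add: linear_map_def)
  have bilB: "bilinear_map A A scalars ?B"
    by (rule bilinear_map_comp[OF vspace.bilinear_map_scalars[OF vspace_scalars Lb] id LR])
  have bilS: "bilinear_map A A (tensor A A) (\<lambda>x1 x2. pure_tensor A A (S x2) (S x1))"
    by (rule bilinear_map_swap[OF bilinear_map_comp[OF TA.pure_bilinear S_linear S_linear]])
  have bilBS: "bilinear_map A A scalars (\<lambda>x1 x2. ?B (S x2) (S x1))"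
    by (rule bilinear_map_swap[OF bilinear_map_comp[OF bilB S_linear S_linear]])
  have LS: "linear_map A scalars (\<lambda>u. \<phi> (S u \<bullet> b))" by (rule linear_map_comp[OF S_linear Lb])
  note lin = TA.sweedler_linear[OF vspace_scalars bilB]
  have "\<phi> (S (S X) \<bullet> b) = sweedler scalars (\<Delta> t) (\<lambda>t1 t2. \<phi> (t1 \<bullet> X) \<odot>\<^bsub>scalars\<^esub> \<phi> (S t2 \<bullet> b))"
    by (rule linear_S[OF LS vspace_scalars X])
  also have "\<dots> = sweedler scalars (\<Delta> t) (\<lambda>x1 x2. ?B (S x2) (S x1))"
    by (rule TA.sweedler_cong[OF Delta_t_closed vspace_scalars bilinear_map_comp[OF vspace.bilinear_map_scalars[OF vspace_scalars LX] id LS] bilBS])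
      (simp add: R_S)
  also have "\<dots> = sweedler scalars (\<Delta> t) (\<lambda>x1 x2. sweedler scalars (pure_tensor A A (S x2) (S x1)) ?B)"
    by (rule TA.sweedler_cong[OF Delta_t_closed vspace_scalars bilBS bilinear_map_linear[OF bilS lin]])
      (rule TA.sweedler_pure[OF vspace_scalars bilB, symmetric]; simp add: linear_mapD(1)[OF S_linear])
  also have "\<dots> = sweedler scalars (sweedler (tensor A A) (\<Delta> t) (\<lambda>x1 x2. pure_tensor A A (S x2) (S x1))) ?B"
    by (rule TA.linear_map_sweedler[OF Delta_t_closed TT_vspace vspace_scalars bilS lin, symmetric])
  also have "\<dots> = sweedler scalars (\<Delta> t) ?B"
    unfolding Delta_S[OF t_closed, symmetric] S_t ..
  also have "\<dots> = \<phi> (R (S b) \<bullet> X)" by (rule linear_S[OF LR vspace_scalars b, symmetric])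
  finally show ?thesis by (simp add: R_S b)
qed

text \<open>
  Test \<open>phi_S_S\<close> on \<open>x\<^sub>i\<close> and the complementary monomial. The right side is nonzero, and on the
  left \<open>S (S x\<^sub>i)\<close> is a multiple of \<open>x\<^bsub>\<pi> (\<pi> i)\<^esub>\<close>, whose product with that monomial
  vanishes unless \<open>\<pi> (\<pi> i) = i\<close>. Then the coefficients can be compared.
\<close>
lemma pi_involution: "\<pi> (\<pi> i) = i" and gamma_mult: "\<gamma> i * \<gamma> (\<pi> i) = h_unit i"
proof -
  let ?u = "unit_exp i"
  have SS: "S (S (xm ?u)) = (\<gamma> i * \<gamma> (\<pi> i)) \<cdot> xm (unit_exp (\<pi> (\<pi> i)))"
    by (simp add: S_unit linear_mapD[OF S_linear] A.vs_assoc)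
  have r: "\<phi> (xm (compl ?u) \<bullet> xm ?u) = pairing q (compl ?u) ?u * \<phi> (xm tp)"
    unfolding monom_mult compl_add(1)[OF unit_in_V] by (simp add: linear_mapD[OF phi])
  have l: "\<phi> (S (S (xm ?u)) \<bullet> xm (compl ?u)) =
    (\<gamma> i * \<gamma> (\<pi> i)) * \<phi> (xm (unit_exp (\<pi> (\<pi> i))) \<bullet> xm (compl ?u))"
    unfolding SS by (simp add: smult_A linear_mapD[OF phi])
  have e: "(\<gamma> i * \<gamma> (\<pi> i)) * \<phi> (xm (unit_exp (\<pi> (\<pi> i))) \<bullet> xm (compl ?u)) =
     pairing q (compl ?u) ?u * \<phi> (xm tp)"
    unfolding l[symmetric] r[symmetric] by (rule phi_S_S) simp_all
  show pp: "\<pi> (\<pi> i) = i"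
  proof (rule ccontr)
    assume ne: "\<pi> (\<pi> i) \<noteq> i"
    let ?k = "\<pi> (\<pi> i)"
    have "(\<lambda>j. unit_exp ?k j + compl ?u j) \<notin> V"
    proof
      assume "(\<lambda>j. unit_exp ?k j + compl ?u j) \<in> V"
      from V_le[OF this, of ?k] show False using ne a_ge[of ?k] by (simp add: unit_exp_def)
    qed
    then show False using e phi_top pairing_nz linear_map_zero[OF A.vspace_axioms vspace_scalars phi]
      by (simp add: xm_add_zero)
  qed
  have "(\<gamma> i * \<gamma> (\<pi> i)) * (pairing q ?u (compl ?u) * \<phi> (xm tp)) = pairing q (compl ?u) ?u * \<phi> (xm tp)"
    using e unfolding pp monom_mult compl_add(2)[OF unit_in_V] by (simp add: linear_mapD[OF phi])
  moreover have "pairing q (compl ?u) ?u = pairing q ?u (compl ?u) * h_unit i"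
    using pairing_compl[OF unit_in_V[of i]] unfolding prod_power_unit_exp .
  ultimately have "(\<gamma> i * \<gamma> (\<pi> i)) * (pairing q ?u (compl ?u) * \<phi> (xm tp)) = h_unit i * (pairing q ?u (compl ?u) * \<phi> (xm tp))"
    by (simp only: mult_ac)
  then show "\<gamma> i * \<gamma> (\<pi> i) = h_unit i"
    unfolding mult_right_cancel[OF no_zero_divisors[OF pairing_nz phi_top]] .
qed

text \<open>
  The coefficient of \<open>S x\<^bsub>a-1\<^esub> = x\<^bsub>a-1\<^esub>\<close>.
\<close>
lemma q_perm_gamma: "q_perm q a \<pi> * (\<Prod>i\<in>UNIV. \<gamma> i ^ (a i - 1)) = 1"
proof -
  have "xm tp = antipode_coeff q \<pi> \<gamma> tp \<cdot> xm tp"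
    using antihom_monom[OF S_linear S_one S_anti S_unit compat, of tp] by (simp add: S_top perm_vec_top[OF compat])
  then have "1 = antipode_coeff q \<pi> \<gamma> tp"
    by - (rule smult_cancel[of _ "xm tp"], simp_all add: xm_nonzero)
  then show ?thesis by (simp add: antipode_coeff_top[OF compat])
qed

end

section \<open>Coefficients of the attached structure\<close>

locale attached = qci_data q a
  for q :: "'n::{finite,linorder} \<Rightarrow> 'n \<Rightarrow> 'k::field" and a +
  fixes \<pi> :: "'n \<Rightarrow> 'n" and c :: "'n \<Rightarrow> 'k"
  assumes compat: "compatible_perm q a \<pi>" and inv: "\<pi> \<circ> \<pi> = id"
    and c_mult: "\<And>i. c i * c (\<pi> i) = h_unit i"
    and relation: "q_perm q a \<pi> * (\<Prod>i\<in>UNIV. c i ^ (a i - 1)) = 1"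
begin

abbreviation "s \<equiv> antipode_coeff q \<pi> c"
abbreviation "g \<equiv> g_coeff q a \<pi> c"
abbreviation "pv \<equiv> perm_vec \<pi>"
abbreviation "D \<equiv> attached_comult q a \<pi> c"
abbreviation "S \<equiv> attached_antipode q a \<pi> c"
abbreviation "ep \<equiv> coef (\<lambda>_. 0)"
abbreviation "TT \<equiv> tensor A A"
abbreviation "CCC \<equiv> tensor A TT"
abbreviation "mid v \<equiv> v \<in> V \<and> v \<noteq> (\<lambda>_. 0) \<and> v \<noteq> tp"

lemma pi_pi: "\<pi> (\<pi> i) = i" using inv by (metis comp_apply id_apply)

lemma pv_V: "v \<in> V \<Longrightarrow> pv v \<in> V" by (simp add: perm_exp_in_V[OF compat])

lemma pv_pv: "pv (pv v) = v"
proof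
  fix i
  have "pv (pv v) (\<pi> (\<pi> i)) = v i" by (simp only: perm_vec_apply[OF compatD(1)[OF compat]])
  then show "pv (pv v) i = v i" by (simp add: pi_pi)
qed

lemma pv_zero: "pv (\<lambda>_. 0) = (\<lambda>_. 0)" by (rule perm_vec_zero)
lemma pv_top: "pv tp = tp" by (rule perm_vec_top[OF compat])

lemma pv_eq_iff: "pv v = (\<lambda>_. 0) \<longleftrightarrow> v = (\<lambda>_. 0)" "pv v = tp \<longleftrightarrow> v = tp"
  using pv_pv pv_zero pv_top by metis+

lemma top_ne_zero: "tp \<noteq> (\<lambda>_. 0)"
proof
  assume "tp = (\<lambda>_. 0)"
  then have "a undefined - 1 = 0" unfolding top_exp_def by meson
  then show False using a_ge[of undefined] by simp
qed

lemma compl_zero: "compl (\<lambda>_. 0) = tp" and compl_top: "compl tp = (\<lambda>_. 0)"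
  by (simp_all add: top_exp_def)

lemma compl_eq_iff:
  assumes "v \<in> V" shows "compl v = (\<lambda>_. 0) \<longleftrightarrow> v = tp" "compl v = tp \<longleftrightarrow> v = (\<lambda>_. 0)"
proof -
  have "a i - 1 - v i = 0 \<longleftrightarrow> v i = a i - 1" "a i - 1 - v i = a i - 1 \<longleftrightarrow> v i = 0" for i
    using V_le[OF assms, of i] by arith+
  then show "compl v = (\<lambda>_. 0) \<longleftrightarrow> v = tp" "compl v = tp \<longleftrightarrow> v = (\<lambda>_. 0)"
    unfolding fun_eq_iff top_exp_def by blast+
qed

lemma mid_pv: "mid v \<Longrightarrow> mid (pv v)" by (simp add: pv_V pv_eq_iff)
lemma mid_compl: "mid v \<Longrightarrow> mid (compl v)"
  using compl_eq_iff[of v] compl_in_V[of v] by (simp del: diff_diff_left)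

lemma s_pv: "s w * s (pv w) = (h_exp w)"
  using antipode_coeff_perm[OF compat inv, of c w] by (simp add: c_mult)

lemma s_zero: "s (\<lambda>_. 0) = 1" by (rule antipode_coeff_zero)
lemma s_top: "s tp = 1" using antipode_coeff_top[OF compat] relation by simp

lemma g_eq: "v \<in> V \<Longrightarrow> g v = s v / pairing q (compl v) v"
  unfolding g_coeff_def by (simp only: q_pairing_compl) simp

lemma g_zero: "g (\<lambda>_. 0) = 1" unfolding g_eq[OF zero_in_V] by (simp add: s_zero)
lemma g_top: "g tp = 1" unfolding g_eq[OF top_in_V] compl_top by (simp add: s_top)

text \<open>
  The symmetry of \<open>g\<close> behind \<open>\<Delta> (S x) = \<Sum> S x\<^sub>2 \<otimes> S x\<^sub>1\<close> at the top monomial.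
\<close>
lemma g_compl: "w \<in> V \<Longrightarrow> g w * (s (pv w) * s (compl w)) = g (compl w)"
proof -
  assume w: "w \<in> V"
  let ?H = "(h_exp w)" and ?P = "pairing q w (compl w)"
  have H: "?H \<noteq> 0" by (simp add: h_unit_nz)
  have frac: "x \<noteq> 0 \<Longrightarrow> x * y / (z * x) = y / z" for x y z :: 'k by simp
  have "g w * (s (pv w) * s (compl w)) = (s w * s (pv w)) * s (compl w) / (?P * ?H)"
    unfolding g_eq[OF w] pairing_compl[OF w] by simp
  also have "\<dots> = s (compl w) / ?P" unfolding s_pv by (rule frac[OF H])
  also have "\<dots> = g (compl w)" unfolding g_eq[OF compl_in_V] compl_compl[OF w] ..
  finally show ?thesis .
qed

section \<open>The attached maps on the standard basis\<close>

lemma S_linear: "linear_map A A S"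
  unfolding attached_antipode_def by (rule extend_linear[OF A.vspace_axioms]) simp

lemma S_monom: "S (xm v) = s v \<cdot> xm (pv v)"
proof (cases "v \<in> V")
  case True
  then show ?thesis unfolding attached_antipode_def by (intro extend_monom[OF A.vspace_axioms]) simp_all
next
  case False
  then show ?thesis using linear_map_zero[OF A.vspace_axioms A.vspace_axioms S_linear] perm_exp_in_V[OF compat, of v]
    by (simp add: monom_zero)
qed

lemma S_one: "S \<one>\<^sub>A = \<one>\<^sub>A"
  using S_monom[of "\<lambda>_. 0"] by (simp add: s_zero pv_zero monom_0)

lemma S_top: "S (xm tp) = xm tp" by (simp add: S_monom s_top pv_top)

lemma counit_eq: "attached_counit q a = ep"
proof
  fix X
  have "attached_counit q a X = (\<Sum>v\<in>V. if v = (\<lambda>_. 0) then ep X else 0)"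
    unfolding attached_counit_def qci_extend_def finsum_scalars[OF finite_V] by (intro sum.cong) auto
  then show "attached_counit q a X = ep X" using finite_V by simp
qed

lemma basis_closed: "v \<in> V \<Longrightarrow> attached_comult_basis q a \<pi> c v \<in> carrier TT"
  unfolding attached_comult_basis_def Let_def by (auto intro!: TA.T.finsum_closed)

lemma D_linear: "linear_map A TT D"
  unfolding attached_comult_def by (rule extend_linear[OF TT_vspace basis_closed])

lemma D_basis: "v \<in> V \<Longrightarrow> D (xm v) = attached_comult_basis q a \<pi> c v"
  unfolding attached_comult_def by (rule extend_monom[OF TT_vspace basis_closed])

lemma D_one: "D \<one>\<^sub>A = pure_tensor A A \<one>\<^sub>A \<one>\<^sub>A"
  using D_basis[OF zero_in_V] by (simp add: monom_0 attached_comult_basis_def Let_def)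

lemma D_mid: "mid v \<Longrightarrow> D (xm v) = pure_tensor A A \<one>\<^sub>A (xm v) \<oplus>\<^bsub>TT\<^esub> pure_tensor A A (xm v) \<one>\<^sub>A"
  by (simp add: D_basis attached_comult_basis_def Let_def)

lemma D_top: "D (xm tp) = (\<Oplus>\<^bsub>TT\<^esub>w\<in>V. g w \<odot>\<^bsub>TT\<^esub> pure_tensor A A (xm (compl w)) (xm (pv w)))"
  using top_ne_zero by (simp only: D_basis[OF top_in_V] attached_comult_basis_def Let_def if_False if_True simp_thms)

lemma D_closed: "X \<in> carrier A \<Longrightarrow> D X \<in> carrier TT" by (rule linear_mapD(1)[OF D_linear])

lemma sweedler_D_one:
  assumes "vspace P" "bilinear_map A A P \<beta>"
  shows "sweedler P (D \<one>\<^sub>A) \<beta> = \<beta> \<one>\<^sub>A \<one>\<^sub>A"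
  unfolding D_one by (rule TA.sweedler_pure[OF assms]) simp_all

lemma sweedler_D_mid:
  assumes "vspace P" "bilinear_map A A P \<beta>" "mid v"
  shows "sweedler P (D (xm v)) \<beta> = \<beta> \<one>\<^sub>A (xm v) \<oplus>\<^bsub>P\<^esub> \<beta> (xm v) \<one>\<^sub>A"
  unfolding D_mid[OF assms(3)]
  by (subst linear_mapD(2)[OF TA.sweedler_linear[OF assms(1,2)]]) (simp_all add: TA.sweedler_pure[OF assms(1,2)])

lemma sweedler_D_top:
  assumes "vspace P" "bilinear_map A A P \<beta>"
  shows "sweedler P (D (xm tp)) \<beta> = (\<Oplus>\<^bsub>P\<^esub>w\<in>V. g w \<odot>\<^bsub>P\<^esub> \<beta> (xm (compl w)) (xm (pv w)))"
proof -
  interpret P: vspace P by fact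
  note L = TA.sweedler_linear[OF assms]
  have "sweedler P (D (xm tp)) \<beta> =
    (\<Oplus>\<^bsub>P\<^esub>w\<in>V. sweedler P (g w \<odot>\<^bsub>TT\<^esub> pure_tensor A A (xm (compl w)) (xm (pv w))) \<beta>)"
    unfolding D_top by (rule linear_map_finsum[OF TT_vspace assms(1) L finite_V]) auto
  also have "\<dots> = (\<Oplus>\<^bsub>P\<^esub>w\<in>V. g w \<odot>\<^bsub>P\<^esub> \<beta> (xm (compl w)) (xm (pv w)))"
    using bilinear_mapD(3)[OF assms(2)]
    by (intro P.finsum_cong') (auto simp: linear_mapD(3)[OF L] TA.sweedler_pure[OF assms])
  finally show ?thesis .
qed

lemma basis_cases:
  assumes "v \<in> V" obtains "v = (\<lambda>_. 0)" | "v = tp" | "mid v"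
  using assms by blast

lemma sweedler_D_linear:
  assumes "vspace P" "bilinear_map A A P \<beta>"
  shows "linear_map A P (\<lambda>X. sweedler P (D X) \<beta>)"
  by (rule linear_map_comp[OF D_linear TA.sweedler_linear[OF assms]])

section \<open>The attached coalgebra\<close>

sublocale TC: tensor_pair A "tensor A A" by unfold_locales

lemmas CCC_vspace = TC.T.vspace_axioms

abbreviation CCC_add (infixl "\<oplus>\<^sub>3" 65) where "X \<oplus>\<^sub>3 Y \<equiv> X \<oplus>\<^bsub>CCC\<^esub> Y"
abbreviation "triple x y z \<equiv> pure_tensor A TT x (pure_tensor A A y z)"

lemma pure_tensor_linear: "X \<in> carrier A \<Longrightarrow> linear_map A TT (\<lambda>y. pure_tensor A A X y)"
    "X \<in> carrier A \<Longrightarrow> linear_map A TT (\<lambda>y. pure_tensor A A y X)"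
  by (rule bilinear_mapD(1)[OF TA.pure_bilinear] bilinear_mapD(2)[OF TA.pure_bilinear], assumption)+

lemma triple_bilinear:
  "z \<in> carrier A \<Longrightarrow> bilinear_map A A CCC (\<lambda>x y. triple x y z)"
  "z \<in> carrier A \<Longrightarrow> bilinear_map A A CCC (\<lambda>x y. triple z x y)"
  by (rule bilinear_map_comp[OF TC.pure_bilinear id_linear pure_tensor_linear(2)])
    (auto intro: bilinear_map_linear[OF TA.pure_bilinear bilinear_mapD(1)[OF TC.pure_bilinear]])

lemma triple_linear_1: "y \<in> carrier A \<Longrightarrow> z \<in> carrier A \<Longrightarrow> linear_map A CCC (\<lambda>x. triple x y z)"
  using bilinear_mapD(2)[OF triple_bilinear(1)] by simp

lemma triple_linear_3: "x \<in> carrier A \<Longrightarrow> y \<in> carrier A \<Longrightarrow> linear_map A CCC (\<lambda>z. triple x y z)"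
  using bilinear_mapD(1)[OF triple_bilinear(2)] by simp

lemma triple_closed: "x \<in> carrier A \<Longrightarrow> y \<in> carrier A \<Longrightarrow> z \<in> carrier A \<Longrightarrow> triple x y z \<in> carrier CCC"
  by simp

text \<open>
  The iterated comultiplications \<open>\<Delta> y \<otimes> z\<close> and \<open>y \<otimes> \<Delta> z\<close> in the triple tensor product.
\<close>
definition "split_left y z = sweedler CCC (D y) (\<lambda>y1 y2. triple y1 y2 z)"
definition "split_right y z = sweedler CCC (D z) (\<lambda>z1 z2. triple y z1 z2)"

lemma split_left_bilinear: "bilinear_map A A CCC split_left"
  unfolding split_left_def[abs_def]
  by (rule bilinear_mapI)
    (auto intro!: TA.sweedler_linear_param[OF D_closed CCC_vspace A.vspace_axioms triple_bilinear(1) triple_linear_3]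
      sweedler_D_linear[OF CCC_vspace triple_bilinear(1)])

lemma split_right_bilinear: "bilinear_map A A CCC split_right"
  unfolding split_right_def[abs_def]
  by (rule bilinear_mapI)
    (auto intro!: TA.sweedler_linear_param[OF D_closed CCC_vspace A.vspace_axioms triple_bilinear(2) triple_linear_1]
      sweedler_D_linear[OF CCC_vspace triple_bilinear(2)])

lemma split_one:
  assumes "z \<in> carrier A"
  shows "split_left \<one>\<^sub>A z = triple \<one>\<^sub>A \<one>\<^sub>A z" "split_right z \<one>\<^sub>A = triple z \<one>\<^sub>A \<one>\<^sub>A"
  unfolding split_left_def split_right_def using assms sweedler_D_one[OF CCC_vspace triple_bilinear(1)] sweedler_D_one[OF CCC_vspace triple_bilinear(2)] by auto

lemma split_mid:
  assumes "z \<in> carrier A" "mid v"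
  shows "split_left (xm v) z = triple \<one>\<^sub>A (xm v) z \<oplus>\<^sub>3 triple (xm v) \<one>\<^sub>A z"
    "split_right z (xm v) = triple z \<one>\<^sub>A (xm v) \<oplus>\<^sub>3 triple z (xm v) \<one>\<^sub>A"
  unfolding split_left_def split_right_def
  using sweedler_D_mid[OF CCC_vspace triple_bilinear(1)[OF assms(1)] assms(2)]
    sweedler_D_mid[OF CCC_vspace triple_bilinear(2)[OF assms(1)] assms(2)] by auto

lemma finsum_V_split:
  assumes "vspace P" "\<And>v. v \<in> V \<Longrightarrow> f v \<in> carrier P"
  shows "finsum P f V = f (\<lambda>_. 0) \<oplus>\<^bsub>P\<^esub> (f tp \<oplus>\<^bsub>P\<^esub> finsum P f {v. mid v})"
proof -
  interpret P: vspace P by fact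
  define M where "M = {v. mid v}"
  have V: "V = insert (\<lambda>_. 0) (insert tp M)" unfolding M_def using zero_in_V top_in_V by blast
  have fin: "finite M" unfolding M_def by (rule finite_subset[OF _ finite_V]) auto
  have M: "(\<lambda>_. 0) \<notin> insert tp M" "tp \<notin> M" using top_ne_zero by (auto simp: M_def)
  have cl: "f (\<lambda>_. 0) \<in> carrier P" "f tp \<in> carrier P" "f \<in> M \<rightarrow> carrier P"
    using assms(2) by (auto simp: M_def)
  have "finsum P f (insert tp M) = f tp \<oplus>\<^bsub>P\<^esub> finsum P f M"
    using fin M(2) cl by (intro P.finsum_insert) auto
  moreover have "finsum P f (insert (\<lambda>_. 0) (insert tp M)) = f (\<lambda>_. 0) \<oplus>\<^bsub>P\<^esub> finsum P f (insert tp M)"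
    using fin M(1) cl by (intro P.finsum_insert) auto
  ultimately have "finsum P f V = f (\<lambda>_. 0) \<oplus>\<^bsub>P\<^esub> (f tp \<oplus>\<^bsub>P\<^esub> finsum P f M)"
    by (simp only: V)
  then show ?thesis by (simp only: M_def)
qed

lemma split_top:
  assumes "z \<in> carrier A"
  shows "split_left (xm tp) z = triple (xm tp) \<one>\<^sub>A z \<oplus>\<^sub>3 (triple \<one>\<^sub>A (xm tp) z \<oplus>\<^sub>3
      (\<Oplus>\<^bsub>CCC\<^esub>w\<in>{v. mid v}. g w \<odot>\<^bsub>CCC\<^esub> triple (xm (compl w)) (xm (pv w)) z))" (is ?F)
    "split_right z (xm tp) = triple z (xm tp) \<one>\<^sub>A \<oplus>\<^sub>3 (triple z \<one>\<^sub>A (xm tp) \<oplus>\<^sub>3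
      (\<Oplus>\<^bsub>CCC\<^esub>w\<in>{v. mid v}. g w \<odot>\<^bsub>CCC\<^esub> triple z (xm (compl w)) (xm (pv w))))" (is ?G)
proof -
  show ?F
    unfolding split_left_def sweedler_D_top[OF CCC_vspace triple_bilinear(1)[OF assms]]
    by (subst finsum_V_split[OF CCC_vspace])
      (use assms in \<open>simp_all only: compl_zero compl_top pv_zero pv_top g_zero g_top monom_0 TC.T.vs_simps triple_closed monom_closed A.one_closed\<close>)
  show ?G
    unfolding split_right_def sweedler_D_top[OF CCC_vspace triple_bilinear(2)[OF assms]]
    by (subst finsum_V_split[OF CCC_vspace])
      (use assms in \<open>simp_all only: compl_zero compl_top pv_zero pv_top g_zero g_top monom_0 TC.T.vs_simps triple_closed monom_closed A.one_closed\<close>)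
qed

text \<open>
  Expanding \<open>\<Delta>\<close> of the top monomial once more, with its two outer terms split off, both sides
  consist of the three tensors with a top factor and of three sums over the primitive monomials, in
  which the factor 1 stands in the first, the second and the third place.
\<close>
lemma coassoc_top: "sweedler CCC (D (xm tp)) split_left = sweedler CCC (D (xm tp)) split_right"
proof -
  let ?o = "\<one>\<^sub>A" and ?t = "xm tp"
  note cl = bilinear_mapD(3)[OF split_left_bilinear] bilinear_mapD(3)[OF split_right_bilinear]
  define Z where "Z f = (\<Oplus>\<^bsub>CCC\<^esub>w\<in>{v. mid v}. g w \<odot>\<^bsub>CCC\<^esub> f (xm (compl w)) (xm (pv w)))" for f
  have fin: "finite {v. mid v}" by (rule finite_subset[OF _ finite_V]) auto
  have Zc: "Z f \<in> carrier CCC" if "\<And>x y. x \<in> carrier A \<Longrightarrow> y \<in> carrier A \<Longrightarrow> f x y \<in> carrier CCC" for f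
    unfolding Z_def using that by (intro TC.T.finsum_closed) auto
  have split: "sweedler CCC (D ?t) \<beta> = \<beta> ?t ?o \<oplus>\<^sub>3 (\<beta> ?o ?t \<oplus>\<^sub>3 Z \<beta>)" if "bilinear_map A A CCC \<beta>" for \<beta>
    unfolding sweedler_D_top[OF CCC_vspace that] Z_def
    by (subst finsum_V_split[OF CCC_vspace])
      (use bilinear_mapD(3)[OF that] in \<open>simp_all only: compl_zero compl_top pv_zero pv_top g_zero g_top monom_0 TC.T.vs_simps monom_closed A.one_closed\<close>)
  have Zadd: "Z f \<oplus>\<^sub>3 Z h = Z (\<lambda>x y. f x y \<oplus>\<^sub>3 h x y)"
    if "\<And>x y. x \<in> carrier A \<Longrightarrow> y \<in> carrier A \<Longrightarrow> f x y \<in> carrier CCC"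
      "\<And>x y. x \<in> carrier A \<Longrightarrow> y \<in> carrier A \<Longrightarrow> h x y \<in> carrier CCC" for f h
    unfolding Z_def using that by (simp add: TC.T.vs_distr_r TC.T.finsum_addf Pi_iff)
  have Zcong: "Z f = Z h" if "\<And>w. mid w \<Longrightarrow> f (xm (compl w)) (xm (pv w)) = h (xm (compl w)) (xm (pv w))"
      "\<And>x y. x \<in> carrier A \<Longrightarrow> y \<in> carrier A \<Longrightarrow> h x y \<in> carrier CCC" for f h
    unfolding Z_def using that by (intro TC.T.finsum_cong') auto
  let ?X = "Z (\<lambda>x y. triple x y ?o)" and ?Y = "Z (\<lambda>x y. triple ?o x y)" and ?W = "Z (\<lambda>x y. triple x ?o y)"
  have ZF: "Z split_left = ?Y \<oplus>\<^sub>3 ?W"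
  proof -
    have "Z split_left = Z (\<lambda>x y. triple ?o x y \<oplus>\<^sub>3 triple x ?o y)"
      by (rule Zcong, rule split_mid(1)[OF monom_closed mid_compl], assumption)
        (simp only: TC.T.add.m_closed triple_closed A.one_closed)
    then show ?thesis by (subst Zadd) (simp_all only: triple_closed A.one_closed)
  qed
  have ZG: "Z split_right = ?W \<oplus>\<^sub>3 ?X"
  proof -
    have "Z split_right = Z (\<lambda>x y. triple x ?o y \<oplus>\<^sub>3 triple x y ?o)"
      by (rule Zcong, rule split_mid(2)[OF monom_closed mid_pv], assumption)
        (simp only: TC.T.add.m_closed triple_closed A.one_closed)
    then show ?thesis by (subst Zadd) (simp_all only: triple_closed A.one_closed)
  qed
  have c: "?X \<in> carrier CCC" "?Y \<in> carrier CCC" "?W \<in> carrier CCC"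
    by (rule Zc; simp only: triple_closed A.one_closed)+
  have c': "triple ?t ?o ?o \<in> carrier CCC" "triple ?o ?t ?o \<in> carrier CCC" "triple ?o ?o ?t \<in> carrier CCC"
    by (simp_all only: triple_closed A.one_closed monom_closed)
  have e1: "split_left ?t ?o = triple ?t ?o ?o \<oplus>\<^sub>3 (triple ?o ?t ?o \<oplus>\<^sub>3 ?X)"
    unfolding Z_def by (rule split_top(1)) simp
  have e2: "split_right ?o ?t = triple ?o ?t ?o \<oplus>\<^sub>3 (triple ?o ?o ?t \<oplus>\<^sub>3 ?Y)"
    unfolding Z_def by (rule split_top(2)) simp
  have e3: "split_left ?o ?t = triple ?o ?o ?t" "split_right ?t ?o = triple ?t ?o ?o" by (rule split_one; simp)+
  have comm: "(x \<oplus>\<^sub>3 (y \<oplus>\<^sub>3 u)) \<oplus>\<^sub>3 (z \<oplus>\<^sub>3 (v \<oplus>\<^sub>3 w)) = x \<oplus>\<^sub>3 ((y \<oplus>\<^sub>3 (z \<oplus>\<^sub>3 v)) \<oplus>\<^sub>3 (w \<oplus>\<^sub>3 u))"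
    if "x \<in> carrier CCC" "y \<in> carrier CCC" "z \<in> carrier CCC" "u \<in> carrier CCC" "v \<in> carrier CCC" "w \<in> carrier CCC" for x y z u v w
    using that by (simp add: TC.T.a_ac)
  show ?thesis unfolding split[OF split_left_bilinear] split[OF split_right_bilinear] ZF ZG e1 e2 e3
    by (rule comm) (fact c c')+
qed

lemma coassoc: "X \<in> carrier A \<Longrightarrow> sweedler CCC (D X) split_left = sweedler CCC (D X) split_right"
proof (rule linear_ext[OF CCC_vspace sweedler_D_linear[OF CCC_vspace split_left_bilinear] sweedler_D_linear[OF CCC_vspace split_right_bilinear]])
  fix v assume "v \<in> V"
  then show "sweedler CCC (D (xm v)) split_left = sweedler CCC (D (xm v)) split_right"
  proof (cases rule: basis_cases)
    case 1
    then show ?thesis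
      by (simp only: monom_0 sweedler_D_one[OF CCC_vspace split_left_bilinear] sweedler_D_one[OF CCC_vspace split_right_bilinear] split_one A.one_closed)
  next
    case 2
    then show ?thesis by (simp only: coassoc_top)
  next
    case 3
    have "triple \<one>\<^sub>A \<one>\<^sub>A (xm v) \<oplus>\<^sub>3 (triple \<one>\<^sub>A (xm v) \<one>\<^sub>A \<oplus>\<^sub>3 triple (xm v) \<one>\<^sub>A \<one>\<^sub>A) =
      triple \<one>\<^sub>A \<one>\<^sub>A (xm v) \<oplus>\<^sub>3 triple \<one>\<^sub>A (xm v) \<one>\<^sub>A \<oplus>\<^sub>3 triple (xm v) \<one>\<^sub>A \<one>\<^sub>A"
      by (rule TC.T.a_assoc[symmetric]; simp)
    then show ?thesis
      by (simp only: sweedler_D_mid[OF CCC_vspace split_left_bilinear 3] sweedler_D_mid[OF CCC_vspace split_right_bilinear 3]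
          split_one split_mid[OF A.one_closed 3] monom_closed)
  qed
qed

lemma counit_bilinear: "bilinear_map A A A (\<lambda>y z. ep y \<cdot> z)" "bilinear_map A A A (\<lambda>y z. ep z \<cdot> y)"
  using A.bilinear_map_scalars[OF dual_linear] bilinear_map_swap by blast+

lemma ep_monom: "v \<in> V \<Longrightarrow> ep (xm v) = (if v = (\<lambda>_. 0) then 1 else 0)" by (rule dual_monom)

lemma counit:
  "X \<in> carrier A \<Longrightarrow> sweedler A (D X) (\<lambda>y z. ep y \<cdot> z) = X"
  "X \<in> carrier A \<Longrightarrow> sweedler A (D X) (\<lambda>y z. ep z \<cdot> y) = X"
proof -
  note l = sweedler_D_linear[OF A.vspace_axioms counit_bilinear(1)] sweedler_D_linear[OF A.vspace_axioms counit_bilinear(2)]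
  have l1: "sweedler A (D (xm v)) (\<lambda>y z. ep y \<cdot> z) = xm v" if "v \<in> V" for v
    using that
  proof (cases rule: basis_cases)
    case 1 then show ?thesis by (simp add: monom_0 sweedler_D_one[OF A.vspace_axioms counit_bilinear(1)] dual_one)
  next
    case 3 then show ?thesis by (simp add: sweedler_D_mid[OF A.vspace_axioms counit_bilinear(1) 3] dual_one ep_monom)
  next
    case 2
    have "(\<Oplus>\<^bsub>A\<^esub>w\<in>V. g w \<cdot> (ep (xm (compl w)) \<cdot> xm (pv w))) = xm tp"
    proof (rule A.finsum_delta[OF finite_V top_in_V])
      fix w assume "w \<in> V"
      then show "g w \<cdot> (ep (xm (compl w)) \<cdot> xm (pv w)) = (if w = tp then xm tp else \<zero>\<^sub>A)"
        unfolding ep_monom[OF compl_in_V] compl_eq_iff(1)[OF \<open>w \<in> V\<close>] by (simp add: g_top pv_top)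
    qed simp
    then show ?thesis unfolding 2 sweedler_D_top[OF A.vspace_axioms counit_bilinear(1)] .
  qed
  have l2: "sweedler A (D (xm v)) (\<lambda>y z. ep z \<cdot> y) = xm v" if "v \<in> V" for v
    using that
  proof (cases rule: basis_cases)
    case 1 then show ?thesis by (simp add: monom_0 sweedler_D_one[OF A.vspace_axioms counit_bilinear(2)] dual_one)
  next
    case 3 then show ?thesis by (simp add: sweedler_D_mid[OF A.vspace_axioms counit_bilinear(2) 3] dual_one ep_monom)
  next
    case 2
    have "(\<Oplus>\<^bsub>A\<^esub>w\<in>V. g w \<cdot> (ep (xm (pv w)) \<cdot> xm (compl w))) = xm tp"
    proof (rule A.finsum_delta[OF finite_V zero_in_V])
      fix w assume w: "w \<in> V"
      show "g w \<cdot> (ep (xm (pv w)) \<cdot> xm (compl w)) = (if w = (\<lambda>_. 0) then xm tp else \<zero>\<^sub>A)"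
        unfolding ep_monom[OF pv_V[OF w]] pv_eq_iff(1)
        by (cases "w = (\<lambda>_. 0)") (simp_all only: g_zero compl_zero if_True if_False, simp_all)
    qed simp
    then show ?thesis unfolding 2 sweedler_D_top[OF A.vspace_axioms counit_bilinear(2)] .
  qed
  show "X \<in> carrier A \<Longrightarrow> sweedler A (D X) (\<lambda>y z. ep y \<cdot> z) = X"
    by (rule linear_ext[OF A.vspace_axioms l(1) id_linear l1])
  show "X \<in> carrier A \<Longrightarrow> sweedler A (D X) (\<lambda>y z. ep z \<cdot> y) = X"
    by (rule linear_ext[OF A.vspace_axioms l(2) id_linear l2])
qed

lemma coalgebra_D: "coalgebra A D ep"
  unfolding coalgebra_def Let_def split_left_def[symmetric] split_right_def[symmetric]
  using A.vspace_axioms D_linear dual_linear coassoc counit by (auto simp: vspace_def)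

section \<open>The attached bi-Frobenius algebra\<close>

lemma tr_scale_bilinear: "X \<in> carrier A \<Longrightarrow> bilinear_map A A A (\<lambda>t1 t2. tr (t1 \<bullet> X) \<cdot> t2)"
  by (rule A.bilinear_map_scalars[OF bilinear_mapD(2)[OF tr_mult_bilinear]])

lemma S_eq_sweedler: "X \<in> carrier A \<Longrightarrow> S X = sweedler A (D (xm tp)) (\<lambda>t1 t2. tr (t1 \<bullet> X) \<cdot> t2)"
proof (rule linear_ext[OF A.vspace_axioms S_linear])
  show "linear_map A A (\<lambda>X. sweedler A (D (xm tp)) (\<lambda>t1 t2. tr (t1 \<bullet> X) \<cdot> t2))"
    by (rule TA.sweedler_linear_param[OF D_closed[OF monom_closed] A.vspace_axioms A.vspace_axioms tr_scale_bilinear])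
      (auto intro!: A.linear_map_scalar_smult bilinear_mapD(1)[OF tr_mult_bilinear])
  fix v assume v: "v \<in> V"
  have "(\<Oplus>\<^bsub>A\<^esub>w\<in>V. g w \<cdot> (tr (xm (compl w) \<bullet> xm v) \<cdot> xm (pv w))) = s v \<cdot> xm (pv v)"
  proof (rule A.finsum_delta[OF finite_V v])
    fix w assume w: "w \<in> V"
    show "g w \<cdot> (tr (xm (compl w) \<bullet> xm v) \<cdot> xm (pv w)) = (if w = v then s v \<cdot> xm (pv v) else \<zero>\<^sub>A)"
      unfolding tr_compl(1)[OF w monom_closed] dual_monom[OF v] g_eq[OF w] using pairing_nz[of "compl w" w]
      by (auto simp: A.vs_assoc[symmetric])
  qed simp
  then show "S (xm v) = sweedler A (D (xm tp)) (\<lambda>t1 t2. tr (t1 \<bullet> xm v) \<cdot> t2)"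
    unfolding sweedler_D_top[OF A.vspace_axioms tr_scale_bilinear[OF monom_closed]] S_monom by simp
qed

lemma ep_mult: "X \<in> carrier A \<Longrightarrow> Y \<in> carrier A \<Longrightarrow> ep (X \<bullet> Y) = ep X * ep Y"
proof (rule bilinear_ext[OF vspace_scalars bilinear_map_linear[OF mult_bilinear dual_linear]])
  show "bilinear_map A A scalars (\<lambda>X Y. ep X * ep Y)"
    using bilinear_map_comp[OF vspace.bilinear_map_scalars[OF vspace_scalars dual_linear] id_linear dual_linear] by simp
  fix v w assume v: "v \<in> V" and w: "w \<in> V"
  show "ep (xm v \<bullet> xm w) = ep (xm v) * ep (xm w)"
  proof (cases "v = (\<lambda>_. 0)")
    case True then show ?thesis by (simp add: monom_0 dual_one)
  next
    case False
    then have "(\<lambda>i. v i + w i) \<noteq> (\<lambda>_. 0)" by (auto simp: fun_eq_iff)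
    then have "ep (xm (\<lambda>i. v i + w i)) = 0"
      using coef_zero
      by (cases "(\<lambda>i. v i + w i) \<in> V") (simp_all add: ep_monom monom_zero)
    then show ?thesis using v False by (simp add: monom_mult coef_scale ep_monom)
  qed
qed

lemma frobenius_A: "frobenius_algebra A tr"
  unfolding frobenius_algebra_def
proof
  fix f assume "f \<in> dual_space A"
  then have f: "linear_map A scalars f" by (simp add: dual_space_def)
  define b where "b = lin_comb (\<lambda>u. f (xm (compl u)) / pairing q u (compl u))"
  have "f X = tr (b \<bullet> X)" if "X \<in> carrier A" for X
  proof (rule linear_ext[OF vspace_scalars f bilinear_mapD(1)[OF tr_mult_bilinear] _ that])
    fix v assume v: "v \<in> V"
    have b: "b \<in> carrier A" by (simp add: b_def)
    have db: "coef u b = f (xm (compl u)) / pairing q u (compl u)" if "u \<in> V" for u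
      using that by (simp only: b_def qci_dual_monom_def coords_lin_comb if_True)
    have "tr (b \<bullet> xm (compl (compl v))) = f (xm (compl (compl v)))"
      unfolding tr_compl(2)[OF compl_in_V b] db[OF compl_in_V]
      by (simp only: times_divide_eq_right nonzero_mult_div_cancel_left[OF pairing_nz])
    then show "f (xm v) = tr (b \<bullet> xm v)" unfolding compl_compl[OF v] ..
  qed (simp add: b_def)
  then have "\<forall>x\<in>carrier A. f x = tr (b \<bullet> x)" by (rule ballI)
  moreover have "b \<in> carrier A" by (simp add: b_def)
  ultimately show "\<exists>b\<in>carrier A. \<forall>x\<in>carrier A. f x = tr (b \<bullet> x)" by (rule bexI)
qed

text \<open>
  \<open>S\<^sup>2\<close> multiplies \<open>x\<^sub>v\<close> by \<open>h\<^sub>v\<close>, and the Nakayama automorphism divides it by \<open>h\<^sub>v\<close>.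
\<close>
lemma S_S_nak: "X \<in> carrier A \<Longrightarrow> S (S (nak X)) = X"
proof (rule linear_ext[OF A.vspace_axioms linear_map_comp[OF nak_linear linear_map_comp[OF S_linear S_linear]] id_linear])
  fix v assume v: "v \<in> V"
  have i: "inverse (h_exp v) * (s v * s (pv v)) = 1" unfolding s_pv by (simp add: h_unit_nz)
  show "S (S (nak (xm v))) = xm v"
    by (simp add: nak_monom[OF v] linear_mapD(3)[OF S_linear] S_monom pv_pv A.vs_assoc[symmetric] mult.assoc i)
qed

text \<open>
  The functionals \<open>\<lambda>x. tr (x Y)\<close> already suffice: they yield the values \<open>S Y\<close>, and \<open>S\<close> is
  surjective by \<open>S_S_nak\<close>.
\<close>
lemma frobenius_coalgebra_A: "frobenius_coalgebra A D (xm tp)"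
  unfolding frobenius_coalgebra_def
proof (intro equalityI subsetI)
  fix X assume X: "X \<in> carrier A"
  define Y where "Y = S (nak X)"
  have Y: "Y \<in> carrier A" using X linear_mapD(1)[OF S_linear] linear_mapD(1)[OF nak_linear] by (simp add: Y_def)
  have "X = sweedler A (D (xm tp)) (\<lambda>t1 t2. tr (t1 \<bullet> Y) \<cdot> t2)"
    using S_eq_sweedler[OF Y] S_S_nak[OF X] by (simp add: Y_def)
  moreover have "(\<lambda>x. tr (x \<bullet> Y)) \<in> dual_space A"
    using bilinear_mapD(2)[OF tr_mult_bilinear Y] by (simp add: dual_space_def)
  ultimately show "X \<in> {sweedler A (D (xm tp)) (\<lambda>t1 t2. f t1 \<cdot> t2) |f. f \<in> dual_space A}"
    by (intro CollectI exI[of _ "\<lambda>x. tr (x \<bullet> Y)"] conjI)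
next
  fix X assume "X \<in> {sweedler A (D (xm tp)) (\<lambda>t1 t2. f t1 \<cdot> t2) |f. f \<in> dual_space A}"
  then obtain f where "linear_map A scalars f" "X = sweedler A (D (xm tp)) (\<lambda>t1 t2. f t1 \<cdot> t2)"
    by (auto simp: dual_space_def)
  then show "X \<in> carrier A"
    using linear_mapD(1)[OF TA.sweedler_linear[OF A.vspace_axioms A.bilinear_map_scalars] D_closed[OF monom_closed]] by blast
qed

lemma S_antimult: "X \<in> carrier A \<Longrightarrow> Y \<in> carrier A \<Longrightarrow> S (X \<bullet> Y) = S Y \<bullet> S X"
proof (rule bilinear_ext[OF A.vspace_axioms bilinear_map_linear[OF mult_bilinear S_linear]
    bilinear_map_swap[OF bilinear_map_comp[OF mult_bilinear S_linear S_linear]]])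
  fix v w assume "v \<in> V" "w \<in> V"
  have "S (xm v \<bullet> xm w) = (pairing q v w * s (\<lambda>i. v i + w i)) \<cdot> xm (pv (\<lambda>i. v i + w i))"
    by (simp add: monom_mult linear_mapD(3)[OF S_linear] S_monom A.vs_assoc)
  also have "\<dots> = (s v * (s w * pairing q (pv w) (pv v))) \<cdot> xm (\<lambda>i. pv w i + pv v i)"
    unfolding antipode_coeff_mult[OF compat] perm_vec_add by (simp add: mult.assoc add.commute)
  also have "\<dots> = S (xm w) \<bullet> S (xm v)"
    by (simp add: S_monom smult_A monom_mult A.vs_assoc)
  finally show "S (xm v \<bullet> xm w) = S (xm w) \<bullet> S (xm v)" .
qed

lemma ep_S: "X \<in> carrier A \<Longrightarrow> ep (S X) = ep X"
proof (rule linear_ext[OF vspace_scalars linear_map_comp[OF S_linear dual_linear] dual_linear])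
  fix v assume v: "v \<in> V"
  then show "ep (S (xm v)) = ep (xm v)"
    by (simp add: S_monom coef_scale ep_monom pv_V pv_eq_iff s_zero)
qed

lemma S_flip_bilinear: "bilinear_map A A TT (\<lambda>x1 x2. pure_tensor A A (S x2) (S x1))"
  by (rule bilinear_map_swap[OF bilinear_map_comp[OF TA.pure_bilinear S_linear S_linear]])

lemma pure_tensor_scale:
  assumes "X \<in> carrier A" "Y \<in> carrier A"
  shows "pure_tensor A A (r \<cdot> X) Y = r \<odot>\<^bsub>TT\<^esub> pure_tensor A A X Y" "pure_tensor A A X (r \<cdot> Y) = r \<odot>\<^bsub>TT\<^esub> pure_tensor A A X Y"
  using linear_mapD(3)[OF pure_tensor_linear(2)[OF assms(2)] assms(1)] linear_mapD(3)[OF pure_tensor_linear(1)[OF assms(1)] assms(2)] by auto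

lemma compl_bij: "inj_on (\<lambda>v. compl v) V" "(\<lambda>v. compl v) ` V = V"
proof -
  show "inj_on (\<lambda>v. compl v) V" by (rule inj_on_inverseI[of _ "\<lambda>v. compl v"]) (rule compl_compl)
  show "(\<lambda>v. compl v) ` V = V"
  proof
    show "V \<subseteq> (\<lambda>v. compl v) ` V"
    proof
      fix v assume "v \<in> V"
      show "v \<in> (\<lambda>v. compl v) ` V"
        by (rule image_eqI[where x = "compl v"], rule compl_compl[OF \<open>v \<in> V\<close>, symmetric], rule compl_in_V)
    qed
    show "(\<lambda>v. compl v) ` V \<subseteq> V" by (rule image_subsetI) (rule compl_in_V)
  qed
qed

text \<open>
  For primitive monomials this is the symmetry of \<open>\<Delta>\<close>. At the top monomial the two sums agree term
  by term under \<open>w \<mapsto> a - 1 - w\<close>, by \<open>g_compl\<close>.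
\<close>
lemma D_S: "X \<in> carrier A \<Longrightarrow> D (S X) = sweedler TT (D X) (\<lambda>x1 x2. pure_tensor A A (S x2) (S x1))"
proof (rule linear_ext[OF TT_vspace linear_map_comp[OF S_linear D_linear] sweedler_D_linear[OF TT_vspace S_flip_bilinear]])
  fix v assume "v \<in> V"
  then show "D (S (xm v)) = sweedler TT (D (xm v)) (\<lambda>x1 x2. pure_tensor A A (S x2) (S x1))"
  proof (cases rule: basis_cases)
    case 1
    show ?thesis unfolding 1 monom_0 sweedler_D_one[OF TT_vspace S_flip_bilinear] S_one by (rule D_one)
  next
    case 3
    have "D (S (xm v)) = s v \<odot>\<^bsub>TT\<^esub> pure_tensor A A \<one>\<^sub>A (xm (pv v)) \<oplus>\<^bsub>TT\<^esub> s v \<odot>\<^bsub>TT\<^esub> pure_tensor A A (xm (pv v)) \<one>\<^sub>A"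
      unfolding S_monom linear_mapD(3)[OF D_linear monom_closed] D_mid[OF mid_pv[OF 3]]
      by (rule TA.T.vs_distr_r) simp_all
    also have "\<dots> = s v \<odot>\<^bsub>TT\<^esub> pure_tensor A A (xm (pv v)) \<one>\<^sub>A \<oplus>\<^bsub>TT\<^esub> s v \<odot>\<^bsub>TT\<^esub> pure_tensor A A \<one>\<^sub>A (xm (pv v))"
      by (rule TA.T.a_comm) simp_all
    also have "\<dots> = sweedler TT (D (xm v)) (\<lambda>x1 x2. pure_tensor A A (S x2) (S x1))"
      unfolding sweedler_D_mid[OF TT_vspace S_flip_bilinear 3] S_one S_monom by (simp add: pure_tensor_scale)
    finally show ?thesis .
  next
    case 2
    have "sweedler TT (D (xm tp)) (\<lambda>x1 x2. pure_tensor A A (S x2) (S x1)) =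
      (\<Oplus>\<^bsub>TT\<^esub>w\<in>V. g w \<odot>\<^bsub>TT\<^esub> pure_tensor A A (S (xm (pv w))) (S (xm (compl w))))"
      by (rule sweedler_D_top[OF TT_vspace S_flip_bilinear])
    also have "\<dots> = (\<Oplus>\<^bsub>TT\<^esub>w\<in>V. g (compl w) \<odot>\<^bsub>TT\<^esub> pure_tensor A A (xm (compl (compl w))) (xm (pv (compl w))))"
    proof (rule TA.T.finsum_cong'[OF refl])
      fix w assume w: "w \<in> V"
      have "g w \<odot>\<^bsub>TT\<^esub> pure_tensor A A (S (xm (pv w))) (S (xm (compl w))) =
        (g w * (s (pv w) * s (compl w))) \<odot>\<^bsub>TT\<^esub> pure_tensor A A (xm w) (xm (pv (compl w)))"
        unfolding S_monom pv_pv
        by (simp only: pure_tensor_scale monom_closed A.vs_simps TA.pure_closed TA.T.vs_simps TA.T.vs_assoc mult.commute[of "s (pv w)"])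
      then show "g w \<odot>\<^bsub>TT\<^esub> pure_tensor A A (S (xm (pv w))) (S (xm (compl w))) =
          g (compl w) \<odot>\<^bsub>TT\<^esub> pure_tensor A A (xm (compl (compl w))) (xm (pv (compl w)))"
        unfolding g_compl[OF w] compl_compl[OF w] .
    qed simp
    also have "\<dots> = (\<Oplus>\<^bsub>TT\<^esub>w\<in>(\<lambda>v. compl v) ` V. g w \<odot>\<^bsub>TT\<^esub> pure_tensor A A (xm (compl w)) (xm (pv w)))"
      by (rule TA.T.add.finprod_reindex[symmetric, OF _ compl_bij(1)]) simp
    also have "\<dots> = D (xm tp)" unfolding compl_bij(2) D_top ..
    finally show ?thesis unfolding 2 S_top ..
  qed
qed

theorem attached_bi_frobenius:
  "bi_frobenius_algebra A D (attached_counit q a) tr (xm tp) S"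
  unfolding bi_frobenius_algebra_def counit_eq
proof (intro conjI ballI)
  show "tr \<in> dual_space A" by (simp add: dual_space_def dual_linear)
qed (rule k_algebra_A finite_dim_A coalgebra_D monom_closed S_eq_sweedler dual_one ep_mult D_one
    frobenius_A frobenius_coalgebra_A S_one S_antimult ep_S D_S; assumption)+

lemma attached_permutation_antipode: "permutation_antipode q a S"
  unfolding permutation_antipode_def
proof (intro exI conjI ballI)
  define p where "p v = (if v \<in> V then pv v else v)" for v
  have pp: "p (p v) = v" for v by (simp add: p_def pv_V pv_pv)
  have "bij_betw p V V" by (rule bij_betw_byWitness[of _ p]) (auto simp: pp p_def pv_V pv_pv)
  then show "p permutes V" by (rule bij_imp_permutes) (simp add: p_def)
  show "S (xm v) = s v \<cdot> xm (p v)" if "v \<in> V" for v using that by (simp add: p_def S_monom)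
qed

end

section \<open>The characterization\<close>

lemma (in bifrob_perm) admissible:
  assumes "\<And>z::'k. z ^ 2 \<noteq> -1" and "(1::'k) \<noteq> -1"
  shows "admissible_perm q a \<pi> \<and> (\<forall>i. h_unit i * h_unit i = 1)"
  by (rule necessary_admissible[OF compat _ gamma_mult q_perm_gamma assms]) (auto simp: pi_involution)

lemma one_neq_minus_one:
  assumes "CHAR('k::field) \<noteq> 2" shows "(1::'k) \<noteq> -1"
proof
  assume "(1::'k) = -1"
  then have "(1::'k) + 1 = 0" by (metis add.right_inverse)
  then have "of_nat 2 = (0::'k)" by simp
  then have dvd: "CHAR('k) dvd 2" by (simp only: of_nat_eq_0_iff_char_dvd)
  then have "CHAR('k) \<le> 2" by (rule dvd_imp_le) simp
  moreover have "CHAR('k) \<noteq> 0" using dvd by (metis dvd_0_left_iff zero_neq_numeral)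
  moreover have "CHAR('k) \<noteq> 1" by simp
  ultimately show False using assms by linarith
qed

theorem theorem7p4:
  fixes q :: "'n::{finite,linorder} \<Rightarrow> 'n \<Rightarrow> 'k::field" and a :: "'n \<Rightarrow> nat"
  assumes "card (UNIV :: 'n set) \<ge> 2"
    and "\<And>i. a i \<ge> 2"
    and "\<And>i. q i i = 1"
    and "\<And>i j. q i j * q j i = 1"
    and "CHAR('k) \<noteq> 2"
    and "\<not> (\<exists>z::'k. z ^ 2 = -1)"
  shows
    "((\<exists>\<Delta> \<epsilon> \<phi> t S. bi_frobenius_algebra (qci q a) \<Delta> \<epsilon> \<phi> t S \<and> permutation_antipode q a S)
       \<longleftrightarrow> (\<forall>x\<in>carrier (qci q a). qci_nakayama q a (qci_nakayama q a x) = x) \<and>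
           (\<exists>\<pi>. admissible_perm q a \<pi>)) \<and>
     ((\<forall>x\<in>carrier (qci q a). qci_nakayama q a (qci_nakayama q a x) = x) \<longrightarrow>
       (\<forall>\<pi>. admissible_perm q a \<pi> \<longrightarrow>
         (\<exists>c. (\<forall>i. c i * c (\<pi> i) = h_coeff q a (unit_vec i)) \<and>
              q_perm q a \<pi> * (\<Prod>i\<in>UNIV. c i ^ (a i - 1)) = 1 \<and>
              bi_frobenius_algebra (qci q a) (attached_comult q a \<pi> c) (attached_counit q a)
                (qci_dual_monom q a (top_exp a)) (qci_monom q a (top_exp a))
                (attached_antipode q a \<pi> c))))"
proof -
  interpret qci_data q a by unfold_locales (rule assms(2), rule assms(3), rule assms(4))
  have ns: "z ^ 2 \<noteq> -1" for z :: 'k using assms(6) by blast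
  note char = one_neq_minus_one[OF assms(5)]
  have suff: "\<exists>c. (\<forall>i. c i * c (\<pi> i) = h_coeff q a (unit_vec i)) \<and>
      q_perm q a \<pi> * (\<Prod>i\<in>UNIV. c i ^ (a i - 1)) = 1 \<and>
      bi_frobenius_algebra (qci q a) (attached_comult q a \<pi> c) (attached_counit q a)
        (qci_dual_monom q a (top_exp a)) (qci_monom q a (top_exp a)) (attached_antipode q a \<pi> c) \<and>
      permutation_antipode q a (attached_antipode q a \<pi> c)"
    if h2: "\<And>i. h_unit i * h_unit i = 1" and adm: "admissible_perm q a \<pi>" for \<pi>
  proof -
    obtain c where c: "\<And>i. c i * c (\<pi> i) = h_unit i" "q_perm q a \<pi> * (\<Prod>i\<in>UNIV. c i ^ (a i - 1)) = 1"
      using exists_coefficients[OF adm h2] by blast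
    have ci: "compatible_perm q a \<pi>" "\<pi> \<circ> \<pi> = id" using adm by (simp_all add: admissible_perm_def)
    have "attached q a \<pi> c"
      by (rule attached.intro[OF qci_data_axioms attached_axioms.intro[OF ci c]])
    then show ?thesis
      using attached.attached_bi_frobenius attached.attached_permutation_antipode c
      unfolding h_coeff_unit by blast
  qed
  have nec: "\<exists>\<pi>. admissible_perm q a \<pi> \<and> (\<forall>i. h_unit i * h_unit i = 1)"
    if bf: "bi_frobenius_algebra (qci q a) \<Delta> \<epsilon> \<phi> t S" and pa: "permutation_antipode q a S" for \<Delta> \<epsilon> \<phi> t S
  proof -
    obtain p c where p: "p permutes exponents a"
      "\<And>v. v \<in> exponents a \<Longrightarrow> S (qci_monom q a v) = c v \<odot>\<^bsub>qci q a\<^esub> qci_monom q a (p v)"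
      using pa unfolding permutation_antipode_def by blast
    have B: "bifrob_perm q a \<Delta> \<epsilon> \<phi> t S p c"
      by (rule bifrob_perm.intro[OF qci_data_axioms bifrob_perm_axioms.intro[OF bf p]])
    show ?thesis using bifrob_perm.admissible[OF B ns char] by blast
  qed
  show ?thesis
    unfolding nakayama_involutive_iff
  proof (intro conjI iffI impI allI)
    assume "\<exists>\<Delta> \<epsilon> \<phi> t S. bi_frobenius_algebra A \<Delta> \<epsilon> \<phi> t S \<and> permutation_antipode q a S"
    then have "\<exists>\<pi>. admissible_perm q a \<pi> \<and> (\<forall>i. h_unit i * h_unit i = 1)" using nec by blast
    then show "\<exists>\<pi>. admissible_perm q a \<pi>" "\<And>i. h_unit i * h_unit i = 1" by blast+
  next
    assume "(\<forall>i. h_unit i * h_unit i = 1) \<and> (\<exists>\<pi>. admissible_perm q a \<pi>)"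
    then show "\<exists>\<Delta> \<epsilon> \<phi> t S. bi_frobenius_algebra A \<Delta> \<epsilon> \<phi> t S \<and> permutation_antipode q a S"
      using suff by blast
  next
    fix \<pi> assume "\<forall>i. h_unit i * h_unit i = 1" "admissible_perm q a \<pi>"
    then show "\<exists>c. (\<forall>i. c i * c (\<pi> i) = h_coeff q a (unit_vec i)) \<and>
        q_perm q a \<pi> * (\<Prod>i\<in>UNIV. c i ^ (a i - 1)) = 1 \<and>
        bi_frobenius_algebra A (attached_comult q a \<pi> c) (attached_counit q a) tr (xm tp) (attached_antipode q a \<pi> c)"
      using suff[of \<pi>] by blast
  qed
qed

end
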